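(* Let $p \geq 3$ be a prime. There exists a field $F$ containing $\mathbb{C}$, with separable closure $F_s$, such that the natural map \[ H^1(\mathrm{Gal}(F_s/F), \mathbf{U}_3(\mathbb{Z}/p^2)) \to H^1(\mathrm{Gal}(F_s/F), \mathbf{U}_3(\mathbb{F}_p)) \] is not surjective.
   Context: For a commutative ring $R$, $\mathbf{U}_3(R)$ denotes the group of $3 \times 3$ upper triangular matrices over $R$ with all diagonal entries equal to $1$. For a profinite group $G$ and a finite group $A$ with trivial $G$-action, $H^1(G,A)$ is the set of continuous homomorphisms $G \to A$ modulo conjugation by elements of $A$ (a homomorphism is continuous if its kernel is open). The natural map is induced by reduction modulo $p$, $\mathbf{U}_3(\mathbb{Z}/p^2) \to \mathbf{U}_3(\mathbb{F}_p)$. *)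

theory Defs
  imports
    Complex_Main
    "HOL-Analysis.Function_Topology"
    "HOL-Algebra.Algebra"
    "HOL-Algebra.Algebraic_Closure_Type"
    "HOL-Number_Theory.Residues"
    "Jordan_Normal_Form.Matrix"
begin

section \<open>Separable closures\<close>

text \<open>
  As in \<^theory>\<open>HOL-Algebra.Polynomials\<close>, a polynomial is the list of its coefficients with
  the leading coefficient first.
\<close>

definition formal_deriv :: "('a, 'b) ring_scheme \<Rightarrow> 'a list \<Rightarrow> 'a list" where
  "formal_deriv R f =
     ring.normalize R (map (\<lambda>i. [i] \<cdot>\<^bsub>R\<^esub> ring.coeff R f i) (rev [1..<length f]))"

definition separable_poly :: "('a, 'b) ring_scheme \<Rightarrow> 'a set \<Rightarrow> 'a list \<Rightarrow> bool" where
  "separable_poly R K f \<longleftrightarrow>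
     f \<in> carrier (K[X]\<^bsub>R\<^esub>) \<and>
     (\<forall>d \<in> carrier (K[X]\<^bsub>R\<^esub>).
        d divides\<^bsub>K[X]\<^bsub>R\<^esub>\<^esub> f \<longrightarrow> d divides\<^bsub>K[X]\<^bsub>R\<^esub>\<^esub> formal_deriv R f \<longrightarrow> d \<in> Units (K[X]\<^bsub>R\<^esub>))"

locale separable_closure = field L + subfield K L for L (structure) and K +
  assumes algebraic_extension: "x \<in> carrier L \<Longrightarrow> (algebraic over K) x"
    and separable_extension: "x \<in> carrier L \<Longrightarrow> separable_poly L K (Irr K x)"
    and separably_closed: "separable_poly L (carrier L) f \<Longrightarrow> splitted f"


section \<open>Galois groups with the Krull topology\<close>

definition galois_group :: "('a, 'b) ring_scheme \<Rightarrow> 'a set \<Rightarrow> ('a \<Rightarrow> 'a) monoid" where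
  "galois_group L K =
     (BijGroup (carrier L))
       \<lparr>carrier := {\<sigma> \<in> Bij (carrier L). \<sigma> \<in> Ring.ring_hom L L \<and> (\<forall>x\<in>K. \<sigma> x = x)}\<rparr>"

definition finite_subextension :: "('a, 'b) ring_scheme \<Rightarrow> 'a set \<Rightarrow> 'a set \<Rightarrow> bool" where
  "finite_subextension L K E \<longleftrightarrow> subfield E L \<and> K \<subseteq> E \<and> ring.finite_dimension L K E"

text \<open>The cosets of the subgroups fixing a finite subextension form a basis of the Krull topology.\<close>

definition krull_topology :: "('a, 'b) ring_scheme \<Rightarrow> 'a set \<Rightarrow> ('a \<Rightarrow> 'a) topology" where
  "krull_topology L K = topology_generated_by
     {\<sigma> <#\<^bsub>galois_group L K\<^esub> carrier (galois_group L E) |\<sigma> E.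
        \<sigma> \<in> carrier (galois_group L K) \<and> finite_subextension L K E}"


section \<open>Nonabelian first cohomology with trivial action\<close>

text \<open>
  Homomorphisms are taken extensional, so that equality in HOL is equality on the group.
\<close>

definition continuous_homs ::
  "('g, 'm) monoid_scheme \<Rightarrow> 'g topology \<Rightarrow> ('a, 'n) monoid_scheme \<Rightarrow> ('g \<Rightarrow> 'a) set" where
  "continuous_homs G T A =
     {f \<in> hom G A. f \<in> extensional (carrier G) \<and> openin T (kernel G A f)}"

definition conj_rel ::
  "('g, 'm) monoid_scheme \<Rightarrow> 'g topology \<Rightarrow> ('a, 'n) monoid_scheme \<Rightarrow> (('g \<Rightarrow> 'a) \<times> ('g \<Rightarrow> 'a)) set" where
  "conj_rel G T A =
     {(f, g). f \<in> continuous_homs G T A \<and> g \<in> continuous_homs G T A \<and>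
        (\<exists>a \<in> carrier A. \<forall>x \<in> carrier G. g x = a \<otimes>\<^bsub>A\<^esub> f x \<otimes>\<^bsub>A\<^esub> inv\<^bsub>A\<^esub> a)}"

definition H1 ::
  "('g, 'm) monoid_scheme \<Rightarrow> 'g topology \<Rightarrow> ('a, 'n) monoid_scheme \<Rightarrow> ('g \<Rightarrow> 'a) set set" where
  "H1 G T A = continuous_homs G T A // conj_rel G T A"

text \<open>
  The map on \<open>H1\<close> induced by a homomorphism \<open>\<phi>\<close> from the first coefficient group to \<open>B\<close> sends
  the class of \<open>f\<close> to the class of \<open>\<phi> \<circ> f\<close>.
\<close>

definition H1_map ::
  "('g, 'm) monoid_scheme \<Rightarrow> 'g topology \<Rightarrow> ('b, 'n) monoid_scheme \<Rightarrow>
     ('a \<Rightarrow> 'b) \<Rightarrow> ('g \<Rightarrow> 'a) set \<Rightarrow> ('g \<Rightarrow> 'b) set" where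
  "H1_map G T B \<phi> c = conj_rel G T B `` (compose (carrier G) \<phi> ` c)"


section \<open>Unitriangular groups\<close>

text \<open>
  The type \<^typ>\<open>'a mat\<close> only serves as a container for square arrays: the product is formed in
  the ring \<open>R\<close> and not with the type class operations on \<^typ>\<open>'a\<close>.
\<close>

definition unitriangular :: "nat \<Rightarrow> ('a, 'b) ring_scheme \<Rightarrow> 'a mat monoid" where
  "unitriangular n R =
     \<lparr>carrier = {A \<in> carrier_mat n n.
        (\<forall>i<n. \<forall>j<n. A $$ (i, j) \<in> carrier R) \<and>
        (\<forall>i<n. A $$ (i, i) = \<one>\<^bsub>R\<^esub>) \<and>
        (\<forall>i<n. \<forall>j<i. A $$ (i, j) = \<zero>\<^bsub>R\<^esub>)},
      monoid.mult = \<lambda>A B. mat n n (\<lambda>(i, j). \<Oplus>\<^bsub>R\<^esub>k\<in>{..<n}. A $$ (i, k) \<otimes>\<^bsub>R\<^esub> B $$ (k, j)),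
      one = mat n n (\<lambda>(i, j). if i = j then \<one>\<^bsub>R\<^esub> else \<zero>\<^bsub>R\<^esub>)\<rparr>"

abbreviation U3_mod :: "nat \<Rightarrow> int mat monoid" where
  "U3_mod m \<equiv> unitriangular 3 (residue_ring (int m))"

definition reduce_mod :: "nat \<Rightarrow> int mat \<Rightarrow> int mat" where
  "reduce_mod p = map_mat (\<lambda>x. x mod int p)"

text \<open>
  HOL cannot quantify over types existentially, so the fields asserted to exist need a fixed
  ambient type.  The type \<^typ>\<open>complex set\<close> is no restriction for them: a homomorphism defined
  over an extension of the complex numbers factors through a finite Galois group, hence descends
  to a subextension of continuum cardinality, and if the descended homomorphism had a lift, so
  would the original one.
\<close>

end

theory Submission
  imports Defs
begin

text \<open>
  The Heisenberg group of order \<open>p\<^sup>3\<close>, generated by \<open>\<sigma>\<close>, \<open>\<tau>\<close> and the central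
  \<open>\<zeta>\<close>, acts on the rational functions \<open>L\<close> over \<open>\<complex>\<close> by cyclic shifts of the
  variables and multiplication by roots of unity. The representation of the Galois group of
  \<open>F = L\<^sup>G\<close> through \<open>Gal(L/F)\<close> does not lift modulo \<open>p\<^sup>2\<close>, not even up to the central
  entry. Let \<open>A\<close>, \<open>B\<close>, \<open>C\<close> be the entries of a lift and \<open>\<omega>\<close> a primitive root of unity of
  order \<open>p\<^sup>2\<close>. Hilbert 90 provides \<open>\<theta>\<close> with \<open>g \<theta> = \<omega>\<^bsup>A(g)\<^esup> \<theta>\<close> for all \<open>g\<close>, and
  \<open>\<eta>\<close> with \<open>g \<eta> = \<omega>\<^bsup>C(g)\<^esup> \<eta>\<close> on the subgroup where \<open>A\<close> and \<open>B\<close> vanish modulo \<open>p\<close>,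
  because \<open>C\<close> is additive there. Up to a constant, \<open>z = \<theta> \<eta> / \<sigma> \<eta>\<close> is then a
  \<open>\<zeta>\<close>-invariant element of \<open>L\<close> whose norm along \<open>\<sigma>\<close> is a multiple of \<open>\<theta>\<^sup>p\<close>, hence an
  eigenvector of \<open>\<tau>\<close> whose eigenvalue is a primitive \<open>p\<close>-th root of unity. Unique factorization
  in the polynomial ring forbids this: such a norm is a product of \<open>\<tau>\<close>-invariant blocks.
\<close>

text \<open>The base field contains all roots of unity, so by Kummer theory each superdiagonal entry
  lifts on its own; what can fail is the corner entry, the vanishing of the cup product of the two
  lifts, and the norm relation for \<open>z\<close> is what that vanishing would force. Only the
  superdiagonal entries modulo p are compared. Conjugation does not change them, so the failure
  passes from the homomorphism to its class.

  The first p variables carry the representation in which \<zeta> acts by a scalar and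
  \<tau>\<sigma> = \<sigma>\<tau>\<zeta>. For a \<zeta>-eigenvector this makes \<tau> commute with
  the norm along \<sigma> up to the eigenvalue raised to the power p(p-1)/2, which is 1 because p is
  odd. Prime factors of a \<zeta>-invariant element need not be eigenvectors of \<zeta> themselves,
  so the induction removes the least \<zeta>-eigenvector divisible by a prime instead of the prime.

  The algebra is done in types. An injection of the algebraic closure into
  \<open>complex set\<close> then moves it to rings with explicit carriers, where Galois groups and
  the Krull topology live.\<close>

hide_const (open) Polynomials.degree Polynomials.lead_coeff up_ring.coeff up_ring.monom
  Divisibility.prime Divisibility.irreducible

section \<open>Unique factorization in polynomial rings\<close>

text \<open>Ring notions are relative to a subset of a type because the rings in n variables, for
  growing n, are to sit inside one type of polynomial functions.\<close>

definition subring_set :: "'a::comm_ring_1 set \<Rightarrow> bool" where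
  "subring_set A \<longleftrightarrow> 1 \<in> A \<and> (\<forall>x\<in>A. \<forall>y\<in>A. x - y \<in> A \<and> x * y \<in> A)"

definition dvd_in :: "'a::comm_ring_1 set \<Rightarrow> 'a \<Rightarrow> 'a \<Rightarrow> bool" where
  "dvd_in A a b \<longleftrightarrow> (\<exists>c\<in>A. b = a * c)"

definition prime_in :: "'a::comm_ring_1 set \<Rightarrow> 'a \<Rightarrow> bool" where
  "prime_in A q \<longleftrightarrow> q \<in> A \<and> q \<noteq> 0 \<and> \<not> dvd_in A q 1 \<and>
     (\<forall>f\<in>A. \<forall>g\<in>A. dvd_in A q (f * g) \<longrightarrow> dvd_in A q f \<or> dvd_in A q g)"

definition ufd_in :: "'a::comm_ring_1 set \<Rightarrow> bool" where
  "ufd_in A \<longleftrightarrow> subring_set A \<and>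
     (\<forall>f\<in>A. f \<noteq> 0 \<longrightarrow>
        (\<exists>u qs. u \<in> A \<and> dvd_in A u 1 \<and> (\<forall>q\<in>set qs. prime_in A q) \<and> f = u * prod_list qs))"

definition polys_in :: "'a::comm_ring_1 set \<Rightarrow> 'a poly set" where
  "polys_in A = {F. \<forall>i. coeff F i \<in> A}"

lemma subring_set_closed:
  assumes "subring_set A"
  shows "0 \<in> A" "1 \<in> A" "x \<in> A \<Longrightarrow> - x \<in> A" "x \<in> A \<Longrightarrow> y \<in> A \<Longrightarrow> x + y \<in> A"
    "x \<in> A \<Longrightarrow> y \<in> A \<Longrightarrow> x - y \<in> A" "x \<in> A \<Longrightarrow> y \<in> A \<Longrightarrow> x * y \<in> A"
proof -
  show one: "1 \<in> A" and diff: "x \<in> A \<Longrightarrow> y \<in> A \<Longrightarrow> x - y \<in> A"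
    and "x \<in> A \<Longrightarrow> y \<in> A \<Longrightarrow> x * y \<in> A" for x y
    using assms by (auto simp: subring_set_def)
  show zero: "0 \<in> A"
    using diff[OF one one] by simp
  show neg: "x \<in> A \<Longrightarrow> - x \<in> A" for x
    using diff[OF zero, of x] by simp
  show "x \<in> A \<Longrightarrow> y \<in> A \<Longrightarrow> x + y \<in> A"
    using diff[of x "- y"] neg[of y] by simp
qed

lemma subring_set_sum:
  assumes "subring_set A" "\<And>i. i \<in> I \<Longrightarrow> f i \<in> A"
  shows "sum f I \<in> A"
  using assms(2)
  by (induction I rule: infinite_finite_induct) (auto simp: subring_set_closed[OF assms(1)])

lemma subring_set_power: "subring_set A \<Longrightarrow> x \<in> A \<Longrightarrow> x ^ n \<in> A"
  by (induction n) (auto simp: subring_set_closed)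

lemma subring_set_prod_list:
  "subring_set A \<Longrightarrow> (\<And>x. x \<in> set xs \<Longrightarrow> x \<in> A) \<Longrightarrow> prod_list xs \<in> A"
  by (induction xs) (auto simp: subring_set_closed)

lemma coeff_polys_in: "F \<in> polys_in A \<Longrightarrow> coeff F i \<in> A"
  by (simp add: polys_in_def)

lemma subring_set_polys_in:
  assumes "subring_set A"
  shows "subring_set (polys_in A)"
  unfolding subring_set_def[of "polys_in A"]
  by (auto simp: polys_in_def coeff_mult subring_set_closed[OF assms] of_bool_def
      intro!: subring_set_sum[OF assms])

lemma const_polys_in: "subring_set A \<Longrightarrow> c \<in> A \<Longrightarrow> [:c:] \<in> polys_in A"
  by (auto simp: polys_in_def coeff_pCons subring_set_closed split: nat.splits)

lemma monom_polys_in: "subring_set A \<Longrightarrow> c \<in> A \<Longrightarrow> Polynomial.monom c n \<in> polys_in A"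
  by (auto simp: polys_in_def subring_set_closed)

lemma smult_polys_in: "subring_set A \<Longrightarrow> c \<in> A \<Longrightarrow> F \<in> polys_in A \<Longrightarrow> smult c F \<in> polys_in A"
  by (auto simp: polys_in_def subring_set_closed)

lemma dvd_in_refl: "subring_set A \<Longrightarrow> dvd_in A x x"
  by (auto simp: dvd_in_def subring_set_closed intro!: bexI[of _ 1])

lemma dvd_in_trans: "subring_set A \<Longrightarrow> dvd_in A x y \<Longrightarrow> dvd_in A y z \<Longrightarrow> dvd_in A x z"
  by (auto simp: dvd_in_def mult.assoc subring_set_closed)

lemma dvd_in_mult: "subring_set A \<Longrightarrow> dvd_in A x y \<Longrightarrow> z \<in> A \<Longrightarrow> dvd_in A x (y * z)"
  by (auto simp: dvd_in_def mult.assoc subring_set_closed)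

lemma dvd_in_add: "subring_set A \<Longrightarrow> dvd_in A x y \<Longrightarrow> dvd_in A x z \<Longrightarrow> dvd_in A x (y + z)"
  unfolding dvd_in_def
proof safe
  fix c d assume "subring_set A" "c \<in> A" "d \<in> A"
  then show "\<exists>e\<in>A. x * c + x * d = x * e"
    by (intro bexI[of _ "c + d"]) (auto simp: algebra_simps subring_set_closed)
qed

lemma dvd_in_diff: "subring_set A \<Longrightarrow> dvd_in A x y \<Longrightarrow> dvd_in A x z \<Longrightarrow> dvd_in A x (y - z)"
  unfolding dvd_in_def
proof safe
  fix c d assume "subring_set A" "c \<in> A" "d \<in> A"
  then show "\<exists>e\<in>A. x * c - x * d = x * e"
    by (intro bexI[of _ "c - d"]) (auto simp: algebra_simps subring_set_closed)
qed

lemma dvd_in_zero: "subring_set A \<Longrightarrow> dvd_in A x 0"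
  by (auto simp: dvd_in_def subring_set_closed intro!: bexI[of _ 0])

lemma dvd_in_sum:
  "subring_set A \<Longrightarrow> (\<And>i. i \<in> I \<Longrightarrow> dvd_in A x (f i)) \<Longrightarrow> dvd_in A x (sum f I)"
  by (induction I rule: infinite_finite_induct) (auto simp: dvd_in_add dvd_in_zero)

section \<open>Gauss's lemma and unique factorization of polynomials\<close>

lemma dvd_in_const_iff:
  fixes c :: "'a::idom"
  assumes "subring_set A"
  shows "dvd_in (polys_in A) [:c:] F \<longleftrightarrow> (\<forall>i. dvd_in A c (coeff F i))"
proof
  assume "dvd_in (polys_in A) [:c:] F"
  then show "\<forall>i. dvd_in A c (coeff F i)"
    by (auto simp: dvd_in_def polys_in_def)
next
  assume "\<forall>i. dvd_in A c (coeff F i)"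
  then obtain h where h: "\<And>i. h i \<in> A \<and> coeff F i = c * h i"
    unfolding dvd_in_def by metis
  define G where "G = (\<Sum>i\<le>Polynomial.degree F. Polynomial.monom (h i) i)"
  have "F = [:c:] * G"
  proof (rule poly_eqI)
    fix i
    show "coeff F i = coeff ([:c:] * G) i"
      using h[of i] by (auto simp: G_def coeff_sum sum.delta coeff_eq_0)
  qed
  moreover have "G \<in> polys_in A"
    unfolding G_def using h assms
    by (intro subring_set_sum subring_set_polys_in monom_polys_in) auto
  ultimately show "dvd_in (polys_in A) [:c:] F"
    by (auto simp: dvd_in_def)
qed

text \<open>Gauss's lemma: if q divides neither F nor G, take the first coefficients that q does not
  divide, at m and n. In the coefficient of the product at m + n every other summand is divisible by
  q.\<close>

lemma prime_in_const:
  fixes q :: "'a::idom"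
  assumes A: "subring_set A" and q: "prime_in A q"
  shows "prime_in (polys_in A) [:q:]"
proof -
  have "\<not> dvd_in (polys_in A) [:q:] 1"
    using q by (auto simp: dvd_in_const_iff[OF A] prime_in_def intro!: exI[of _ 0])
  moreover have "dvd_in (polys_in A) [:q:] F \<or> dvd_in (polys_in A) [:q:] G"
    if F: "F \<in> polys_in A" and G: "G \<in> polys_in A" and d: "dvd_in (polys_in A) [:q:] (F * G)" for F G
  proof (rule ccontr)
    assume "\<not> ?thesis"
    then have "\<exists>i. \<not> dvd_in A q (coeff F i)" "\<exists>i. \<not> dvd_in A q (coeff G i)"
      by (auto simp: dvd_in_const_iff[OF A])
    then obtain m n where m: "\<not> dvd_in A q (coeff F m)" "\<And>i. i < m \<Longrightarrow> dvd_in A q (coeff F i)"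
      and n: "\<not> dvd_in A q (coeff G n)" "\<And>i. i < n \<Longrightarrow> dvd_in A q (coeff G i)"
      using exists_least_iff[of "\<lambda>i. \<not> dvd_in A q (coeff F i)"]
        exists_least_iff[of "\<lambda>i. \<not> dvd_in A q (coeff G i)"] by blast
    let ?t = "\<lambda>i. coeff F i * coeff G (m + n - i)"
    have "dvd_in A q (\<Sum>i\<in>{..m + n} - {m}. ?t i)"
    proof (rule dvd_in_sum[OF A])
      fix i assume "i \<in> {..m + n} - {m}"
      then consider "i < m" | "m + n - i < n" by force
      then show "dvd_in A q (?t i)"
        using dvd_in_mult[OF A m(2), of i "coeff G (m + n - i)"]
          dvd_in_mult[OF A n(2), of "m + n - i" "coeff F i"] coeff_polys_in[OF F] coeff_polys_in[OF G]
        by cases (auto simp: mult.commute)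
    qed
    moreover have "dvd_in A q (\<Sum>i\<le>m + n. ?t i)"
      using d by (auto simp: dvd_in_const_iff[OF A] coeff_mult)
    ultimately have "dvd_in A q ((\<Sum>i\<le>m + n. ?t i) - (\<Sum>i\<in>{..m + n} - {m}. ?t i))"
      using dvd_in_diff[OF A] by blast
    also have "(\<Sum>i\<le>m + n. ?t i) - (\<Sum>i\<in>{..m + n} - {m}. ?t i) = coeff F m * coeff G n"
      by (subst sum.remove[of _ m]) auto
    finally show False
      using q m(1) n(1) coeff_polys_in[OF F] coeff_polys_in[OF G] by (auto simp: prime_in_def)
  qed
  ultimately show ?thesis
    using q const_polys_in[OF A] by (auto simp: prime_in_def)
qed

text \<open>The leading coefficient of U need not be a unit. Each reduction step therefore
  multiplies F by it before the leading term is cancelled, which accounts for the power.\<close>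

lemma pseudo_division:
  fixes U :: "'a::idom poly"
  assumes A: "subring_set A" and U: "U \<in> polys_in A" "U \<noteq> 0" and F: "F \<in> polys_in A"
  shows "\<exists>k Q R. Q \<in> polys_in A \<and> R \<in> polys_in A \<and>
    smult (lead_coeff U ^ k) F = Q * U + R \<and> (R = 0 \<or> Polynomial.degree R < Polynomial.degree U)"
  using F
proof (induction "Polynomial.degree F" arbitrary: F rule: less_induct)
  case less
  note PA = subring_set_polys_in[OF A]
  show ?case
  proof (cases "F = 0 \<or> Polynomial.degree F < Polynomial.degree U")
    case True
    then show ?thesis
      using less.prems subring_set_closed[OF PA] by (intro exI[of _ 0] exI[of _ 0] exI[of _ F]) auto
  next
    case False
    define l where "l = lead_coeff U"
    define M where "M = Polynomial.monom (lead_coeff F) (Polynomial.degree F - Polynomial.degree U)"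
    define G where "G = smult l F - M * U"
    have M: "M \<in> polys_in A"
      using less.prems by (auto simp: M_def coeff_polys_in intro!: monom_polys_in[OF A])
    have l: "l \<in> A"
      using U by (auto simp: l_def coeff_polys_in)
    have G: "G \<in> polys_in A"
      unfolding G_def using M l U less.prems
      by (intro subring_set_closed[OF PA] smult_polys_in[OF A]) auto
    have M0: "M \<noteq> 0" using False by (auto simp: M_def)
    have dM: "Polynomial.degree M = Polynomial.degree F - Polynomial.degree U" "lead_coeff M = lead_coeff F"
      using False by (simp_all add: M_def degree_monom_eq)
    have degM: "Polynomial.degree (M * U) = Polynomial.degree F"
      using False M0 U(2) dM(1) by (simp add: degree_mult_eq)
    have "lead_coeff (M * U) = lead_coeff F * l"
      by (simp only: lead_coeff_mult dM(2) l_def)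
    then have cz: "coeff G (Polynomial.degree F) = 0"
      by (simp add: G_def flip: degM)
    have "Polynomial.degree G \<le> Polynomial.degree F"
      unfolding G_def using degM by (intro degree_diff_le) auto
    then have "G = 0 \<or> Polynomial.degree G < Polynomial.degree F"
      using cz by (metis leading_coeff_0_iff order_le_imp_less_or_eq)
    then have "\<exists>k Q R. Q \<in> polys_in A \<and> R \<in> polys_in A \<and>
      smult (l ^ k) G = Q * U + R \<and> (R = 0 \<or> Polynomial.degree R < Polynomial.degree U)"
    proof
      assume "G = 0"
      then show ?thesis
        using subring_set_closed[OF PA] by (intro exI[of _ 0] exI[of _ 0]) auto
    next
      assume "Polynomial.degree G < Polynomial.degree F"
      then show ?thesis
        unfolding l_def using less.hyps G by blast
    qed
    then obtain k Q R where QR: "Q \<in> polys_in A" "R \<in> polys_in A"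
      "smult (l ^ k) G = Q * U + R" "R = 0 \<or> Polynomial.degree R < Polynomial.degree U"
      by blast
    have "smult (l ^ Suc k) F = (Q + smult (l ^ k) M) * U + R"
      using QR(3) by (simp add: G_def smult_diff_right algebra_simps smult_add_right)
    moreover have "Q + smult (l ^ k) M \<in> polys_in A"
      using QR(1) M l by (intro subring_set_closed[OF PA] smult_polys_in[OF A] subring_set_power[OF A])
    ultimately show ?thesis
      using QR l_def by blast
  qed
qed

lemma smult_left_cancel:
  fixes F G :: "'a::idom poly"
  assumes "smult q F = smult q G" "q \<noteq> 0"
  shows "F = G"
proof -
  have "smult q (F - G) = 0"
    using assms(1) by (simp add: smult_diff_right)
  then show ?thesis
    using assms(2) by simp
qed

text \<open>The primes of the constant divide Q or U by Gauss's lemma and are cancelled one at a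
  time. This turns a factorization of F over the fraction field into one over A, while the fraction
  field itself never appears.\<close>

lemma split_const_divisor:
  fixes F :: "'a::idom poly"
  assumes A: "subring_set A" and qs: "\<forall>q\<in>set qs. prime_in A q"
    and u: "u \<in> A" "dvd_in A u 1" and F: "F \<in> polys_in A"
    and Q: "Q \<in> polys_in A" and U: "U \<in> polys_in A"
    and eq: "smult (u * prod_list qs) F = Q * U"
  shows "\<exists>c1 c2 Q' U'. c1 \<in> A \<and> c2 \<in> A \<and> Q' \<in> polys_in A \<and> U' \<in> polys_in A \<and>
    Q = smult c1 Q' \<and> U = smult c2 U' \<and> F = Q' * U'"
  using qs Q U eq
proof (induction qs arbitrary: Q U)
  case Nil
  obtain v where v: "v \<in> A" "u * v = 1"
    using u by (auto simp: dvd_in_def)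
  have "smult v (smult u F) = smult v (Q * U)"
    using Nil.prems(4) by simp
  then have "F = smult v Q * U"
    using v(2) by (simp add: mult.commute)
  moreover have "Q = smult u (smult v Q)"
    using v by simp
  ultimately show ?case
    using Nil.prems u v subring_set_closed(2)[OF A] smult_polys_in[OF A]
    by (intro exI[of _ u] exI[of _ 1] exI[of _ "smult v Q"] exI[of _ U]) auto
next
  case (Cons q qs)
  note PA = subring_set_polys_in[OF A]
  have q: "prime_in A q" and q0: "q \<noteq> 0" and qA: "q \<in> A"
    using Cons.prems by (auto simp: prime_in_def)
  have "u * prod_list qs \<in> A"
    using Cons.prems u by (intro subring_set_closed[OF A] subring_set_prod_list[OF A])
      (auto simp: prime_in_def)
  then have "smult (u * prod_list qs) F \<in> polys_in A"
    using F by (intro smult_polys_in[OF A])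
  moreover have "Q * U = [:q:] * smult (u * prod_list qs) F"
    using Cons.prems(4) by (simp add: algebra_simps)
  ultimately have "dvd_in (polys_in A) [:q:] (Q * U)"
    unfolding dvd_in_def by blast
  then consider "dvd_in (polys_in A) [:q:] Q" | "dvd_in (polys_in A) [:q:] U"
    using prime_in_const[OF A q] Cons.prems by (auto simp: prime_in_def)
  then show ?case
  proof cases
    case 1
    then obtain Q1 where Q1: "Q1 \<in> polys_in A" "Q = smult q Q1"
      by (auto simp: dvd_in_def)
    have "smult q (smult (u * prod_list qs) F) = smult q (Q1 * U)"
      using Cons.prems(4) Q1 by (simp add: algebra_simps)
    then have "smult (u * prod_list qs) F = Q1 * U"
      using q0 by (rule smult_left_cancel)
    then obtain c1 c2 Q' U' where "c1 \<in> A" "c2 \<in> A" "Q' \<in> polys_in A" "U' \<in> polys_in A"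
      "Q1 = smult c1 Q'" "U = smult c2 U'" "F = Q' * U'"
      using Cons.IH[OF _ Q1(1) Cons.prems(3)] Cons.prems(1) by auto
    then show ?thesis
      using Q1 qA subring_set_closed(6)[OF A]
      by (intro exI[of _ "q * c1"] exI[of _ c2] exI[of _ Q'] exI[of _ U']) auto
  next
    case 2
    then obtain U1 where U1: "U1 \<in> polys_in A" "U = smult q U1"
      by (auto simp: dvd_in_def)
    have "smult q (smult (u * prod_list qs) F) = smult q (Q * U1)"
      using Cons.prems(4) U1 by (simp add: algebra_simps)
    then have "smult (u * prod_list qs) F = Q * U1"
      using q0 by (rule smult_left_cancel)
    then obtain c1 c2 Q' U' where "c1 \<in> A" "c2 \<in> A" "Q' \<in> polys_in A" "U' \<in> polys_in A"
      "Q = smult c1 Q'" "U1 = smult c2 U'" "F = Q' * U'"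
      using Cons.IH[OF _ Cons.prems(2) U1(1)] Cons.prems(1) by auto
    then show ?thesis
      using U1 qA subring_set_closed(6)[OF A]
      by (intro exI[of _ c1] exI[of _ "q * c2"] exI[of _ Q'] exI[of _ U']) auto
  qed
qed

lemma ufd_in_subring: "ufd_in A \<Longrightarrow> subring_set A"
  by (simp add: ufd_in_def)

lemma ufd_in_prime_divisor:
  assumes A: "ufd_in A" and c: "c \<in> A" "c \<noteq> 0" "\<not> dvd_in A c 1"
  shows "\<exists>q. prime_in A q \<and> dvd_in A q c"
proof -
  obtain u qs where u: "u \<in> A" "dvd_in A u 1" and qs: "\<forall>q\<in>set qs. prime_in A q"
    and eq: "c = u * prod_list qs"
    using A c by (auto simp: ufd_in_def)
  have "qs \<noteq> []"
    using eq u c by auto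
  then obtain q qs' where Cons: "qs = q # qs'"
    by (cases qs) auto
  have "u * prod_list qs' \<in> A"
    using u qs Cons by (intro subring_set_closed[OF ufd_in_subring[OF A]]
        subring_set_prod_list[OF ufd_in_subring[OF A]]) (auto simp: prime_in_def)
  then have "dvd_in A q c"
    unfolding eq Cons dvd_in_def by (intro bexI[of _ "u * prod_list qs'"]) auto
  then show ?thesis
    using qs Cons by auto
qed

text \<open>The constant c is split between F and its cofactor. The part c1 taken from F divides F,
  which has no constant prime divisor, so c1 is a unit.\<close>

lemma cancel_const_multiple:
  fixes F :: "'a::idom poly"
  assumes A: "ufd_in A" and F: "F \<in> polys_in A" "F \<noteq> 0"
    and prim: "\<not> (\<exists>q. prime_in A q \<and> dvd_in (polys_in A) [:q:] F)"
    and c: "c \<in> A" "c \<noteq> 0" and G: "G \<in> polys_in A" and d: "dvd_in (polys_in A) F (smult c G)"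
  shows "dvd_in (polys_in A) F G"
proof -
  note S = ufd_in_subring[OF A]
  obtain u qs where u: "u \<in> A" "dvd_in A u 1" and qs: "\<forall>q\<in>set qs. prime_in A q"
    and eq: "c = u * prod_list qs"
    using A c by (auto simp: ufd_in_def)
  obtain W where W: "W \<in> polys_in A" "smult c G = F * W"
    using d by (auto simp: dvd_in_def)
  obtain c1 c2 F' W' where s: "c1 \<in> A" "c2 \<in> A" "F' \<in> polys_in A" "W' \<in> polys_in A"
    "F = smult c1 F'" "W = smult c2 W'" "G = F' * W'"
    using split_const_divisor[OF S qs u G F(1) W(1)] W(2) eq by blast
  have "dvd_in A c1 1"
  proof (rule ccontr)
    assume "\<not> dvd_in A c1 1"
    then obtain q where q: "prime_in A q" "dvd_in A q c1"
      using ufd_in_prime_divisor[OF A s(1)] s F(2) by auto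
    then have "dvd_in (polys_in A) [:q:] F"
      using s(5) coeff_polys_in[OF s(3)] dvd_in_mult[OF S q(2)] by (auto simp: dvd_in_const_iff[OF S])
    then show False
      using prim q by blast
  qed
  then obtain v where v: "v \<in> A" "c1 * v = 1"
    by (auto simp: dvd_in_def)
  have "F * smult v W' = smult (c1 * v) (F' * W')"
    using s(5) by (simp add: mult.commute)
  then have "G = F * smult v W'"
    using v(2) s(7) by simp
  then show ?thesis
    using smult_polys_in[OF S v(1) s(4)] unfolding dvd_in_def by blast
qed

text \<open>If F does not divide G, irreducibility forces the ideal generated by F and G to contain
  a nonzero constant c2. Its Bezout relation multiplied by H shows that F divides c2 H, and F, being
  free of constant primes, divides H.\<close>

lemma prime_in_of_irreducible_poly:
  fixes F :: "'a::idom poly"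
  assumes A: "ufd_in A" and F: "F \<in> polys_in A" "0 < Polynomial.degree F"
    and prim: "\<not> (\<exists>q. prime_in A q \<and> dvd_in (polys_in A) [:q:] F)"
    and irr: "\<And>G H. G \<in> polys_in A \<Longrightarrow> H \<in> polys_in A \<Longrightarrow> F = G * H \<Longrightarrow>
      dvd_in (polys_in A) G 1 \<or> dvd_in (polys_in A) H 1"
  shows "prime_in (polys_in A) F"
proof -
  note S = ufd_in_subring[OF A]
  note PS = subring_set_polys_in[OF S]
  have F0: "F \<noteq> 0"
    using F by auto
  have cancel: "dvd_in (polys_in A) F G"
    if "c \<in> A" "c \<noteq> 0" "G \<in> polys_in A" "dvd_in (polys_in A) F (smult c G)" for c G
    using cancel_const_multiple[OF A F(1) F0 prim] that by blast
  have "\<not> dvd_in (polys_in A) F 1"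
  proof
    assume "dvd_in (polys_in A) F 1"
    then have "F dvd 1"
      unfolding dvd_in_def dvd_def by blast
    then show False
      using F(2) by (metis degree_1 dvd_imp_degree_le le_zero_eq less_irrefl zero_neq_one)
  qed
  moreover have "dvd_in (polys_in A) F H"
    if G: "G \<in> polys_in A" and H: "H \<in> polys_in A" and d: "dvd_in (polys_in A) F (G * H)"
      and nd: "\<not> dvd_in (polys_in A) F G" for G H
  proof -
    define J where "J = {P * F + Q * G |P Q. P \<in> polys_in A \<and> Q \<in> polys_in A}"
    have J: "V \<in> polys_in A" if "V \<in> J" for V
      using that F G subring_set_closed[OF PS] by (auto simp: J_def)
    have FJ: "F \<in> J"
      unfolding J_def using subring_set_closed(1,2)[OF PS]
      by (intro CollectI exI[of _ 1] exI[of _ 0]) auto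
    have GJ: "G \<in> J"
      unfolding J_def using subring_set_closed(1,2)[OF PS]
      by (intro CollectI exI[of _ 0] exI[of _ 1]) auto
    \<comment> \<open>Least degree makes U a greatest common divisor of F and G over the fraction
      field; \<open>div\<close> below is the division by it.\<close>
    obtain U where U: "U \<in> J" "U \<noteq> 0"
      and min: "\<And>V. V \<in> J \<Longrightarrow> V \<noteq> 0 \<Longrightarrow> Polynomial.degree U \<le> Polynomial.degree V"
      using ex_has_least_nat[of "\<lambda>V. V \<in> J \<and> V \<noteq> 0" F Polynomial.degree] FJ F0 by blast
    have UP: "U \<in> polys_in A"
      using U J by blast
    have div: "\<exists>c Q. c \<in> A \<and> c \<noteq> 0 \<and> Q \<in> polys_in A \<and> smult c V = Q * U" if V: "V \<in> J" for V
    proof -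
      obtain k Q R where kQR: "Q \<in> polys_in A" "R \<in> polys_in A"
        "smult (lead_coeff U ^ k) V = Q * U + R" "R = 0 \<or> Polynomial.degree R < Polynomial.degree U"
        using pseudo_division[OF S UP U(2) J[OF V]] by blast
      have lc: "lead_coeff U ^ k \<in> A"
        using coeff_polys_in[OF UP] by (intro subring_set_power[OF S])
      obtain P1 Q1 P2 Q2 where PQ: "V = P1 * F + Q1 * G" "U = P2 * F + Q2 * G"
        "P1 \<in> polys_in A" "Q1 \<in> polys_in A" "P2 \<in> polys_in A" "Q2 \<in> polys_in A"
        using V U(1) by (auto simp: J_def)
      have "R = smult (lead_coeff U ^ k) V - Q * U"
        using kQR(3) by simp
      also have "\<dots> = (smult (lead_coeff U ^ k) P1 - Q * P2) * F + (smult (lead_coeff U ^ k) Q1 - Q * Q2) * G"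
        unfolding PQ(1) by (subst (2) PQ(2)) (simp add: algebra_simps smult_add_right)
      finally have R: "R = (smult (lead_coeff U ^ k) P1 - Q * P2) * F +
          (smult (lead_coeff U ^ k) Q1 - Q * Q2) * G" .
      have "smult (lead_coeff U ^ k) P1 - Q * P2 \<in> polys_in A"
        "smult (lead_coeff U ^ k) Q1 - Q * Q2 \<in> polys_in A"
        using kQR(1) PQ(3-6) lc by (auto intro!: subring_set_closed[OF PS] smult_polys_in[OF S])
      then have "R \<in> J"
        unfolding J_def using R by blast
      then have "R = 0"
        using min kQR(4) by (meson leD)
      then show ?thesis
        using kQR U(2) lc by (intro exI[of _ "lead_coeff U ^ k"] exI[of _ Q]) auto
    qed
    obtain c Q where cQ: "c \<in> A" "c \<noteq> 0" "Q \<in> polys_in A" "smult c F = Q * U"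
      using div[OF FJ] by blast
    obtain u qs where u: "u \<in> A" "dvd_in A u 1" and qs: "\<forall>q\<in>set qs. prime_in A q"
      and eq: "c = u * prod_list qs"
      using A cQ by (auto simp: ufd_in_def)
    obtain c1 c2 Q' U' where s: "c1 \<in> A" "c2 \<in> A" "Q' \<in> polys_in A" "U' \<in> polys_in A"
      "Q = smult c1 Q'" "U = smult c2 U'" "F = Q' * U'"
      using split_const_divisor[OF S qs u F(1) cQ(3) UP] cQ(4) eq by blast
    \<comment> \<open>A unit Q' would make U' an associate of F, so that F divides a constant
      multiple of G.\<close>
    have "\<not> dvd_in (polys_in A) Q' 1"
    proof
      assume "dvd_in (polys_in A) Q' 1"
      then obtain Y where Y: "Y \<in> polys_in A" "Q' * Y = 1"
        by (auto simp: dvd_in_def)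
      obtain c' Q'' where c': "c' \<in> A" "c' \<noteq> 0" "Q'' \<in> polys_in A" "smult c' G = Q'' * U"
        using div[OF GJ] by blast
      have "Y * F = (Q' * Y) * U'"
        unfolding s(7) by (simp only: mult.assoc mult.left_commute)
      then have "U' = Y * F"
        unfolding Y(2) by simp
      then have "smult c' G = F * (smult c2 (Q'' * Y))"
        using c'(4) s(6) by (simp add: algebra_simps)
      moreover have "smult c2 (Q'' * Y) \<in> polys_in A"
        using c' s Y by (intro smult_polys_in[OF S] subring_set_closed[OF PS])
      ultimately have "dvd_in (polys_in A) F (smult c' G)"
        unfolding dvd_in_def by blast
      then show False
        using cancel[OF c'(1,2) G] nd by blast
    qed
    then obtain Y where Y: "Y \<in> polys_in A" "U' * Y = 1"
      using irr[OF s(3,4,7)] by (auto simp: dvd_in_def)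
    obtain P1 Q1 where PQ: "U = P1 * F + Q1 * G" "P1 \<in> polys_in A" "Q1 \<in> polys_in A"
      using U(1) by (auto simp: J_def)
    obtain W where W: "W \<in> polys_in A" "G * H = F * W"
      using d by (auto simp: dvd_in_def)
    have "smult c2 H = smult c2 (U' * Y) * H"
      using Y(2) by simp
    also have "\<dots> = Y * H * U"
      using s(6) by (simp add: algebra_simps)
    also have "\<dots> = Y * P1 * H * F + Y * Q1 * (G * H)"
      unfolding PQ(1) by (simp add: algebra_simps)
    also have "\<dots> = F * (Y * P1 * H + Y * Q1 * W)"
      unfolding W(2) by (simp add: algebra_simps)
    finally have "dvd_in (polys_in A) F (smult c2 H)"
      using Y PQ W H unfolding dvd_in_def
      by (intro bexI[of _ "Y * P1 * H + Y * Q1 * W"]) (auto intro!: subring_set_closed[OF PS])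
    moreover have "c2 \<noteq> 0"
      using U(2) s(6) by auto
    ultimately show ?thesis
      using cancel[OF s(2) _ H] by blast
  qed
  ultimately show ?thesis
    using F F0 unfolding prime_in_def by blast
qed

text \<open>Induction on the degree and, for equal degree, on the number of primes in the leading
  coefficient. A constant prime factor of F lowers the second count; in its absence F is a constant,
  a prime, or a product of two factors of smaller degree.\<close>

lemma ufd_in_polys_in:
  fixes A :: "'a::idom set"
  assumes A: "ufd_in A"
  shows "ufd_in (polys_in A)"
proof -
  note S = ufd_in_subring[OF A]
  note PS = subring_set_polys_in[OF S]
  define fac where "fac F \<longleftrightarrow> (\<exists>u qs. u \<in> polys_in A \<and> dvd_in (polys_in A) u 1 \<and>
    (\<forall>q\<in>set qs. prime_in (polys_in A) q) \<and> F = u * prod_list qs)" for F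
  have fac_mult: "fac (F * G)" if FG: "fac F" "fac G" for F G
  proof -
    obtain u qs where u: "u \<in> polys_in A" "dvd_in (polys_in A) u 1"
      "\<forall>q\<in>set qs. prime_in (polys_in A) q" "F = u * prod_list qs"
      using FG(1) unfolding fac_def by blast
    obtain v rs where v: "v \<in> polys_in A" "dvd_in (polys_in A) v 1"
      "\<forall>q\<in>set rs. prime_in (polys_in A) q" "G = v * prod_list rs"
      using FG(2) unfolding fac_def by blast
    obtain u' v' where "u' \<in> polys_in A" "v' \<in> polys_in A" "u * u' = 1" "v * v' = 1"
      using u(2) v(2) by (auto simp: dvd_in_def)
    then have "dvd_in (polys_in A) (u * v) 1"
      unfolding dvd_in_def using subring_set_closed(6)[OF PS]
      by (intro bexI[of _ "u' * v'"]) (simp add: mult.assoc mult.left_commute[of v], blast)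
    then show ?thesis
      unfolding fac_def using u v subring_set_closed(6)[OF PS]
      by (intro exI[of _ "u * v"] exI[of _ "qs @ rs"]) (auto simp: algebra_simps)
  qed
  have fac_prime: "fac F" if "prime_in (polys_in A) F" for F
    unfolding fac_def using that subring_set_closed(2)[OF PS] dvd_in_refl[OF PS]
    by (intro exI[of _ 1] exI[of _ "[F]"]) auto
  have fac_unit: "fac F" if "F \<in> polys_in A" "dvd_in (polys_in A) F 1" for F
    unfolding fac_def using that by (intro exI[of _ F] exI[of _ "[]"]) auto
  have fac_const: "fac [:c:]" if c: "c \<in> A" "c \<noteq> 0" for c
  proof -
    obtain u qs where u: "u \<in> A" "dvd_in A u 1" and qs: "\<forall>q\<in>set qs. prime_in A q"
      and eq: "c = u * prod_list qs"
      using A c by (auto simp: ufd_in_def)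
    have "fac [:u:]"
      using u const_polys_in[OF S] dvd_in_const_iff[OF S, of u 1]
      by (intro fac_unit) (auto simp: dvd_in_zero[OF S] of_bool_def)
    moreover have "fac [:prod_list qs:]"
      using qs
    proof (induction qs)
      case Nil
      then show ?case
        using fac_unit[OF subring_set_closed(2)[OF PS] dvd_in_refl[OF PS]] by (simp add: one_pCons)
    next
      case (Cons q qs)
      then have "fac ([:q:] * [:prod_list qs:])"
        by (intro fac_mult[OF fac_prime[OF prime_in_const[OF S]]]) auto
      then show ?case by (simp add: mult.commute)
    qed
    ultimately have "fac ([:u:] * [:prod_list qs:])"
      by (rule fac_mult)
    then show ?thesis
      by (simp add: eq mult.commute)
  qed
  have "fac F" if "F \<in> polys_in A" "F \<noteq> 0" "u \<in> A" "dvd_in A u 1" "\<forall>q\<in>set qs. prime_in A q"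
    "lead_coeff F = u * prod_list qs" for F u qs
    using that
  proof (induction "Polynomial.degree F" arbitrary: F u qs rule: less_induct)
    case outer: less
    show ?case
      using outer.prems outer.hyps
    proof (induction "length qs" arbitrary: F u qs rule: less_induct)
      case inner: less
      show ?case
      proof (cases "\<exists>q. prime_in A q \<and> dvd_in (polys_in A) [:q:] F")
        case True
        then obtain q F1 where q: "prime_in A q" and F1: "F1 \<in> polys_in A" "F = smult q F1"
          by (auto simp: dvd_in_def)
        have q': "q \<in> A" "q \<noteq> 0" "\<not> dvd_in A q 1"
          using q by (auto simp: prime_in_def)
        have lc: "u * prod_list qs = q * lead_coeff F1"
          using inner.prems(6) F1(2) q'(2) by simp
        have nu: "\<not> dvd_in A q u"
          using dvd_in_trans[OF S _ inner.prems(4)] q'(3) by blast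
        have "dvd_in A q (u * prod_list qs)"
          unfolding lc dvd_in_def using coeff_polys_in[OF F1(1)] by blast
        then have "dvd_in A q (prod_list qs)"
          using nu q inner.prems(3,5) subring_set_prod_list[OF S, of qs]
          unfolding prime_in_def by blast
        \<comment> \<open>The constant prime q is associated to one of the primes r of the leading
          coefficient. Dividing F by q therefore removes r from the list, and the unit w = r/q joins
          u.\<close>
        then have "\<exists>r\<in>set qs. dvd_in A q r"
          using inner.prems(5)
        proof (induction qs)
          case Nil
          then show ?case using q'(3) by auto
        next
          case (Cons r qs)
          have "prod_list qs \<in> A" "r \<in> A"
            using Cons.prems(2) by (auto intro!: subring_set_prod_list[OF S] simp: prime_in_def)
          then show ?case
            using Cons q unfolding prime_in_def by auto
        qed
        then obtain r w where r: "r \<in> set qs" "w \<in> A" "r = q * w"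
          by (auto simp: dvd_in_def)
        have rp: "r \<in> A" "r \<noteq> 0" "prime_in A r"
          using r(1) inner.prems(5) by (auto simp: prime_in_def)
        have "dvd_in A w 1"
        proof -
          have "dvd_in A r (q * w)"
            using dvd_in_refl[OF S, of r] r(3) by simp
          then have "dvd_in A r q \<or> dvd_in A r w"
            using rp(3) q'(1) r(2) unfolding prime_in_def by blast
          then consider v where "v \<in> A" "q = r * v" | v where "v \<in> A" "w = r * v"
            by (auto simp: dvd_in_def)
          then show ?thesis
          proof cases
            case 1
            then have "r * (w * v) = r * 1"
              using r(3) by (metis mult.assoc mult.commute mult.right_neutral)
            then have "1 = w * v"
              using rp(2) by (metis mult_cancel_left)
            then show ?thesis
              using 1 by (auto simp: dvd_in_def)
          next
            case 2
            then have "r * (q * v) = r * 1"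
              using r(3) by (simp add: algebra_simps)
            then have "1 = q * v"
              using rp(2) by simp
            then show ?thesis
              using 2 q'(3) by (auto simp: dvd_in_def)
          qed
        qed
        then obtain w' u' where w': "w' \<in> A" "w * w' = 1" "u' \<in> A" "u * u' = 1"
          using inner.prems(4) by (auto simp: dvd_in_def)
        have "dvd_in A (u * w) 1"
          unfolding dvd_in_def using w' subring_set_closed(6)[OF S]
          by (intro bexI[of _ "u' * w'"]) (simp add: mult.assoc mult.left_commute[of w], blast)
        moreover have "lead_coeff F1 = u * w * prod_list (remove1 r qs)"
        proof -
          have "prod_list qs = q * w * prod_list (remove1 r qs)"
            using r(1) unfolding r(3)[symmetric] by (induction qs) (auto simp: algebra_simps)
          with lc have "q * lead_coeff F1 = u * (q * w * prod_list (remove1 r qs))"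
            by metis
          also have "\<dots> = q * (u * w * prod_list (remove1 r qs))"
            by (simp only: mult.assoc mult.left_commute)
          finally show ?thesis
            by (rule mult_left_cancel[OF q'(2), THEN iffD1])
        qed
        moreover have "length (remove1 r qs) < length qs"
          using r(1) length_pos_if_in_set[OF r(1)] by (simp add: length_remove1)
        moreover have "Polynomial.degree F1 = Polynomial.degree F"
          using F1(2) q'(2) by simp
        moreover have "F1 \<noteq> 0"
          using inner.prems(2) F1(2) by auto
        moreover have "u * w \<in> A"
          using inner.prems(3) r(2) subring_set_closed(6)[OF S] by blast
        moreover have "\<forall>q\<in>set (remove1 r qs). prime_in A q"
          using inner.prems(5) set_remove1_subset[of r qs] by blast
        ultimately have "fac F1"
          using inner.hyps[of "remove1 r qs" F1 "u * w"] F1(1) inner.prems(7) by auto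
        then have "fac ([:q:] * F1)"
          using q by (intro fac_mult[OF fac_prime[OF prime_in_const[OF S]]])
        then show ?thesis
          using F1 by simp
      next
        case prim: False
        show ?thesis
        proof (cases "Polynomial.degree F = 0")
          case True
          then obtain c where "F = [:c:]"
            by (metis degree_eq_zeroE)
          then show ?thesis
            using inner.prems(1,2) fac_const[of c] coeff_polys_in[of F A 0] by auto
        next
          case False
          show ?thesis
          proof (cases "prime_in (polys_in A) F")
            case True
            then show ?thesis by (rule fac_prime)
          next
            case notprime: False
            obtain G H where GH: "G \<in> polys_in A" "H \<in> polys_in A" "F = G * H"
              "\<not> dvd_in (polys_in A) G 1" "\<not> dvd_in (polys_in A) H 1"
              using prime_in_of_irreducible_poly[OF A inner.prems(1) _ prim] False notprime by blast
            have nz: "G \<noteq> 0" "H \<noteq> 0"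
              using GH(3) inner.prems(2) by auto
            \<comment> \<open>A factor of degree 0 would be a constant without inverse, so a prime
              of A would divide it and hence F.\<close>
            have pos: "Polynomial.degree G \<noteq> 0"
              if G: "G \<in> polys_in A" and H: "H \<in> polys_in A" and F: "F = G * H"
                and nu: "\<not> dvd_in (polys_in A) G 1" for G H
            proof
              assume "Polynomial.degree G = 0"
              then obtain c where c: "G = [:c:]"
                by (metis degree_eq_zeroE)
              have cA: "c \<in> A" "c \<noteq> 0"
                using coeff_polys_in[OF G, of 0] c F inner.prems(2) by auto
              have "\<not> dvd_in A c 1"
              proof
                assume "dvd_in A c 1"
                then obtain d where "d \<in> A" "1 = c * d"
                  by (auto simp: dvd_in_def)
                then have "1 = G * [:d:]" "[:d:] \<in> polys_in A"
                  using c const_polys_in[OF S] by (auto simp: one_pCons mult.commute)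
                then show False
                  using nu by (auto simp: dvd_in_def)
              qed
              then obtain q where q: "prime_in A q" "dvd_in A q c"
                using ufd_in_prime_divisor[OF A cA] by blast
              then have "dvd_in (polys_in A) [:q:] F"
                using F c coeff_polys_in[OF H] dvd_in_mult[OF S q(2)]
                by (auto simp: dvd_in_const_iff[OF S])
              then show False
                using prim q by blast
            qed
            have "Polynomial.degree F = Polynomial.degree G + Polynomial.degree H"
              using GH(3) nz by (simp add: degree_mult_eq)
            then have lt: "Polynomial.degree G < Polynomial.degree F" "Polynomial.degree H < Polynomial.degree F"
              using pos[OF GH(1,2,3,4)] pos[OF GH(2,1) _ GH(5)] GH(3) by (auto simp: mult.commute)
            have "fac K" if K: "K \<in> polys_in A" "K \<noteq> 0" "Polynomial.degree K < Polynomial.degree F" for K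
            proof -
              obtain v rs where "v \<in> A" "dvd_in A v 1" "\<forall>q\<in>set rs. prime_in A q"
                "lead_coeff K = v * prod_list rs"
                using A coeff_polys_in[OF K(1)] K(2) unfolding ufd_in_def
                by (metis leading_coeff_0_iff)
              then show ?thesis
                using inner.prems(7) K by blast
            qed
            then show ?thesis
              using GH lt nz fac_mult by blast
          qed
        qed
      qed
    qed
  qed
  moreover have "\<exists>u qs. u \<in> A \<and> dvd_in A u 1 \<and> (\<forall>q\<in>set qs. prime_in A q) \<and> lead_coeff F = u * prod_list qs"
    if "F \<in> polys_in A" "F \<noteq> 0" for F
    using A that coeff_polys_in[OF that(1)] by (auto simp: ufd_in_def)
  ultimately show ?thesis
    unfolding ufd_in_def fac_def[symmetric] using PS by blast
qed

section \<open>Transport of factorization along injective ring homomorphisms\<close>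

lemma dvd_in_image_iff:
  assumes mult: "\<And>x y. x \<in> B \<Longrightarrow> y \<in> B \<Longrightarrow> h (x * y) = h x * h y"
    and inj: "inj_on h B" and B: "subring_set B" and ab: "a \<in> B" "b \<in> B"
  shows "dvd_in (h ` B) (h a) (h b) \<longleftrightarrow> dvd_in B a b"
proof
  assume "dvd_in (h ` B) (h a) (h b)"
  then obtain c where c: "c \<in> B" "h b = h (a * c)"
    using ab by (auto simp: dvd_in_def mult)
  then have "b = a * c"
    using inj ab subring_set_closed(6)[OF B] by (auto dest: inj_onD)
  then show "dvd_in B a b"
    using c by (auto simp: dvd_in_def)
next
  assume "dvd_in B a b"
  then show "dvd_in (h ` B) (h a) (h b)"
    using ab by (auto simp: dvd_in_def mult)
qed

lemma prime_in_image:
  assumes mult: "\<And>x y. x \<in> B \<Longrightarrow> y \<in> B \<Longrightarrow> h (x * y) = h x * h y"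
    and one: "h 1 = 1" and zero: "h 0 = 0"
    and inj: "inj_on h B" and B: "subring_set B" and q: "prime_in B q"
  shows "prime_in (h ` B) (h q)"
proof -
  have d: "dvd_in (h ` B) (h a) (h b) \<longleftrightarrow> dvd_in B a b" if "a \<in> B" "b \<in> B" for a b
    using dvd_in_image_iff[OF mult inj B that] by blast
  have "q \<in> B" "q \<noteq> 0"
    using q by (auto simp: prime_in_def)
  moreover have "h q \<noteq> 0"
    using inj_onD[OF inj, of q 0] calculation subring_set_closed(1)[OF B] zero by auto
  moreover have "\<not> dvd_in (h ` B) (h q) 1"
    using d[of q 1] calculation q subring_set_closed(2)[OF B] one by (auto simp: prime_in_def)
  moreover have "dvd_in (h ` B) (h q) (h f) \<or> dvd_in (h ` B) (h q) (h g)"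
    if "f \<in> B" "g \<in> B" "dvd_in (h ` B) (h q) (h f * h g)" for f g
    using that d[of q "f * g"] d[of q f] d[of q g] calculation(1) q subring_set_closed(6)[OF B]
    by (auto simp: prime_in_def mult)
  ultimately show ?thesis
    by (auto simp: prime_in_def)
qed

text \<open>Applied with h the evaluation of polynomials over \<open>vars_below n\<close> at the
  next variable, which identifies formal polynomials with functions.\<close>

lemma ufd_in_image:
  assumes diff: "\<And>x y. x \<in> B \<Longrightarrow> y \<in> B \<Longrightarrow> h (x - y) = h x - h y"
    and mult: "\<And>x y. x \<in> B \<Longrightarrow> y \<in> B \<Longrightarrow> h (x * y) = h x * h y"
    and one: "h 1 = 1" and inj: "inj_on h B" and B: "ufd_in B"
  shows "ufd_in (h ` B)"
proof -
  note S = ufd_in_subring[OF B]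
  have zero: "h 0 = 0"
    using diff[of 1 1] subring_set_closed(2)[OF S] by simp
  have "subring_set (h ` B)"
    unfolding subring_set_def
    using subring_set_closed(2)[OF S] one
    by (auto simp: diff[symmetric] mult[symmetric] subring_set_closed[OF S] image_iff)
  moreover have "\<exists>u qs. u \<in> h ` B \<and> dvd_in (h ` B) u 1 \<and> (\<forall>q\<in>set qs. prime_in (h ` B) q) \<and>
      h f = u * prod_list qs" if f: "f \<in> B" "h f \<noteq> 0" for f
  proof -
    have "f \<noteq> 0"
      using f zero by auto
    then obtain u qs where u: "u \<in> B" "dvd_in B u 1" and qs: "\<forall>q\<in>set qs. prime_in B q"
      and eq: "f = u * prod_list qs"
      using f B by (auto simp: ufd_in_def)
    have "h (prod_list qs) = prod_list (map h qs)"
      using qs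
    proof (induction qs)
      case (Cons q qs)
      then show ?case
        using mult[of q "prod_list qs"] subring_set_prod_list[OF S, of qs]
        by (auto simp: prime_in_def)
    qed (simp add: one)
    moreover have "prod_list qs \<in> B"
      using qs by (intro subring_set_prod_list[OF S]) (auto simp: prime_in_def)
    ultimately have "h f = h u * prod_list (map h qs)"
      using eq mult[OF u(1)] by simp
    moreover have "dvd_in (h ` B) (h u) 1"
      using dvd_in_image_iff[OF mult inj S u(1) subring_set_closed(2)[OF S]] u one by simp
    moreover have "\<forall>q\<in>set (map h qs). prime_in (h ` B) q"
      using qs prime_in_image[OF mult one zero inj S] by auto
    ultimately show ?thesis
      using u by blast
  qed
  ultimately show ?thesis
    by (auto simp: ufd_in_def)
qed

section \<open>Polynomial functions in countably many complex variables\<close>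

text \<open>
  Infinitely many variables make the type independent of \<open>p\<close>; the group acts on the first \<open>p\<close> of them.
\<close>

inductive_set polyfuns :: "((nat \<Rightarrow> complex) \<Rightarrow> complex) set" where
  polyfuns_const: "(\<lambda>v. c) \<in> polyfuns"
| polyfuns_var: "(\<lambda>v. v i) \<in> polyfuns"
| polyfuns_add: "f \<in> polyfuns \<Longrightarrow> g \<in> polyfuns \<Longrightarrow> (\<lambda>v. f v + g v) \<in> polyfuns"
| polyfuns_mult: "f \<in> polyfuns \<Longrightarrow> g \<in> polyfuns \<Longrightarrow> (\<lambda>v. f v * g v) \<in> polyfuns"

typedef polyfun = polyfuns
  morphisms pf Abs_polyfun
  using polyfuns_const by blast

setup_lifting type_definition_polyfun

lift_definition pconst :: "complex \<Rightarrow> polyfun" is "\<lambda>c v. c"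
  by (rule polyfuns_const)

lift_definition pvar :: "nat \<Rightarrow> polyfun" is "\<lambda>i v. v i"
  by (rule polyfuns_var)

lemma polyfun_eq_iff: "f = g \<longleftrightarrow> (\<forall>v. pf f v = pf g v)"
  by transfer auto

text \<open>Restriction to a line reduces questions about functions of many variables to polynomials
  in one variable.\<close>

lemma polyfuns_on_line:
  assumes "f \<in> polyfuns"
  shows "\<exists>P. \<forall>t. f (\<lambda>i. a i + t * b i) = poly P t"
  using assms
proof (induction rule: polyfuns.induct)
  case (polyfuns_const c)
  show ?case by (intro exI[of _ "[:c:]"]) auto
next
  case (polyfuns_var i)
  show ?case by (intro exI[of _ "[:a i, b i:]"]) auto
next
  case (polyfuns_add f g)
  then obtain P Q where "\<forall>t. f (\<lambda>i. a i + t * b i) = poly P t" "\<forall>t. g (\<lambda>i. a i + t * b i) = poly Q t"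
    by blast
  then show ?case by (intro exI[of _ "P + Q"]) auto
next
  case (polyfuns_mult f g)
  then obtain P Q where "\<forall>t. f (\<lambda>i. a i + t * b i) = poly P t" "\<forall>t. g (\<lambda>i. a i + t * b i) = poly Q t"
    by blast
  then show ?case by (intro exI[of _ "P * Q"]) auto
qed

lemma pf_on_line: "\<exists>P. \<forall>t. pf f (\<lambda>i. a i + t * b i) = poly P t"
  using polyfuns_on_line[OF pf] .

instantiation polyfun :: idom
begin

lift_definition zero_polyfun :: polyfun is "\<lambda>v. 0"
  by (rule polyfuns_const)

lift_definition one_polyfun :: polyfun is "\<lambda>v. 1"
  by (rule polyfuns_const)

lift_definition plus_polyfun :: "polyfun \<Rightarrow> polyfun \<Rightarrow> polyfun" is "\<lambda>f g v. f v + g v"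
  by (rule polyfuns_add)

lift_definition times_polyfun :: "polyfun \<Rightarrow> polyfun \<Rightarrow> polyfun" is "\<lambda>f g v. f v * g v"
  by (rule polyfuns_mult)

lift_definition uminus_polyfun :: "polyfun \<Rightarrow> polyfun" is "\<lambda>f v. - f v"
  using polyfuns_mult[OF polyfuns_const[of "- 1"]] by simp

lift_definition minus_polyfun :: "polyfun \<Rightarrow> polyfun \<Rightarrow> polyfun" is "\<lambda>f g v. f v - g v"
  using polyfuns_add polyfuns_mult[OF polyfuns_const[of "- 1"]] by fastforce

instance
proof
  fix f g :: polyfun
  assume fg: "f \<noteq> 0" "g \<noteq> 0"
  then obtain v w where vw: "pf f v \<noteq> 0" "pf g w \<noteq> 0"
    by (auto simp: polyfun_eq_iff zero_polyfun.rep_eq)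
  \<comment> \<open>The line through v and w: f does not vanish at parameter 0 and g does not vanish
    at parameter 1, so both restrictions are nonzero polynomials.\<close>
  define b where "b = (\<lambda>i. w i - v i)"
  obtain P Q where PQ: "\<And>t. pf f (\<lambda>i. v i + t * b i) = poly P t" "\<And>t. pf g (\<lambda>i. v i + t * b i) = poly Q t"
    using pf_on_line[of f v b] pf_on_line[of g v b] by blast
  have "poly P 0 \<noteq> 0" "poly Q 1 \<noteq> 0"
    using vw by (simp_all flip: PQ) (simp_all add: b_def)
  then have "P * Q \<noteq> 0"
    by auto
  then obtain t where "poly (P * Q) t \<noteq> 0"
    using poly_all_0_iff_0 by blast
  then have "pf (f * g) (\<lambda>i. v i + t * b i) \<noteq> 0"
    by (simp add: times_polyfun.rep_eq PQ)
  then show "f * g \<noteq> 0"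
    by (auto simp: zero_polyfun.rep_eq)
next
  show "(0::polyfun) \<noteq> 1"
    by (auto simp: polyfun_eq_iff zero_polyfun.rep_eq one_polyfun.rep_eq)
qed (auto simp: polyfun_eq_iff zero_polyfun.rep_eq one_polyfun.rep_eq plus_polyfun.rep_eq
      times_polyfun.rep_eq uminus_polyfun.rep_eq minus_polyfun.rep_eq algebra_simps)

end

instantiation polyfun :: idom_divide
begin

text \<open>The exact quotient where one exists, and an arbitrary value for a non-multiple. It
  serves to reach the class \<open>algebraic_semidom\<close>, for which the norm argument is
  stated.\<close>

definition divide_polyfun :: "polyfun \<Rightarrow> polyfun \<Rightarrow> polyfun" where
  "divide_polyfun f g = (if g = 0 then 0 else SOME h. f = h * g)"

instance
proof
  fix f g :: polyfun
  assume "g \<noteq> 0"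
  then have "f * g = h * g \<longleftrightarrow> f = h" for h
    by simp
  with \<open>g \<noteq> 0\<close> show "f * g div g = f"
    by (simp add: divide_polyfun_def)
qed (simp add: divide_polyfun_def)

end

instance polyfun :: algebraic_semidom ..

lemmas pf_simps [simp] = zero_polyfun.rep_eq one_polyfun.rep_eq plus_polyfun.rep_eq
  times_polyfun.rep_eq uminus_polyfun.rep_eq minus_polyfun.rep_eq pconst.rep_eq pvar.rep_eq

lemma pf_power [simp]: "pf (f ^ n) v = pf f v ^ n"
  by (induction n) auto

lemma polyfun_induct [case_names const var add mult]:
  assumes "\<And>c. P (pconst c)" "\<And>i. P (pvar i)"
    and "\<And>f g. P f \<Longrightarrow> P g \<Longrightarrow> P (f + g)" "\<And>f g. P f \<Longrightarrow> P g \<Longrightarrow> P (f * g)"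
  shows "P f"
proof -
  have "P (Abs_polyfun f)" if "f \<in> polyfuns" for f
    using that
  proof (induction rule: polyfuns.induct)
    case (polyfuns_const c)
    then show ?case using assms(1)[of c] by (simp add: pconst_def)
  next
    case (polyfuns_var i)
    then show ?case using assms(2)[of i] by (simp add: pvar_def)
  next
    case (polyfuns_add f g)
    then show ?case
      using assms(3)[of "Abs_polyfun f" "Abs_polyfun g"] by (simp add: plus_polyfun.abs_eq eq_onp_def)
  next
    case (polyfuns_mult f g)
    then show ?case
      using assms(4)[of "Abs_polyfun f" "Abs_polyfun g"] by (simp add: times_polyfun.abs_eq eq_onp_def)
  qed
  from this[OF pf[of f]] show ?thesis
    by (simp add: pf_inverse)
qed

lemma pconst_hom:
  "pconst 0 = 0" "pconst 1 = 1" "pconst (a + b) = pconst a + pconst b" "pconst (a * b) = pconst a * pconst b"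
  by (simp_all add: polyfun_eq_iff)

lemma pconst_eq_iff [simp]: "pconst a = pconst b \<longleftrightarrow> a = b"
  by (simp add: polyfun_eq_iff)

text \<open>On each line through the origin f restricts to a unit of the polynomial ring in one
  variable, hence to a constant; so f has everywhere the value that it has at the origin.\<close>

lemma polyfun_unit_const:
  assumes "f * g = (1 :: polyfun)"
  shows "\<exists>c. c \<noteq> 0 \<and> f = pconst c"
proof -
  have "pf f v = pf f (\<lambda>_. 0)" for v
  proof -
    obtain P Q where PQ: "\<And>t. pf f (\<lambda>i. 0 + t * v i) = poly P t" "\<And>t. pf g (\<lambda>i. 0 + t * v i) = poly Q t"
      using pf_on_line[of f "\<lambda>_. 0" v] pf_on_line[of g "\<lambda>_. 0" v] by blast
    have "poly (P * Q - 1) t = 0" for t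
    proof -
      have "pf (f * g) (\<lambda>i. 0 + t * v i) = 1"
        using assms by simp
      then show ?thesis
        using PQ[of t] by simp
    qed
    then have "P * Q = 1"
      using poly_all_0_iff_0[of "P * Q - 1"] by simp
    then have "P dvd 1"
      by (metis dvd_triv_left)
    then obtain c where "P = [:c:]"
      by (auto elim!: is_unit_polyE)
    then have "poly P 1 = poly P 0"
      by simp
    then show ?thesis
      by (simp flip: PQ)
  qed
  then have "f = pconst (pf f (\<lambda>_. 0))"
    by (simp add: polyfun_eq_iff)
  moreover have "f \<noteq> 0"
    using assms by auto
  ultimately show ?thesis
    by (metis pconst_hom(1))
qed

section \<open>The rings in the first n variables\<close>

definition vars_below :: "nat \<Rightarrow> polyfun set" where
  "vars_below n = {f. \<forall>v w. (\<forall>i<n. v i = w i) \<longrightarrow> pf f v = pf f w}"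

lemma subring_set_vars_below: "subring_set (vars_below n)"
  unfolding subring_set_def vars_below_def
  by (simp, intro allI impI conjI) metis+

lemma vars_below_mono: "m \<le> n \<Longrightarrow> vars_below m \<subseteq> vars_below n"
  by (auto simp: vars_below_def)

lemma ex_vars_below: "\<exists>n. f \<in> vars_below n"
proof (induction f rule: polyfun_induct)
  case (const c)
  show ?case by (auto simp: vars_below_def)
next
  case (var i)
  show ?case by (intro exI[of _ "Suc i"]) (auto simp: vars_below_def)
next
  case (add f g)
  then obtain m n where "f \<in> vars_below m" "g \<in> vars_below n" by blast
  then have "f \<in> vars_below (max m n)" "g \<in> vars_below (max m n)"
    using vars_below_mono[of m "max m n"] vars_below_mono[of n "max m n"] by auto
  then show ?case
    using subring_set_closed(4)[OF subring_set_vars_below] by blast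
next
  case (mult f g)
  then obtain m n where "f \<in> vars_below m" "g \<in> vars_below n" by blast
  then have "f \<in> vars_below (max m n)" "g \<in> vars_below (max m n)"
    using vars_below_mono[of m "max m n"] vars_below_mono[of n "max m n"] by auto
  then show ?case
    using subring_set_closed(6)[OF subring_set_vars_below] by blast
qed

lemma polyfuns_subst:
  assumes "f \<in> polyfuns" and phi: "\<And>i. (\<lambda>v. \<phi> v i) \<in> polyfuns"
  shows "(\<lambda>v. f (\<phi> v)) \<in> polyfuns"
  using assms(1) by (induction rule: polyfuns.induct) (auto intro: polyfuns.intros phi)

lemma pf_poly: "pf (poly q x) v = poly (map_poly (\<lambda>c. pf c v) q) (pf x v)"
  by (induction q) (auto simp: map_poly_pCons)

lift_definition psubst :: "(nat \<Rightarrow> polyfun) \<Rightarrow> polyfun \<Rightarrow> polyfun" is "\<lambda>s f v. f (\<lambda>i. s i v)"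
  by (rule polyfuns_subst)

lemma pf_psubst [simp]: "pf (psubst s f) v = pf f (\<lambda>i. pf (s i) v)"
  by transfer simp

lemma psubst_hom:
  "psubst s 0 = 0" "psubst s 1 = 1" "psubst s (f + g) = psubst s f + psubst s g"
  "psubst s (f - g) = psubst s f - psubst s g" "psubst s (f * g) = psubst s f * psubst s g"
  by (simp_all add: polyfun_eq_iff)

text \<open>Only the n-th variable is excluded, whereas \<open>vars_below n\<close> excludes all
  later ones too. An induction over the formation of f needs the larger ring: a sum in
  \<open>vars_below (Suc n)\<close> can have summands outside it.\<close>

definition indep_of :: "nat \<Rightarrow> polyfun set" where
  "indep_of n = {f. \<forall>v t. pf f (v(n := t)) = pf f v}"

lemma subring_set_indep_of: "subring_set (indep_of n)"
  unfolding subring_set_def indep_of_def by simp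

lemma poly_in_var:
  "\<exists>q\<in>polys_in (indep_of n). f = poly q (pvar n)"
proof (induction f rule: polyfun_induct)
  note P = subring_set_polys_in[OF subring_set_indep_of[of n]]
  note C = const_polys_in[OF subring_set_indep_of[of n]]
  case (const c)
  show ?case
    by (intro bexI[of _ "[:pconst c:]"] C) (auto simp: indep_of_def)
next
  note C = const_polys_in[OF subring_set_indep_of[of n]]
  case (var i)
  show ?case
  proof (cases "i = n")
    case True
    then show ?thesis
      using monom_polys_in[OF subring_set_indep_of[of n] subring_set_closed(2)[OF subring_set_indep_of[of n]], of 1]
      by (intro bexI[of _ "Polynomial.monom 1 1"]) (auto simp: poly_monom)
  next
    case False
    then show ?thesis
      by (intro bexI[of _ "[:pvar i:]"] C) (auto simp: indep_of_def)
  qed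
next
  case (add f g)
  then obtain q r where "q \<in> polys_in (indep_of n)" "f = poly q (pvar n)"
    "r \<in> polys_in (indep_of n)" "g = poly r (pvar n)" by blast
  then show ?case
    using subring_set_closed(4)[OF subring_set_polys_in[OF subring_set_indep_of[of n]]]
    by (intro bexI[of _ "q + r"]) auto
next
  case (mult f g)
  then obtain q r where "q \<in> polys_in (indep_of n)" "f = poly q (pvar n)"
    "r \<in> polys_in (indep_of n)" "g = poly r (pvar n)" by blast
  then show ?case
    using subring_set_closed(6)[OF subring_set_polys_in[OF subring_set_indep_of[of n]]]
    by (intro bexI[of _ "q * r"]) auto
qed

text \<open>With all other coordinates fixed, the coefficients are complex numbers and the n-th
  coordinate is free, so a complex polynomial vanishes everywhere.\<close>

lemma pvar_transcendental:
  assumes q: "q \<in> polys_in (indep_of n)" and z: "poly q (pvar n) = 0"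
  shows "q = 0"
proof (rule poly_eqI)
  fix i
  have "pf (coeff q i) v = 0" for v
  proof -
    have "poly (map_poly (\<lambda>c. pf c v) q) t = 0" for t
    proof -
      have "map_poly (\<lambda>c. pf c (v(n := t))) q = map_poly (\<lambda>c. pf c v) q"
        using coeff_polys_in[OF q] by (intro poly_eqI) (auto simp: coeff_map_poly indep_of_def)
      moreover have "pf (poly q (pvar n)) (v(n := t)) = 0"
        using z by simp
      ultimately show ?thesis
        by (simp add: pf_poly)
    qed
    then have "map_poly (\<lambda>c. pf c v) q = 0"
      using poly_all_0_iff_0 by blast
    then have "coeff (map_poly (\<lambda>c. pf c v) q) i = 0"
      by simp
    then show ?thesis
      by (simp add: coeff_map_poly)
  qed
  then show "coeff q i = coeff 0 i"
    by (simp add: polyfun_eq_iff)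
qed

text \<open>Setting all variables beyond n to 0 fixes f and moves the coefficients of its expansion
  in \<open>pvar n\<close> from \<open>indep_of n\<close> into \<open>vars_below n\<close>.\<close>

lemma vars_below_Suc:
  "vars_below (Suc n) = (\<lambda>q. poly q (pvar n)) ` polys_in (vars_below n)"
proof safe
  fix f assume f: "f \<in> vars_below (Suc n)"
  obtain q where q: "q \<in> polys_in (indep_of n)" "f = poly q (pvar n)"
    using poly_in_var by blast
  define s where "s i = (if i \<le> n then pvar i else 0)" for i
  have "psubst s f = f"
    unfolding polyfun_eq_iff using f by (auto simp: vars_below_def s_def less_Suc_eq_le)
  moreover have "psubst s (poly q x) = poly (map_poly (psubst s) q) (psubst s x)" for q x
    by (induction q) (auto simp: psubst_hom map_poly_pCons)
  moreover have "psubst s (pvar n) = pvar n"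
    by (simp add: polyfun_eq_iff s_def)
  ultimately have "f = poly (map_poly (psubst s) q) (pvar n)"
    using q(2) by metis
  moreover have "psubst s c \<in> vars_below n" if c: "c \<in> indep_of n" for c
    unfolding vars_below_def
  proof safe
    fix v w :: "nat \<Rightarrow> complex" assume vw: "\<forall>i<n. v i = w i"
    have "pf c ((\<lambda>i. pf (s i) v)(n := 0)) = pf c ((\<lambda>i. pf (s i) w)(n := 0))"
      using vw by (intro arg_cong[of _ _ "pf c"]) (auto simp: s_def)
    then show "pf (psubst s c) v = pf (psubst s c) w"
      using c by (simp add: indep_of_def)
  qed
  then have "map_poly (psubst s) q \<in> polys_in (vars_below n)"
    using q(1) by (auto simp: polys_in_def coeff_map_poly psubst_hom)
  ultimately show "f \<in> (\<lambda>q. poly q (pvar n)) ` polys_in (vars_below n)"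
    by blast
next
  fix q assume q: "q \<in> polys_in (vars_below n)"
  have "pvar n \<in> vars_below (Suc n)"
    by (auto simp: vars_below_def)
  then show "poly q (pvar n) \<in> vars_below (Suc n)"
    unfolding poly_altdef using coeff_polys_in[OF q] vars_below_mono[of n "Suc n"]
    by (intro subring_set_sum[OF subring_set_vars_below] subring_set_closed[OF subring_set_vars_below]
        subring_set_power[OF subring_set_vars_below]) auto
qed

lemma inj_on_poly_pvar: "inj_on (\<lambda>q. poly q (pvar n)) (polys_in (vars_below n))"
proof (rule inj_onI)
  fix q r assume qr: "q \<in> polys_in (vars_below n)" "r \<in> polys_in (vars_below n)"
    "poly q (pvar n) = poly r (pvar n)"
  have "vars_below n \<subseteq> indep_of n"
    by (auto simp: vars_below_def indep_of_def)
  then have "polys_in (vars_below n) \<subseteq> polys_in (indep_of n)"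
    by (auto simp: polys_in_def)
  then have "q - r \<in> polys_in (indep_of n)"
    using qr subring_set_closed(5)[OF subring_set_polys_in[OF subring_set_indep_of]] by blast
  then have "q - r = 0"
    using qr(3) by (intro pvar_transcendental) auto
  then show "q = r" by simp
qed

lemma ufd_in_vars_below: "ufd_in (vars_below n)"
proof (induction n)
  case 0
  have "\<exists>u qs. u \<in> vars_below 0 \<and> dvd_in (vars_below 0) u 1 \<and> (\<forall>q\<in>set qs. prime_in (vars_below 0) q) \<and>
      f = u * prod_list qs" if f: "f \<in> vars_below 0" "f \<noteq> 0" for f
  proof -
    have "f = pconst (pf f (\<lambda>_. 0))"
      using f(1) by (auto simp: polyfun_eq_iff vars_below_def)
    then obtain c where c: "f = pconst c"
      by blast
    then have "c \<noteq> 0"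
      using f(2) pconst_hom(1) by auto
    then have "dvd_in (vars_below 0) f 1"
      unfolding dvd_in_def by (intro bexI[of _ "pconst (inverse c)"])
        (auto simp: c vars_below_def polyfun_eq_iff)
    then show ?thesis
      using f(1) by (intro exI[of _ f] exI[of _ "[]"]) auto
  qed
  then show ?case
    by (auto simp: ufd_in_def subring_set_vars_below)
next
  case (Suc n)
  show ?case
    unfolding vars_below_Suc
    by (intro ufd_in_image ufd_in_polys_in Suc inj_on_poly_pvar) auto
qed

section \<open>Passage to infinitely many variables\<close>

lemma prime_in_vars_below_Suc:
  assumes "prime_in (vars_below n) q"
  shows "prime_in (vars_below (Suc n)) q"
proof -
  have "prime_in ((\<lambda>q. poly q (pvar n)) ` polys_in (vars_below n)) (poly [:q:] (pvar n))"
    by (rule prime_in_image) (auto intro: inj_on_poly_pvar subring_set_polys_in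
      subring_set_vars_below prime_in_const assms)
  then show ?thesis
    by (simp add: vars_below_Suc)
qed

text \<open>A prime stays prime when further variables are adjoined, by Gauss's lemma, and any given
  divisibility already takes place among finitely many variables.\<close>

lemma prime_in_UNIV_polyfun:
  assumes q: "prime_in (vars_below n) q"
  shows "prime_in UNIV q"
proof -
  have qm: "prime_in (vars_below m) q" if "n \<le> m" for m
    using that by (induction rule: dec_induct) (auto simp: q prime_in_vars_below_Suc)
  have large: "\<exists>m\<ge>n. f \<in> vars_below m \<and> g \<in> vars_below m \<and> h \<in> vars_below m" for f g h
  proof -
    obtain a b c where "f \<in> vars_below a" "g \<in> vars_below b" "h \<in> vars_below c"
      using ex_vars_below by blast
    then show ?thesis
      using vars_below_mono[of a "n + a + b + c"] vars_below_mono[of b "n + a + b + c"]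
        vars_below_mono[of c "n + a + b + c"] by (intro exI[of _ "n + a + b + c"]) auto
  qed
  have "\<not> dvd_in UNIV q 1"
  proof
    assume "dvd_in UNIV q 1"
    then obtain k where k: "1 = q * k"
      by (auto simp: dvd_in_def)
    obtain m where "n \<le> m" "k \<in> vars_below m"
      using large by blast
    then show False
      using k qm[of m] by (auto simp: prime_in_def dvd_in_def)
  qed
  moreover have "dvd_in UNIV q f \<or> dvd_in UNIV q g" if d: "dvd_in UNIV q (f * g)" for f g
  proof -
    obtain k where k: "f * g = q * k"
      using d by (auto simp: dvd_in_def)
    obtain m where m: "n \<le> m" "f \<in> vars_below m" "g \<in> vars_below m" "k \<in> vars_below m"
      using large by blast
    then have "dvd_in (vars_below m) q f \<or> dvd_in (vars_below m) q g"
      using k qm[OF m(1)] unfolding prime_in_def by (metis dvd_in_def)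
    then show ?thesis
      by (auto simp: dvd_in_def)
  qed
  ultimately show ?thesis
    using q by (auto simp: prime_in_def)
qed

lemma polyfun_prime_factorization:
  fixes f :: polyfun
  assumes "f \<noteq> 0"
  shows "\<exists>u qs. u dvd 1 \<and> (\<forall>q\<in>set qs. prime_elem q) \<and> f = u * prod_list qs"
proof -
  obtain n where "f \<in> vars_below n"
    using ex_vars_below by blast
  then obtain u qs where f: "dvd_in (vars_below n) u 1" "\<forall>q\<in>set qs. prime_in (vars_below n) q"
    "f = u * prod_list qs"
    using ufd_in_vars_below[of n] assms by (auto simp: ufd_in_def)
  have "prime_elem q" if "q \<in> set qs" for q
    using prime_in_UNIV_polyfun[of n q] f(2) that
    by (auto simp: prime_elem_def prime_in_def dvd_in_def dvd_def)
  moreover have "u dvd 1"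
    using f(1) unfolding dvd_in_def dvd_def by blast
  ultimately show ?thesis
    using f(3) by blast
qed

section \<open>Norms of semi-invariants of the Heisenberg group\<close>

lemma unit_power: "(u :: 'a::comm_semiring_1) dvd 1 \<Longrightarrow> u ^ n dvd 1"
  using dvd_power_same[of u 1 n] by simp

lemma unit_mult: "(u :: 'a::comm_semiring_1) dvd 1 \<Longrightarrow> v dvd 1 \<Longrightarrow> u * v dvd 1"
  using mult_dvd_mono[of u 1 v 1] by simp

lemma prime_elem_dvd_prod:
  assumes "prime_elem q" "q dvd prod f I"
  shows "\<exists>i\<in>I. q dvd f i"
  using assms(2)
proof (induction I rule: infinite_finite_induct)
  case (insert i I)
  then show ?case
    using assms(1) prime_elem_dvd_multD by fastforce
qed (use assms(1) in \<open>auto simp: prime_elem_def\<close>)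

text \<open>The primes are cancelled one at a time against x or y; x is no unit, so it uses up at
  least one. The count \<open>length qs\<close> is the induction measure of the norm
  theorem.\<close>

lemma proper_divisor_fewer_primes:
  fixes u x y :: "'a::{idom_divide,algebraic_semidom}"
  assumes "u dvd 1" "\<forall>q\<in>set qs. prime_elem q" "u * prod_list qs = x * y" "\<not> x dvd 1"
  shows "\<exists>v rs. v dvd 1 \<and> (\<forall>q\<in>set rs. prime_elem q) \<and> y = v * prod_list rs \<and> length rs < length qs"
  using assms(2-4)
proof (induction qs arbitrary: x y)
  case Nil
  then have "x dvd u" by simp
  then show ?case
    using Nil.prems(3) assms(1) dvd_trans by blast
next
  case (Cons r qs)
  have r: "prime_elem r" "r \<noteq> 0"
    using Cons.prems(1) by auto
  have "r * (u * prod_list qs) = x * y"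
    using Cons.prems(2) by (simp add: algebra_simps)
  then have "r dvd x * y"
    by (metis dvd_triv_left)
  then have "r dvd x \<or> r dvd y"
    using r(1) prime_elem_dvd_multD by blast
  then consider x' where "x = r * x'" | y' where "y = r * y'"
    by (auto simp: dvd_def)
  then show ?case
  proof cases
    case 1
    then have "r * (u * prod_list qs) = r * (x' * y)"
      using \<open>r * (u * prod_list qs) = x * y\<close> by (simp add: algebra_simps)
    then have e: "u * prod_list qs = x' * y"
      using r(2) by simp
    show ?thesis
    proof (cases "x' dvd 1")
      case True
      then obtain w where w: "1 = x' * w"
        by (auto simp: dvd_def)
      have "y = (x' * w) * y"
        using w by simp
      also have "\<dots> = w * (x' * y)"
        by (simp only: mult.assoc mult.left_commute)
      finally have "y = (w * u) * prod_list qs"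
        using e by (simp add: mult.assoc)
      moreover have "w * u dvd 1"
        using assms(1) by (intro unit_mult) (auto simp: w)
      ultimately show ?thesis
        using Cons.prems(1) by (intro exI[of _ "w * u"] exI[of _ qs]) auto
    next
      case False
      then show ?thesis
        using Cons.IH[OF _ e] Cons.prems(1) by (auto intro: less_SucI)
    qed
  next
    case 2
    then have "r * (u * prod_list qs) = r * (x * y')"
      using \<open>r * (u * prod_list qs) = x * y\<close> by (simp add: algebra_simps)
    then have e: "u * prod_list qs = x * y'"
      using r(2) by simp
    obtain v rs where "v dvd 1" "\<forall>q\<in>set rs. prime_elem q" "y' = v * prod_list rs" "length rs < length qs"
      using Cons.IH[OF _ e Cons.prems(3)] Cons.prems(1) by auto
    then show ?thesis
      using 2 r(1) by (intro exI[of _ v] exI[of _ "r # rs"]) (auto simp: algebra_simps)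
  qed
qed

text \<open>
  The index \<open>(a, b, c)\<close> stands for the unitriangular matrix with superdiagonal entries \<open>b\<close>, \<open>a\<close> and
  corner entry \<open>c\<close>, all modulo \<open>p\<close>.
\<close>

locale heisenberg_action =
  fixes p :: nat and act :: "int \<Rightarrow> int \<Rightarrow> int \<Rightarrow> 'a::idom \<Rightarrow> 'a"
  assumes prime_p: "prime p" and odd_p: "odd p"
    and act_add: "act a b c (x + y) = act a b c x + act a b c y"
    and act_mult: "act a b c (x * y) = act a b c x * act a b c y"
    and act_one: "act a b c 1 = 1"
    and act_act: "act a b c (act a' b' c' x) = act (a + a') (b + b') (c + c' + a' * b) x"
    and act_period: "int p dvd a \<Longrightarrow> int p dvd b \<Longrightarrow> int p dvd c \<Longrightarrow> act a b c x = x"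
begin

lemma act_zero: "act a b c 0 = 0"
  using act_add[of a b c 0 0] by (metis add_0 add_cancel_right_left)

text \<open>The corner entry a b - c is that of the inverse unitriangular matrix.\<close>

lemma act_inverse: "act a b c (act (- a) (- b) (a * b - c) x) = x"
  "act (- a) (- b) (a * b - c) (act a b c x) = x"
  by (simp_all add: act_act act_period)

lemma act_eq_0_iff: "act a b c x = 0 \<longleftrightarrow> x = 0"
  using act_inverse(2)[of a b c x] act_zero by metis

lemma act_dvd_iff: "act a b c x dvd act a b c y \<longleftrightarrow> x dvd y"
proof
  assume "act a b c x dvd act a b c y"
  then obtain k where "act a b c y = act a b c x * k" ..
  then have "act (- a) (- b) (a * b - c) (act a b c y) =
      act (- a) (- b) (a * b - c) (act a b c x * k)"
    by simp
  then show "x dvd y"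
    by (simp add: act_inverse act_mult)
qed (auto simp: act_mult)

lemma act_dvd_swap: "act a b c x dvd y \<longleftrightarrow> x dvd act (- a) (- b) (a * b - c) y"
  using act_dvd_iff[of a b c x "act (- a) (- b) (a * b - c) y"] by (simp add: act_inverse)

lemma act_prime_elem: "prime_elem q \<Longrightarrow> prime_elem (act a b c q)"
  unfolding prime_elem_def act_eq_0_iff act_dvd_swap act_mult act_one by blast

lemma act_prod: "act a b c (prod f I) = (\<Prod>i\<in>I. act a b c (f i))"
  by (induction I rule: infinite_finite_induct) (auto simp: act_mult act_one)

lemma act_power: "act a b c (x ^ n) = act a b c x ^ n"
  by (induction n) (auto simp: act_mult act_one)

lemma act_uminus: "act a b c (- x) = - act a b c x"
  using act_add[of a b c x "- x"] by (simp add: act_zero eq_neg_iff_add_eq_0 add.commute)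

lemma act_diff: "act a b c (x - y) = act a b c x - act a b c y"
  using act_add[of a b c x "- y"] by (simp add: act_uminus)

lemma act_cong:
  assumes "[a = a'] (mod int p)" "[b = b'] (mod int p)" "[c = c'] (mod int p)"
  shows "act a b c x = act a' b' c' x"
proof -
  have "act a b c x = act a' b' c' (act (a - a') (b - b') (c - c' - (a - a') * b') x)"
    by (simp add: act_act)
  moreover have "int p dvd a - a'" "int p dvd b - b'" "int p dvd c - c'"
    using assms by (auto simp: cong_iff_dvd_diff)
  ultimately show ?thesis
    by (simp add: act_period)
qed

text \<open>Norm along the cyclic group generated by \<sigma> = \<open>act 1 0 0\<close>. In the
  same notation \<tau> is \<open>act 0 1 0\<close> and \<zeta> is \<open>act 0 0 1\<close>.\<close>

definition N :: "'a \<Rightarrow> 'a" where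
  "N f = (\<Prod>i<p. act (int i) 0 0 f)"

lemma N_mult: "N (f * g) = N f * N g"
  by (simp add: N_def act_mult prod.distrib)

lemma N_shift_1: "N (act 1 0 0 f) = N f"
proof -
  obtain m where m: "p = Suc m"
    using prime_p by (metis not_prime_0 not0_implies_Suc)
  have "N (act 1 0 0 f) = (\<Prod>i<p. act (int (Suc i)) 0 0 f)"
    by (simp add: N_def act_act add.commute)
  also have "\<dots> = (\<Prod>i<m. act (int (Suc i)) 0 0 f) * act (int p) 0 0 f"
    by (simp add: m)
  also have "act (int p) 0 0 f = act (int 0) 0 0 f"
    by (simp add: act_period)
  also have "(\<Prod>i<m. act (int (Suc i)) 0 0 f) * act (int 0) 0 0 f = (\<Prod>i<p. act (int i) 0 0 f)"
    unfolding m by (subst prod.lessThan_Suc_shift) (simp add: mult.commute)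
  finally show ?thesis
    by (simp add: N_def)
qed

lemma N_shift: "N (act j 0 0 f) = N f"
proof -
  have *: "N (act (int k) 0 0 f) = N f" for k
  proof (induction k)
    case 0
    then show ?case by (simp add: act_period)
  next
    case (Suc k)
    have "act (int (Suc k)) 0 0 f = act 1 0 0 (act (int k) 0 0 f)"
      by (simp add: act_act)
    then show ?case
      using Suc N_shift_1 by simp
  qed
  have "act j 0 0 f = act (int (nat (j mod int p))) 0 0 f"
    using prime_p by (intro act_cong) (auto simp: prime_gt_0_nat cong_def)
  then show ?thesis
    by (metis *)
qed

end

section \<open>Invariants as sums and products over the group\<close>

context heisenberg_action
begin

text \<open>The group is represented by its set of maps, so that composition with a group element
  permutes it even if different indices give the same map.\<close>

definition maps :: "('a \<Rightarrow> 'a) set" where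
  "maps = {f. \<exists>a b c. f = act a b c}"

lemma act_in_maps: "act a b c \<in> maps"
  by (auto simp: maps_def)

lemma finite_maps: "finite maps"
proof -
  have "maps \<subseteq> (\<lambda>(a, b, c). act (int a) (int b) (int c)) ` ({..<p} \<times> {..<p} \<times> {..<p})"
  proof
    fix f assume "f \<in> maps"
    then obtain a b c where f: "f = act a b c"
      by (auto simp: maps_def)
    have "f = act (int (nat (a mod int p))) (int (nat (b mod int p))) (int (nat (c mod int p)))"
      unfolding f using prime_p by (intro ext act_cong) (auto simp: prime_gt_0_nat cong_def)
    moreover have "nat (x mod int p) < p" for x
      using prime_p by (simp add: nat_less_iff prime_gt_0_nat)
    ultimately show "f \<in> (\<lambda>(a, b, c). act (int a) (int b) (int c)) ` ({..<p} \<times> {..<p} \<times> {..<p})"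
      by (intro image_eqI[of _ _ "(nat (a mod int p), nat (b mod int p), nat (c mod int p))"]) simp_all
  qed
  then show ?thesis
    by (rule finite_subset) auto
qed

lemma bij_betw_maps: "bij_betw (\<lambda>f. act a b c \<circ> f) maps maps"
proof (rule bij_betw_byWitness[where f' = "\<lambda>f. act (- a) (- b) (a * b - c) \<circ> f"])
  have "act a b c \<circ> f \<in> maps" if "f \<in> maps" for a b c f
    using that unfolding maps_def comp_def by (clarsimp simp: act_act) blast
  then show "(\<lambda>f. act a b c \<circ> f) ` maps \<subseteq> maps" "(\<lambda>f. act (- a) (- b) (a * b - c) \<circ> f) ` maps \<subseteq> maps"
    by blast+
qed (auto simp: fun_eq_iff act_inverse)

lemma act_sum: "act a b c (sum f I) = (\<Sum>i\<in>I. act a b c (f i))"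
  by (induction I rule: infinite_finite_induct) (auto simp: act_add act_zero)

lemma act_sum_maps: "act a b c (\<Sum>f\<in>maps. f x) = (\<Sum>f\<in>maps. f x)"
  using sum.reindex_bij_betw[OF bij_betw_maps, of "\<lambda>f. f x" a b c] by (simp add: act_sum)

lemma act_prod_maps: "act a b c (\<Prod>f\<in>maps. f x) = (\<Prod>f\<in>maps. f x)"
  using prod.reindex_bij_betw[OF bij_betw_maps, of "\<lambda>f. f x" a b c] by (simp add: act_prod)

end

locale heisenberg_action_ufd = heisenberg_action p act
  for p :: nat and act :: "int \<Rightarrow> int \<Rightarrow> int \<Rightarrow> 'a::{idom_divide,algebraic_semidom} \<Rightarrow> 'a" +
  assumes act_unit: "u dvd 1 \<Longrightarrow> act a b c u = u"
    and prime_factorization_ex: "(f :: 'a) \<noteq> 0 \<Longrightarrow>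
      \<exists>u qs. u dvd 1 \<and> (\<forall>q\<in>set qs. prime_elem q) \<and> f = u * prod_list qs"
begin

text \<open>Eigenvectors of the centre rather than invariants: the factors that get split off an
  invariant can have a nontrivial eigenvalue, and the cofactor is then an eigenvector too.\<close>

definition semi :: "'a \<Rightarrow> bool" where
  "semi f \<longleftrightarrow> f \<noteq> 0 \<and> (\<exists>k. k dvd 1 \<and> act 0 0 1 f = k * f)"

text \<open>With a = 0 or b = 0 the powers of the matrix acquire no corner term, and the action
  fixes the unit k, so it is simply raised to the power n.\<close>

lemma act_central_power:
  assumes "k dvd 1" "act a b c f = k * f" "a = 0 \<or> b = 0"
  shows "act (int n * a) (int n * b) (int n * c) f = k ^ n * f"
proof (induction n)
  case 0
  then show ?case by (simp add: act_period)
next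
  case (Suc n)
  have "act (int (Suc n) * a) (int (Suc n) * b) (int (Suc n) * c) f =
      act a b c (act (int n * a) (int n * b) (int n * c) f)"
    using assms(3) by (auto simp: act_act algebra_simps)
  also have "\<dots> = k ^ n * act a b c f"
    using assms(1) by (simp add: Suc act_mult act_power act_unit)
  finally show ?case
    by (simp add: assms(2))
qed

text \<open>The sum is p(p-1)/2, and here the oddness of p is used. It arises as the total exponent
  when central factors are collected over a norm or a p-th power.\<close>

lemma gauss_sum_dvd: "p dvd (\<Sum>i<p. i)"
proof -
  have "(\<Sum>i<p. i) = p * ((p - 1) div 2)"
    using odd_p Sum_Ico_nat[of 0 p] by (auto simp: atLeast0LessThan elim!: oddE)
  then show ?thesis by simp
qed

lemma central_root_of_unity:
  assumes f: "f \<noteq> 0" "k dvd 1" "act 0 0 1 f = k * f"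
  shows "k ^ p = 1"
proof -
  have "k ^ p * f = act 0 0 (int p) f"
    using act_central_power[OF f(2,3), of p] by simp
  also have "\<dots> = 1 * f"
    by (simp add: act_period)
  finally show ?thesis
    using f(1) by (metis mult_right_cancel)
qed

text \<open>Moving \<tau>^b past \<sigma>^i costs \<zeta>^(ib), which multiplies f by r^i with r the
  eigenvalue of \<zeta>^b. Over the whole norm the exponents add up to a multiple of p, and r^p =
  1.\<close>

lemma act_N:
  assumes "semi f"
  shows "act 0 b 0 (N f) = N (act 0 b 0 f)"
proof -
  obtain k where f: "f \<noteq> 0" and k: "k dvd 1" "act 0 0 1 f = k * f"
    using assms by (auto simp: semi_def)
  have kp: "k ^ p = 1"
    using central_root_of_unity[OF f k] .
  define r where "r = k ^ nat (b mod int p)"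
  have rp: "r ^ p = 1"
    unfolding r_def by (simp add: kp flip: power_mult) (metis kp mult.commute power_mult power_one)
  have rb: "act 0 0 (int i * b) f = r ^ i * f" for i
  proof -
    have "act 0 0 (int i * b) f = act 0 0 (int i * (b mod int p)) f"
      by (intro act_cong) (auto simp: cong_def mod_mult_right_eq)
    also have "int i * (b mod int p) = int (nat (b mod int p) * i)"
      using prime_p by (simp add: prime_gt_0_nat)
    also have "act 0 0 (int (nat (b mod int p) * i)) f = k ^ (nat (b mod int p) * i) * f"
      using act_central_power[OF k, of "nat (b mod int p) * i"] by simp
    finally show ?thesis
      by (simp add: r_def power_mult)
  qed
  have "act 0 b 0 (act (int i) 0 0 f) = r ^ i * act (int i) 0 0 (act 0 b 0 f)" for i
  proof -
    have "act 0 b 0 (act (int i) 0 0 f) = act (int i) b 0 (act 0 0 (int i * b) f)"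
      by (simp add: act_act)
    also have "\<dots> = r ^ i * act (int i) b 0 f"
      using k(1) by (simp add: rb act_mult act_power act_unit r_def)
    finally show ?thesis
      by (simp add: act_act)
  qed
  then have "act 0 b 0 (N f) = r ^ (\<Sum>i<p. i) * N (act 0 b 0 f)"
    by (simp add: N_def act_prod prod.distrib power_sum)
  moreover have "r ^ (\<Sum>i<p. i) = 1"
    using gauss_sum_dvd rp by (auto simp: dvd_def power_mult)
  ultimately show ?thesis
    by simp
qed

lemma semi_act: "semi f \<Longrightarrow> semi (act a b c f)"
proof -
  assume "semi f"
  then obtain k where k: "f \<noteq> 0" "k dvd 1" "act 0 0 1 f = k * f"
    by (auto simp: semi_def)
  have "act 0 0 1 (act a b c f) = act a b c (act 0 0 1 f)"
    by (simp add: act_act add.commute)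
  then show ?thesis
    unfolding semi_def using k by (auto simp: act_eq_0_iff act_mult act_unit intro!: exI[of _ k])
qed

lemma semi_quotient:
  assumes "semi f" "semi g" "f = g * h"
  shows "semi h"
proof -
  obtain k l where k: "f \<noteq> 0" "k dvd 1" "act 0 0 1 f = k * f"
    and l: "g \<noteq> 0" "l dvd 1" "act 0 0 1 g = l * g"
    using assms(1,2) by (auto simp: semi_def)
  obtain l' where l': "1 = l * l'"
    using l(2) by (auto simp: dvd_def)
  have "g * (l * act 0 0 1 h) = g * (k * h)"
    using k(3) unfolding assms(3) act_mult l(3) by (simp add: algebra_simps)
  then have "l * act 0 0 1 h = k * h"
    using l(1) by (metis mult_left_cancel)
  then have "(l * l') * act 0 0 1 h = (l' * k) * h"
    by (simp only: mult.assoc mult.left_commute[of l])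
  then have "act 0 0 1 h = (l' * k) * h"
    by (simp flip: l')
  moreover have "l' * k dvd 1"
    using k(2) by (intro unit_mult) (auto simp: l')
  ultimately show ?thesis
    using k(1) assms(3) by (auto simp: semi_def)
qed

text \<open>
  If \<open>q\<close> is not an eigenvector of the centre, its \<open>p\<close> central conjugates are pairwise
  non-associated, and \<open>Q\<close> is their product.
\<close>

lemma semi_hull:
  assumes q: "prime_elem q"
  shows "\<exists>Q. semi Q \<and> q dvd Q \<and> (\<forall>x. semi x \<longrightarrow> q dvd x \<longrightarrow> Q dvd x) \<and>
    (\<forall>a b c e. e dvd 1 \<longrightarrow> act a b c q = e * q \<longrightarrow> (\<exists>e'. e' dvd 1 \<and> act a b c Q = e' * Q)) \<and>
    (\<forall>r. prime_elem r \<longrightarrow> r dvd Q \<longrightarrow> (\<exists>k. r dvd act 0 0 k q))"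
proof (cases "semi q")
  case True
  have "r dvd act 0 0 0 q" if "r dvd q" for r
    using that by (simp add: act_period)
  then show ?thesis
    using True by (intro exI[of _ q] conjI) (simp, simp, simp, blast, blast)
next
  case False
  have q0: "q \<noteq> 0"
    using q by auto
  \<comment> \<open>A divisibility between two different conjugates makes q an eigenvector of
    \<zeta>^(j-i). This generates the centre because p is prime, so q would be an eigenvector of
    \<zeta>.\<close>
  have coprime_conj: "\<not> act 0 0 i q dvd act 0 0 j q" if ij: "\<not> int p dvd i - j" for i j
  proof
    assume "act 0 0 i q dvd act 0 0 j q"
    then have "q dvd act 0 0 (j - i) q"
      by (simp add: act_dvd_swap act_act)
    then obtain w where w: "act 0 0 (j - i) q = w * q"
      by (metis dvd_def mult.commute)
    have "prime_elem (w * q)"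
      using act_prime_elem[OF q, of 0 0 "j - i"] w by simp
    then have "w dvd 1 \<or> q dvd 1"
      by (intro Factorial_Ring.irreducibleD[OF prime_elem_imp_irreducible]) auto
    then have "w dvd 1"
      using q by auto
    obtain m where m: "[(j - i) * m = 1] (mod int p)" "0 \<le> m"
    proof -
      have "coprime (j - i) (int p)"
        using ij prime_p by (metis coprime_commute dvd_minus_iff minus_diff_eq prime_imp_coprime prime_nat_int_transfer)
      then obtain m where "[(j - i) * m = 1] (mod int p)"
        using cong_solve_coprime_int by blast
      then have "[(j - i) * (m mod int p) = 1] (mod int p)"
        by (simp add: cong_def mod_mult_right_eq)
      then show ?thesis
        using prime_p by (intro that[of "m mod int p"]) (auto simp: prime_gt_0_nat)
    qed
    have "act 0 0 1 q = act 0 0 (int (nat m) * (j - i)) q"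
      using m by (intro act_cong) (auto simp: mult.commute cong_sym)
    also have "\<dots> = w ^ nat m * q"
      using act_central_power[OF \<open>w dvd 1\<close> w, of "nat m"] by simp
    finally have "semi q"
      using \<open>w dvd 1\<close> q0 unfolding semi_def
      by (intro conjI exI[of _ "w ^ nat m"] unit_power) auto
    then show False
      using False by simp
  qed
  define P where "P m = (\<Prod>i<m. act 0 0 (int i) q)" for m :: nat
  have P: "act 0 0 1 (P p) = P p"
  proof -
    obtain m where m: "p = Suc m"
      using prime_p by (metis not_prime_0 not0_implies_Suc)
    have "act 0 0 1 (P p) = (\<Prod>i<p. act 0 0 (int (Suc i)) q)"
      by (simp add: P_def act_act act_prod add.commute)
    also have "\<dots> = (\<Prod>i<m. act 0 0 (int (Suc i)) q) * act 0 0 (int p) q"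
      by (simp add: m)
    also have "act 0 0 (int p) q = act 0 0 (int 0) q"
      by (simp add: act_period)
    also have "(\<Prod>i<m. act 0 0 (int (Suc i)) q) * act 0 0 (int 0) q = P p"
      unfolding m P_def by (subst prod.lessThan_Suc_shift) (simp add: mult.commute)
    finally show ?thesis .
  qed
  have P0: "P p \<noteq> 0"
    using q0 by (simp add: P_def act_eq_0_iff)
  \<comment> \<open>The conjugates divide x one after another, since \<zeta>^m maps x to a unit
    multiple of itself.\<close>
  have dvd: "P m dvd x" if x: "semi x" "q dvd x" and "m \<le> p" for m x
    using \<open>m \<le> p\<close>
  proof (induction m)
    case 0
    then show ?case by (simp add: P_def)
  next
    case (Suc m)
    then obtain y where y: "x = P m * y"
      by (auto simp: dvd_def)
    obtain k where k: "k dvd 1" "act 0 0 1 x = k * x"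
      using x(1) by (auto simp: semi_def)
    have "act 0 0 (int m) q dvd act 0 0 (int m) x"
      using x(2) by (simp add: act_dvd_iff)
    also have "act 0 0 (int m) x = k ^ m * x"
      using act_central_power[OF k, of m] by simp
    finally have "act 0 0 (int m) q dvd x"
      using unit_power[OF k(1), of m] by (simp add: dvd_mult_unit_iff')
    then have "act 0 0 (int m) q dvd P m \<or> act 0 0 (int m) q dvd y"
      unfolding y using act_prime_elem[OF q] by (simp add: prime_elem_dvd_mult_iff)
    moreover have "\<not> act 0 0 (int m) q dvd P m"
    proof
      assume "act 0 0 (int m) q dvd P m"
      then obtain i where "i < m" "act 0 0 (int m) q dvd act 0 0 (int i) q"
        unfolding P_def using prime_elem_dvd_prod[OF act_prime_elem[OF q]] by blast
      then show False
        using coprime_conj[of "int m" "int i"] Suc.prems zdvd_imp_le[of "int p" "int m - int i"]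
        by fastforce
    qed
    ultimately have "act 0 0 (int m) q dvd y"
      by blast
    then show ?case
      unfolding y P_def by (simp add: mult_dvd_mono)
  qed
  have "semi (P p)"
    using P P0 by (auto simp: semi_def intro!: exI[of _ 1])
  moreover have "q dvd P p"
  proof -
    have "act 0 0 (int 0) q dvd P p"
      unfolding P_def using prime_p by (intro dvd_prodI) (auto simp: prime_gt_0_nat)
    then show ?thesis
      by (simp add: act_period)
  qed
  moreover have "\<exists>e'. e' dvd 1 \<and> act a b c (P p) = e' * P p" if e: "e dvd 1" "act a b c q = e * q" for a b c e
  proof -
    have "act a b c (act 0 0 (int i) q) = e * act 0 0 (int i) q" for i
    proof -
      have "act a b c (act 0 0 (int i) q) = act 0 0 (int i) (act a b c q)"
        by (simp add: act_act add.commute)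
      then show ?thesis
        using e by (simp add: act_mult act_unit)
    qed
    then have "act a b c (P p) = e ^ p * P p"
      by (simp add: P_def act_prod prod.distrib)
    then show ?thesis
      using unit_power[OF e(1)] by blast
  qed
  moreover have "\<exists>k. r dvd act 0 0 k q" if "prime_elem r" "r dvd P p" for r
    using that prime_elem_dvd_prod unfolding P_def by blast
  moreover have "P p dvd x" if "semi x" "q dvd x" for x
    using dvd that by blast
  ultimately show ?thesis
    by (rule_tac exI[of _ "P p"], intro conjI allI impI) simp_all
qed

lemma N_nonzero: "f \<noteq> 0 \<Longrightarrow> N f \<noteq> 0"
  by (simp add: N_def act_eq_0_iff)

lemma dvd_N: "f dvd N f"
proof -
  have "act (int 0) 0 0 f dvd N f"
    unfolding N_def using prime_p by (intro dvd_prodI) (auto simp: prime_gt_0_nat)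
  then show ?thesis
    by (simp add: act_period)
qed

lemma N_power_mult: "e dvd 1 \<Longrightarrow> N (e * f) = e ^ p * N f"
  by (simp add: N_def act_mult act_unit prod.distrib)

text \<open>Up to the centre the stabilizing element is g = \<sigma>^a \<tau>^b, with g Q = d Q. As
  g^p acts trivially, d^p = 1. Since N absorbs \<sigma>^a and turns d into d^p, N Q is fixed by
  \<tau>^b, hence by \<tau> because b is invertible modulo p.\<close>

lemma act_N_eq_if_stabilized:
  assumes Q: "semi Q" and e: "e dvd 1" "act a b c Q = e * Q" and b: "\<not> int p dvd b"
  shows "act 0 1 0 (N Q) = N Q"
proof -
  obtain k where k: "Q \<noteq> 0" "k dvd 1" "act 0 0 1 Q = k * Q"
    using Q by (auto simp: semi_def)
  \<comment> \<open>The power of the central eigenvalue k corrects the corner entry from c to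
    0.\<close>
  define d where "d = k ^ nat ((- c) mod int p) * e"
  have d: "d dvd 1"
    unfolding d_def using unit_power[OF k(2)] e(1) by (rule unit_mult)
  have dQ: "act a b 0 Q = d * Q"
  proof -
    have "act a b 0 Q = act 0 0 (int (nat ((- c) mod int p)) * 1) (act a b c Q)"
      unfolding act_act using prime_p
      by (intro act_cong) (auto simp: prime_gt_0_nat cong_def mod_simps)
    also have "\<dots> = e * act 0 0 (int (nat ((- c) mod int p))) Q"
      using e by (simp add: act_mult act_unit)
    also have "act 0 0 (int (nat ((- c) mod int p))) Q = k ^ nat ((- c) mod int p) * Q"
      using act_central_power[OF k(2,3), of "nat ((- c) mod int p)"] by simp
    finally show ?thesis
      by (simp add: d_def mult_ac)
  qed
  \<comment> \<open>The n-th power of the matrix with index (a, b, 0) has corner entry a b times 0 +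
    ... + (n-1).\<close>
  have pow: "act (int n * a) (int n * b) (a * b * int (\<Sum>i<n. i)) Q = d ^ n * Q" for n
  proof (induction n)
    case 0
    then show ?case by (simp add: act_period)
  next
    case (Suc n)
    have "act (int (Suc n) * a) (int (Suc n) * b) (a * b * int (\<Sum>i<Suc n. i)) Q =
        act a b 0 (act (int n * a) (int n * b) (a * b * int (\<Sum>i<n. i)) Q)"
      by (simp add: act_act algebra_simps)
    also have "\<dots> = d ^ n * act a b 0 Q"
      unfolding Suc using d by (simp add: act_mult act_power act_unit)
    finally show ?case
      by (simp add: dQ)
  qed
  have "int p dvd int (\<Sum>i<p. i)"
    using gauss_sum_dvd by (simp only: int_dvd_int_iff)
  then have "d ^ p * Q = 1 * Q"
    unfolding pow[symmetric] by (subst act_period) auto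
  then have dp: "d ^ p = 1"
    using k(1) by simp
  have step: "act 0 b 0 (N Q) = N Q"
  proof -
    have "act 0 b 0 (N Q) = N (act 0 b 0 Q)"
      by (rule act_N[OF Q])
    also have "\<dots> = N (act a 0 0 (act 0 b 0 Q))"
      by (simp only: N_shift)
    also have "act a 0 0 (act 0 b 0 Q) = d * Q"
      by (simp add: act_act dQ)
    finally show ?thesis
      using d by (simp add: N_power_mult dp)
  qed
  have steps: "act 0 (int n * b) 0 (N Q) = N Q" for n
  proof (induction n)
    case (Suc n)
    have "act 0 (int (Suc n) * b) 0 (N Q) = act 0 b 0 (act 0 (int n * b) 0 (N Q))"
      by (simp add: act_act algebra_simps)
    then show ?case
      by (simp add: Suc step)
  qed (simp add: act_period)
  obtain m where "[b * m = 1] (mod int p)"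
  proof -
    have "coprime b (int p)"
      using b prime_p by (metis coprime_commute prime_imp_coprime prime_nat_int_transfer)
    then show ?thesis
      using cong_solve_coprime_int that by blast
  qed
  then have "[1 = int (nat (m mod int p)) * b] (mod int p)"
    using prime_p by (auto simp: prime_gt_0_nat cong_def mod_mult_right_eq mult.commute)
  then have "act 0 1 0 (N Q) = act 0 (int (nat (m mod int p)) * b) 0 (N Q)"
    by (intro act_cong) auto
  then show ?thesis
    by (simp only: steps)
qed

text \<open>Induction on the number of primes in N f. Each step writes N f = P N g with P fixed by
  \<tau> and no unit, so N g has the same eigenvalue and fewer primes. When f is a unit, so is N f,
  and \<tau> fixes it.\<close>

theorem act_N_eigenvalue_one:
  assumes f: "semi f" and c: "c dvd 1" "act 0 1 0 (N f) = c * N f"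
  shows "c = 1"
proof -
  have "c = 1" if "semi f" "act 0 1 0 (N f) = c * N f" "u dvd 1" "\<forall>q\<in>set qs. prime_elem q"
    "N f = u * prod_list qs" for f u qs
    using that
  proof (induction "length qs" arbitrary: f u qs rule: less_induct)
    case less
    note f = less.prems(1) and eig = less.prems(2)
    have f0: "f \<noteq> 0"
      using f by (auto simp: semi_def)
    have reduce: "c = 1"
      if g: "semi g" "N f = P * N g" and P: "act 0 1 0 P = P" "\<not> P dvd 1" for g P
    proof -
      obtain v rs where "v dvd 1" "\<forall>q\<in>set rs. prime_elem q" "N g = v * prod_list rs"
        "length rs < length qs"
        using proper_divisor_fewer_primes[OF less.prems(3,4) _ P(2), of "N g"] g(2) less.prems(5) by auto
      moreover have "act 0 1 0 (N g) = c * N g"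
      proof -
        have "P \<noteq> 0"
          using g(2) N_nonzero[OF f0] by auto
        moreover have "P * act 0 1 0 (N g) = P * (c * N g)"
          using eig unfolding g(2) act_mult P(1) by (simp add: mult_ac)
        ultimately show ?thesis
          by simp
      qed
      ultimately show ?thesis
        using less.hyps g(1) by blast
    qed
    obtain w ps where w: "w dvd 1" "\<forall>q\<in>set ps. prime_elem q" "f = w * prod_list ps"
      using prime_factorization_ex[OF f0] by blast
    show ?case
    proof (cases ps)
      case Nil
      then have "act 0 1 0 (N f) = 1 * N f"
        using w by (simp add: N_def act_unit act_prod act_power)
      then have "c * N f = 1 * N f"
        using eig by metis
      then show ?thesis
        using N_nonzero[OF f0] by simp
    next
      case (Cons q ps')
      then have q: "prime_elem q" "q dvd f"
        using w by auto
      obtain Q where Q: "semi Q" "q dvd Q" and hull: "\<And>x. semi x \<Longrightarrow> q dvd x \<Longrightarrow> Q dvd x"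
        and stab: "\<And>a b d e. e dvd 1 \<Longrightarrow> act a b d q = e * q \<Longrightarrow> \<exists>e'. e' dvd 1 \<and> act a b d Q = e' * Q"
        and conj: "\<And>r. prime_elem r \<Longrightarrow> r dvd Q \<Longrightarrow> \<exists>k. r dvd act 0 0 k q"
        using semi_hull[OF q(1)] by blast
      have "\<not> Q dvd 1"
        using dvd_trans[OF Q(2), of 1] prime_elem_not_unit[OF q(1)] by blast
      then have NQ: "\<not> N Q dvd 1"
        using dvd_trans[OF dvd_N, of Q 1] by blast
      show ?thesis
        \<comment> \<open>Either \<open>N Q\<close> itself can be split off, or it is coprime to its \<open>\<tau>\<close>-conjugates and
          the product of all of them can.\<close>
      proof (cases "\<exists>b. \<not> int p dvd b \<and> act 0 b 0 q dvd N Q")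
        case True
        then obtain b where b: "\<not> int p dvd b" "act 0 b 0 q dvd N Q"
          by blast
        \<comment> \<open>The primes dividing N Q are, up to units, conjugates of q under \<sigma>
          and \<zeta>. That \<tau>^b q is among them yields a group element with middle index b that
          maps q to an associate.\<close>
        then obtain j where "act 0 b 0 q dvd act (int j) 0 0 Q"
          using prime_elem_dvd_prod[OF act_prime_elem[OF q(1)], of 0 b 0 "\<lambda>i. act (int i) 0 0 Q" "{..<p}"]
          by (auto simp: N_def)
        then have "act (- int j) b 0 q dvd Q"
          using act_dvd_iff[of "- int j" 0 0 "act 0 b 0 q" "act (int j) 0 0 Q"]
          by (simp add: act_act act_period)
        then obtain k where "act (- int j) b 0 q dvd act 0 0 k q"
          using conj[OF act_prime_elem[OF q(1)]] by blast
        then have "act (- int j) b (- k) q dvd q"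
          using act_dvd_iff[of 0 0 "- k" "act (- int j) b 0 q" "act 0 0 k q"]
          by (simp add: act_act act_period)
        then obtain x where x: "q = act (- int j) b (- k) q * x" ..
        then have "act (- int j) b (- k) q dvd 1 \<or> x dvd 1"
          by (rule Factorial_Ring.irreducibleD[OF prime_elem_imp_irreducible[OF q(1)]])
        then have "x dvd 1"
          using act_prime_elem[OF q(1)] prime_elem_not_unit by blast
        then obtain y where y: "1 = x * y" ..
        have "act (- int j) b (- k) q * (x * y) = y * q"
          by (subst (2) x) (simp add: mult_ac)
        then have "act (- int j) b (- k) q = y * q"
          by (simp flip: y)
        moreover have "y dvd 1"
          by (simp add: y)
        ultimately obtain e where "e dvd 1" "act (- int j) b (- k) Q = e * Q"
          using stab by blast
        then have "act 0 1 0 (N Q) = N Q"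
          using act_N_eq_if_stabilized[OF Q(1)] b(1) by blast
        moreover obtain g where g: "f = Q * g"
          using hull[OF f q(2)] ..
        ultimately show ?thesis
          using reduce[of g "N Q"] semi_quotient[OF f Q(1) g] NQ by (simp add: N_mult)
      next
        case False
        have Tf: "act 0 (int m) 0 (N f) = c ^ m * N f" for m
          using act_central_power[OF c(1) eig, of m] by simp
        \<comment> \<open>N f is an eigenvector of \<tau>, so it is divisible by all
          \<tau>-conjugates of q.\<close>
        have dvdNf: "act 0 (int m) 0 q dvd N f" for m
        proof -
          have "act 0 (int m) 0 q dvd act 0 (int m) 0 (N f)"
            unfolding act_dvd_iff using q(2) dvd_N by (rule dvd_trans)
          then show ?thesis
            unfolding Tf using unit_power[OF c(1), of m] by (simp add: dvd_mult_unit_iff')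
        qed
        \<comment> \<open>The \<tau>-conjugates of N Q are removed one at a time. By the case
          assumption \<tau>^m q divides none of those already removed, so it divides N g, hence some
          \<sigma>-conjugate of g, and the whole hull \<tau>^m Q goes with it.\<close>
        have peel: "\<exists>g. semi g \<and> N f = (\<Prod>i<m. act 0 (int i) 0 (N Q)) * N g" if "m \<le> p" for m
          using that
        proof (induction m)
          case 0
          then show ?case using f by auto
        next
          case (Suc m)
          then obtain g where g: "semi g" "N f = (\<Prod>i<m. act 0 (int i) 0 (N Q)) * N g"
            by auto
          have "\<not> act 0 (int m) 0 q dvd (\<Prod>i<m. act 0 (int i) 0 (N Q))"
          proof
            assume "act 0 (int m) 0 q dvd (\<Prod>i<m. act 0 (int i) 0 (N Q))"
            then obtain i where i: "i < m" "act 0 (int m) 0 q dvd act 0 (int i) 0 (N Q)"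
              using prime_elem_dvd_prod[OF act_prime_elem[OF q(1)]] by blast
            then have "act 0 (int m - int i) 0 q dvd N Q"
              using act_dvd_iff[of 0 "- int i" 0 "act 0 (int m) 0 q" "act 0 (int i) 0 (N Q)"]
              by (simp add: act_act act_period)
            moreover have "\<not> int p dvd int m - int i"
              using i(1) Suc.prems zdvd_imp_le[of "int p" "int m - int i"] by linarith
            ultimately show False
              using False by blast
          qed
          then have "act 0 (int m) 0 q dvd N g"
            using dvdNf[of m] act_prime_elem[OF q(1)] prime_elem_dvd_multD unfolding g(2) by blast
          then obtain j where "act 0 (int m) 0 q dvd act (int j) 0 0 g"
            using prime_elem_dvd_prod[OF act_prime_elem[OF q(1)], of 0 "int m" 0 "\<lambda>i. act (int i) 0 0 g" "{..<p}"]
            by (auto simp: N_def)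
          then have "q dvd act 0 (- int m) 0 (act (int j) 0 0 g)"
            by (simp add: act_dvd_swap)
          then have "Q dvd act 0 (- int m) 0 (act (int j) 0 0 g)"
            by (intro hull semi_act g(1))
          then have "act 0 (int m) 0 Q dvd act (int j) 0 0 g"
            by (simp add: act_dvd_swap)
          then obtain h where h: "act (int j) 0 0 g = act 0 (int m) 0 Q * h" ..
          have "semi h"
            using semi_quotient[OF semi_act[OF g(1)] semi_act[OF Q(1)] h] .
          moreover have "N g = act 0 (int m) 0 (N Q) * N h"
            using arg_cong[OF h, of N] by (simp add: N_shift N_mult act_N[OF Q(1)])
          ultimately show ?case
            using g(2) by (intro exI[of _ h]) (simp add: mult_ac)
        qed
        define P where "P = (\<Prod>i<p. act 0 (int i) 0 (N Q))"
        obtain g where g: "semi g" "N f = P * N g"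
          using peel[of p] by (auto simp: P_def)
        obtain m where m: "p = Suc m"
          using prime_p by (metis not_prime_0 not0_implies_Suc)
        have "act 0 1 0 P = (\<Prod>i<p. act 0 (int (Suc i)) 0 (N Q))"
          by (simp add: P_def act_act act_prod add.commute)
        also have "\<dots> = (\<Prod>i<m. act 0 (int (Suc i)) 0 (N Q)) * act 0 (int p) 0 (N Q)"
          by (simp add: m)
        also have "act 0 (int p) 0 (N Q) = act 0 (int 0) 0 (N Q)"
          by (simp add: act_period)
        also have "(\<Prod>i<m. act 0 (int (Suc i)) 0 (N Q)) * act 0 (int 0) 0 (N Q) = P"
          unfolding m P_def by (subst prod.lessThan_Suc_shift) (simp add: mult.commute)
        finally have "act 0 1 0 P = P" .
        moreover have "\<not> P dvd 1"
        proof -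
          have "act 0 (int 0) 0 (N Q) dvd P"
            unfolding P_def m by (intro dvd_prodI) auto
          then have "N Q dvd P"
            by (simp add: act_period)
          then show ?thesis
            using NQ dvd_trans[of "N Q" P 1] by blast
        qed
        ultimately show ?thesis
          using reduce[OF g] by blast
      qed
    qed
  qed
  moreover have "N f \<noteq> 0"
    using f N_nonzero by (auto simp: semi_def)
  ultimately show ?thesis
    using f c(2) prime_factorization_ex by blast
qed

end

section \<open>The Heisenberg group acting on rational functions\<close>

definition root_unity :: "nat \<Rightarrow> int \<Rightarrow> complex" where
  "root_unity n k = cis (2 * pi * of_int k / of_nat n)"

lemma root_unity_0 [simp]: "root_unity n 0 = 1"
  by (simp add: root_unity_def)

lemma root_unity_add: "root_unity n (k + l) = root_unity n k * root_unity n l"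
  by (simp add: root_unity_def cis_mult add_divide_distrib ring_distribs)

lemma root_unity_nonzero [simp]: "root_unity n k \<noteq> 0"
  by (simp add: root_unity_def)

lemma root_unity_eq_1_iff:
  assumes "n > 0"
  shows "root_unity n k = 1 \<longleftrightarrow> int n dvd k"
proof
  assume "int n dvd k"
  then obtain m where "k = int n * m" ..
  then have "2 * pi * of_int k / of_nat n = 2 * pi * of_int m"
    using assms by simp
  then show "root_unity n k = 1"
    unfolding root_unity_def by (metis cis_multiple_2pi Ints_of_int)
next
  assume "root_unity n k = 1"
  then have "cos (2 * pi * of_int k / of_nat n) = 1"
    by (simp add: root_unity_def complex_eq_iff)
  then obtain m :: int where "2 * pi * of_int k / of_nat n = of_int m * 2 * pi"
    using cos_one_2pi_int by blast
  then have "real_of_int k = real_of_int (int n * m)"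
    using assms by (simp add: field_simps)
  then have "k = int n * m"
    by linarith
  then show "int n dvd k" by simp
qed

lemma root_unity_eq_iff:
  assumes "n > 0"
  shows "root_unity n k = root_unity n l \<longleftrightarrow> [k = l] (mod int n)"
proof -
  have "root_unity n k = root_unity n (k - l) * root_unity n l"
    by (simp flip: root_unity_add)
  then have "root_unity n k = root_unity n l \<longleftrightarrow> root_unity n (k - l) = 1"
    by simp
  then show ?thesis
    by (simp add: root_unity_eq_1_iff[OF assms] cong_iff_dvd_diff)
qed

lemma root_unity_square: "p > 0 \<Longrightarrow> root_unity (p ^ 2) (int p * k) = root_unity p k"
  by (simp add: root_unity_def power2_eq_square mult.assoc)

text \<open>The Schroedinger representation: \<sigma> shifts the variables, \<tau> multiplies the
  i-th one by the i-th power of a primitive p-th root of unity, \<zeta> is the scalar given by that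
  root. Variables from p on are fixed.\<close>

definition heis_subst :: "nat \<Rightarrow> int \<Rightarrow> int \<Rightarrow> int \<Rightarrow> nat \<Rightarrow> polyfun" where
  "heis_subst p a b c i = (if i < p
     then pconst (root_unity p (c + int i * b)) * pvar (nat ((int i + a) mod int p)) else pvar i)"

definition polyfun_act :: "nat \<Rightarrow> int \<Rightarrow> int \<Rightarrow> int \<Rightarrow> polyfun \<Rightarrow> polyfun" where
  "polyfun_act p a b c = psubst (heis_subst p a b c)"

lemma polyfun_act_pvar: "polyfun_act p a b c (pvar i) = heis_subst p a b c i"
  by (simp add: polyfun_act_def polyfun_eq_iff)

lemma polyfun_act_pconst [simp]: "polyfun_act p a b c (pconst z) = pconst z"
  by (simp add: polyfun_act_def polyfun_eq_iff)

lemma polyfun_act_comp: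
  assumes "p > 0"
  shows "polyfun_act p a b c (polyfun_act p a' b' c' f) = polyfun_act p (a + a') (b + b') (c + c' + a' * b) f"
proof -
  have "pf (heis_subst p a' b' c' i) (\<lambda>i. pf (heis_subst p a b c i) v) =
      pf (heis_subst p (a + a') (b + b') (c + c' + a' * b) i) v" for i v
  proof (cases "i < p")
    case True
    \<comment> \<open>When the outer substitution acts, the i-th variable has become the j-th, with
      j = i + a' modulo p; the exponent j b is the origin of the corner term a' b.\<close>
    define j where "j = nat ((int i + a') mod int p)"
    have j: "int j = (int i + a') mod int p" "j < p"
      using assms by (auto simp: j_def nat_less_iff)
    have "root_unity p (c' + int i * b') * root_unity p (c + int j * b) =
        root_unity p (c + c' + a' * b + int i * (b + b'))"
    proof -
      have "[int j * b = (int i + a') * b] (mod int p)"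
        unfolding j by (intro cong_mult) (auto simp: cong_def)
      then have "[c' + int i * b' + (c + int j * b) = c' + int i * b' + (c + (int i + a') * b)] (mod int p)"
        by (intro cong_add cong_refl)
      then show ?thesis
        using assms by (simp add: root_unity_eq_iff algebra_simps flip: root_unity_add)
    qed
    moreover have "(int j + a) mod int p = (int i + (a + a')) mod int p"
      by (simp add: j mod_simps add.commute add.left_commute)
    ultimately show ?thesis
      using True j(2) by (simp add: heis_subst_def flip: j_def mult.assoc)
  qed (simp add: heis_subst_def)
  then show ?thesis
    by (simp add: polyfun_act_def polyfun_eq_iff)
qed

lemma polyfun_act_period:
  assumes "p > 0" "int p dvd a" "int p dvd b" "int p dvd c"
  shows "polyfun_act p a b c f = f"
proof -
  have "pf (heis_subst p a b c i) v = v i" for i v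
  proof -
    have "root_unity p (c + int i * b) = 1"
      using assms by (simp add: root_unity_eq_1_iff)
    moreover have "i < p \<Longrightarrow> nat ((int i + a) mod int p) = i"
      using assms by (auto elim!: dvdE)
    ultimately show ?thesis
      by (simp add: heis_subst_def)
  qed
  then show ?thesis
    by (simp add: polyfun_act_def polyfun_eq_iff)
qed

lemma heisenberg_action_ufd_polyfun:
  assumes "prime p" "odd p"
  shows "heisenberg_action_ufd p (polyfun_act p)"
proof unfold_locales
  show "polyfun_act p a b c u = u" if "u dvd 1" for a b c u
    using that polyfun_unit_const by (auto simp: dvd_def) (metis polyfun_act_pconst)
qed (use assms polyfun_act_comp polyfun_act_period polyfun_prime_factorization in
    \<open>auto simp: prime_gt_0_nat polyfun_act_def psubst_hom\<close>)

text \<open>The value is computed from one chosen representative; it is independent of the choice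
  when h is multiplicative and vanishes only at 0.\<close>

definition fract_map :: "('a::idom \<Rightarrow> 'b::idom) \<Rightarrow> 'a fract \<Rightarrow> 'b fract" where
  "fract_map h q = (case SOME (a, b). b \<noteq> 0 \<and> q = Fract a b of (a, b) \<Rightarrow> Fract (h a) (h b))"

lemma fract_map_Fract:
  assumes mult: "\<And>x y. h (x * y) = h x * h y" and nz: "\<And>x. x \<noteq> 0 \<Longrightarrow> h x \<noteq> 0" and b: "b \<noteq> 0"
  shows "fract_map h (Fract a b) = Fract (h a) (h b)"
proof -
  obtain c d where cd: "(SOME (c, d). d \<noteq> 0 \<and> Fract a b = Fract c d) = (c, d)"
    by (cases "SOME (c, d). d \<noteq> 0 \<and> Fract a b = Fract c d")
  have "(case (SOME (c, d). d \<noteq> 0 \<and> Fract a b = Fract c d) of (c, d) \<Rightarrow> d \<noteq> 0 \<and> Fract a b = Fract c d)"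
    by (rule someI[of _ "(a, b)"]) (use b in auto)
  then have *: "d \<noteq> 0" "Fract a b = Fract c d"
    by (auto simp: cd)
  then have "h (a * d) = h (c * b)"
    using b by (simp add: eq_fract)
  then show ?thesis
    using * b nz by (simp add: fract_map_def cd eq_fract mult)
qed

context heisenberg_action
begin

definition fract_act :: "int \<Rightarrow> int \<Rightarrow> int \<Rightarrow> 'a fract \<Rightarrow> 'a fract" where
  "fract_act a b c = fract_map (act a b c)"

lemma fract_act_Fract: "y \<noteq> 0 \<Longrightarrow> fract_act a b c (Fract x y) = Fract (act a b c x) (act a b c y)"
  unfolding fract_act_def by (rule fract_map_Fract) (auto simp: act_mult act_eq_0_iff)

lemma heisenberg_action_fract: "heisenberg_action p fract_act"
proof
  fix a b c :: int and x y :: "'a fract"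
  obtain x1 x2 y1 y2 where xy: "x = Fract x1 x2" "x2 \<noteq> 0" "y = Fract y1 y2" "y2 \<noteq> 0"
    by (metis Fract_cases)
  show "fract_act a b c (x + y) = fract_act a b c x + fract_act a b c y"
    using xy by (simp add: fract_act_Fract act_add act_mult act_eq_0_iff)
  show "fract_act a b c (x * y) = fract_act a b c x * fract_act a b c y"
    using xy by (simp add: fract_act_Fract act_add act_mult act_eq_0_iff)
  show "fract_act a b c 1 = 1"
    by (simp add: One_fract_def fract_act_Fract act_one)
  show "fract_act a b c (fract_act a' b' c' x) = fract_act (a + a') (b + b') (c + c' + a' * b) x" for a' b' c'
    using xy by (simp add: fract_act_Fract act_act act_eq_0_iff)
  show "fract_act a b c x = x" if "int p dvd a" "int p dvd b" "int p dvd c"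
    using xy that by (simp add: fract_act_Fract act_period)
qed (use prime_p odd_p in auto)

end

context heisenberg_action_ufd
begin

interpretation fract: heisenberg_action p fract_act
  by (rule heisenberg_action_fract)

text \<open>Over a denominator invariant under the whole group, the numerator is a polynomial with
  the same \<zeta>-invariance and the same eigenvalue of its norm.\<close>

theorem fract_norm_eigenvalue_one:
  assumes z: "z \<noteq> 0" "fract_act 0 0 1 z = z"
    and c: "c dvd 1" "fract_act 0 1 0 (fract.N z) = to_fract c * fract.N z"
  shows "c = 1"
proof -
  obtain f0 g0 where fg: "z = Fract f0 g0" "g0 \<noteq> 0"
    by (metis Fract_cases)
  \<comment> \<open>The product of all conjugates of g0 is invariant and divisible by g0; r is the
    complementary factor.\<close>
  define n where "n = (\<Prod>f\<in>maps. f g0)"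
  define r where "r = (\<Prod>f\<in>maps - {act 0 0 0}. f g0)"
  have n: "n = g0 * r"
    unfolding n_def r_def using act_in_maps[of 0 0 0]
    by (subst prod.remove[OF finite_maps]) (auto simp: act_period)
  have n0: "n \<noteq> 0"
    using fg(2) finite_maps by (auto simp: n_def maps_def act_eq_0_iff)
  have ninv: "act a b d n = n" for a b d
    by (simp add: n_def act_prod_maps)
  define f where "f = f0 * r"
  have zf: "z = Fract f n"
    using n0 fg(2) by (auto simp: fg n f_def eq_fract)
  have f0: "f \<noteq> 0"
    using z(1) zf by (auto simp: Zero_fract_def eq_fract n0)
  have "act 0 0 1 f = f"
    using z(2) n0 by (simp add: zf fract_act_Fract ninv eq_fract)
  then have "semi f"
    using f0 by (auto simp: semi_def intro!: exI[of _ 1])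
  have Nz: "fract.N z = Fract (N f) (n ^ p)"
  proof -
    have "(\<Prod>i\<in>I. fract_act (int i) 0 0 z) = Fract (\<Prod>i\<in>I. act (int i) 0 0 f) (n ^ card I)" if "finite I" for I
      using that by induction (auto simp: zf fract_act_Fract n0 ninv One_fract_def)
    then show ?thesis
      by (simp add: fract.N_def N_def)
  qed
  have "Fract (act 0 1 0 (N f)) (n ^ p) = Fract (c * N f) (n ^ p)"
    using c(2) n0 by (simp add: Nz fract_act_Fract act_power ninv to_fract_def)
  then have "act 0 1 0 (N f) = c * N f"
    using n0 by (simp add: eq_fract)
  then show ?thesis
    using act_N_eigenvalue_one \<open>semi f\<close> c(1) by blast
qed

end

section \<open>Independence of characters and Hilbert 90\<close>

text \<open>Evaluate the relation at x y and subtract e0 y times the relation at x: this removes e0,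
  and y can be chosen with e y different from e0 y. The set D admits characters that are given on a
  subfield only.\<close>

lemma dedekind_independence:
  fixes E :: "('a::monoid_mult \<Rightarrow> 'b::field) set"
  assumes "finite E" and D: "1 \<in> D" "\<And>x y. x \<in> D \<Longrightarrow> y \<in> D \<Longrightarrow> x * y \<in> D"
    and one: "\<And>e. e \<in> E \<Longrightarrow> e 1 = 1"
    and mult: "\<And>e x y. e \<in> E \<Longrightarrow> x \<in> D \<Longrightarrow> y \<in> D \<Longrightarrow> e (x * y) = e x * e y"
    and distinct: "\<And>e e'. e \<in> E \<Longrightarrow> e' \<in> E \<Longrightarrow> e \<noteq> e' \<Longrightarrow> \<exists>x\<in>D. e x \<noteq> e' x"
    and zero: "\<And>x. x \<in> D \<Longrightarrow> (\<Sum>e\<in>E. w e * e x) = 0"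
    and e: "e \<in> E"
  shows "w e = 0"
  using assms(1) one mult distinct zero e
proof (induction E arbitrary: w e rule: finite_induct)
  case empty
  then show ?case by simp
next
  case (insert e0 E)
  have *: "w e = 0" if e: "e \<in> E" for e
  proof -
    obtain y where y: "y \<in> D" "e y \<noteq> e0 y"
      using insert.prems(3)[of e e0] insert.hyps(2) e by auto
    have "w e * (e y - e0 y) = 0"
    proof (rule insert.IH[of "\<lambda>f. w f * (f y - e0 y)"])
      show "(\<Sum>f\<in>E. w f * (f y - e0 y) * f x) = 0" if x: "x \<in> D" for x
      proof -
        have "(\<Sum>f\<in>insert e0 E. w f * f (x * y)) = (\<Sum>f\<in>insert e0 E. w f * (f x * f y))"
          using insert.prems(2) x y by (intro sum.cong) auto
        then have "0 = (\<Sum>f\<in>insert e0 E. w f * (f x * f y)) - e0 y * (\<Sum>f\<in>insert e0 E. w f * f x)"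
          using insert.prems(4)[OF D(2)[OF x y(1)]] insert.prems(4)[OF x] by simp
        also have "\<dots> = (\<Sum>f\<in>insert e0 E. w f * (f y - e0 y) * f x)"
          unfolding sum_distrib_left sum_subtractf[symmetric] by (simp add: algebra_simps)
        also have "\<dots> = (\<Sum>f\<in>E. w f * (f y - e0 y) * f x)"
          using insert.hyps by simp
        finally show ?thesis by simp
      qed
    qed (use insert.prems e in auto)
    then show ?thesis
      using y(2) by simp
  qed
  moreover have "w e0 = 0"
    using insert.prems(4)[OF D(1)] insert.hyps insert.prems(1)[of e0] * by simp
  ultimately show ?case
    using insert.prems(5) by auto
qed

text \<open>The infinite group is reduced to the finite set E of embeddings of D, the field fixed by
  the pointwise stabilizer of S. D need not be stable under G; it suffices that G permutes E by
  composition from the left. The element sought is the resolvent, the sum of \<chi>(e)^(-1) e(x),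
  which is nonzero for some x by independence of characters.\<close>

lemma hilbert90_finite_orbits:
  fixes G :: "('a::field \<Rightarrow> 'a) set"
  assumes id: "id \<in> G" and comp: "\<And>g h. g \<in> G \<Longrightarrow> h \<in> G \<Longrightarrow> g \<circ> h \<in> G"
    and inverse: "\<And>g. g \<in> G \<Longrightarrow> \<exists>h\<in>G. h \<circ> g = id \<and> g \<circ> h = id"
    and add: "\<And>g x y. g \<in> G \<Longrightarrow> g (x + y) = g x + g y"
    and mult: "\<And>g x y. g \<in> G \<Longrightarrow> g (x * y) = g x * g y"
    and one: "\<And>g. g \<in> G \<Longrightarrow> g 1 = 1"
    and chi: "\<And>g h. g \<in> G \<Longrightarrow> h \<in> G \<Longrightarrow> \<chi> (g \<circ> h) = \<chi> g * \<chi> h"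
    and chi_nz: "\<And>g. g \<in> G \<Longrightarrow> \<chi> g \<noteq> 0"
    and chi_fixed: "\<And>g h. g \<in> G \<Longrightarrow> h \<in> G \<Longrightarrow> g (\<chi> h) = \<chi> h"
    and S: "finite S" "\<And>s. s \<in> S \<Longrightarrow> finite {g s |g. g \<in> G}"
    and cont: "\<And>g. g \<in> G \<Longrightarrow> (\<And>s. s \<in> S \<Longrightarrow> g s = s) \<Longrightarrow> \<chi> g = 1"
  shows "\<exists>\<theta>. \<theta> \<noteq> 0 \<and> (\<forall>g\<in>G. g \<theta> = \<chi> g * \<theta>)"
proof -
  define D where "D = {x. \<forall>g\<in>G. (\<forall>s\<in>S. g s = s) \<longrightarrow> g x = x}"
  define E where "E = (\<lambda>g. restrict g D) ` G"
  have SD: "S \<subseteq> D"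
    by (auto simp: D_def)
  have D: "1 \<in> D" "\<And>x y. x \<in> D \<Longrightarrow> y \<in> D \<Longrightarrow> x * y \<in> D"
    by (auto simp: D_def one mult)
  \<comment> \<open>Both \<chi> and the restriction to D depend only on the values on S, because the
    quotient of g and h fixes S.\<close>
  have agree: "\<chi> g = \<chi> h \<and> (\<forall>x\<in>D. g x = h x)"
    if gh: "g \<in> G" "h \<in> G" and eq: "\<And>s. s \<in> S \<Longrightarrow> g s = h s" for g h
  proof -
    obtain k where k: "k \<in> G" "k \<circ> g = id" "g \<circ> k = id"
      using inverse[OF gh(1)] by blast
    have kh: "k \<circ> h \<in> G" "\<forall>s\<in>S. (k \<circ> h) s = s"
      using comp[OF k(1) gh(2)] k(2) by (auto simp: fun_eq_iff simp flip: eq)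
    have "g \<circ> (k \<circ> h) = h"
      using k(3) by (simp flip: comp_assoc)
    then have "\<chi> h = \<chi> g"
      using chi[OF gh(1) kh(1)] cont[OF kh(1)] kh(2) by simp
    moreover have "h x = g x" if "x \<in> D" for x
    proof -
      have "(k \<circ> h) x = x"
        using that kh by (auto simp: D_def)
      then show ?thesis
        using k(3) by (metis comp_apply id_apply)
    qed
    ultimately show ?thesis by simp
  qed
  have "finite E"
  proof -
    have "inj_on (\<lambda>e. restrict e S) E"
    proof (rule inj_onI)
      fix e e' assume "e \<in> E" "e' \<in> E" and eq: "restrict e S = restrict e' S"
      then obtain g h where gh: "g \<in> G" "e = restrict g D" "h \<in> G" "e' = restrict h D"
        by (auto simp: E_def)
      have "g s = h s" if "s \<in> S" for s
        using fun_cong[OF eq, of s] that SD gh by auto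
      then show "e = e'"
        using agree[OF gh(1,3)] by (auto simp: gh fun_eq_iff restrict_def)
    qed
    moreover have "(\<lambda>e. restrict e S) ` E \<subseteq> Pi\<^sub>E S (\<lambda>s. {g s |g. g \<in> G})"
      using SD by (auto simp: E_def)
    moreover have "finite (Pi\<^sub>E S (\<lambda>s. {g s |g. g \<in> G}))"
      using S by (intro finite_PiE) auto
    ultimately show ?thesis
      using inj_on_finite by blast
  qed
  define w where "w e = inverse (\<chi> (SOME g. g \<in> G \<and> restrict g D = e))" for e
  have w: "w (restrict g D) = inverse (\<chi> g)" if g: "g \<in> G" for g
  proof -
    define h where "h = (SOME h. h \<in> G \<and> restrict h D = restrict g D)"
    have h: "h \<in> G \<and> restrict h D = restrict g D"
      unfolding h_def by (rule someI[of _ g]) (use g in auto)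
    have "h s = g s" if "s \<in> S" for s
      using fun_cong[OF conjunct2[OF h], of s] that SD by auto
    then show ?thesis
      using agree[of h g] h g by (simp add: w_def flip: h_def)
  qed
  have "\<exists>x\<in>D. (\<Sum>e\<in>E. w e * e x) \<noteq> 0"
  proof (rule ccontr)
    assume neg: "\<not> ?thesis"
    have "w (restrict id D) = 0"
    proof (rule dedekind_independence[where E = E and D = D and w = w and e = "restrict id D"])
      show "finite E" by fact
      show "restrict id D \<in> E"
        using id by (auto simp: E_def)
      show "(\<Sum>e\<in>E. w e * e x) = 0" if "x \<in> D" for x
        using neg that by blast
      show "\<exists>x\<in>D. e x \<noteq> e' x" if "e \<in> E" "e' \<in> E" "e \<noteq> e'" for e e'
        using that by (auto simp: E_def fun_eq_iff restrict_def split: if_splits)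
    qed (use D one mult in \<open>auto simp: E_def\<close>)
    then show False
      using w[OF id] chi_nz[OF id] by simp
  qed
  then obtain x where x: "x \<in> D" "(\<Sum>e\<in>E. w e * e x) \<noteq> 0"
    by blast
  define \<theta> where "\<theta> = (\<Sum>e\<in>E. w e * e x)"
  have "h \<theta> = \<chi> h * \<theta>" if h: "h \<in> G" for h
  proof -
    obtain k where k: "k \<in> G" "k \<circ> h = id" "h \<circ> k = id"
      using inverse[OF h] by blast
    have h0: "h 0 = 0"
      using add[OF h, of 0 0] by (metis add_0 add_cancel_right_left)
    have hsum: "h (sum f I) = (\<Sum>i\<in>I. h (f i))" for f :: "('a \<Rightarrow> 'a) \<Rightarrow> 'a" and I
      by (induction I rule: infinite_finite_induct) (auto simp: add[OF h] h0)
    have hinv: "h (inverse (\<chi> g)) = inverse (\<chi> g)" if "g \<in> G" for g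
    proof -
      have "\<chi> g * h (inverse (\<chi> g)) = h (\<chi> g * inverse (\<chi> g))"
        by (simp add: mult[OF h] chi_fixed[OF h that])
      also have "\<dots> = 1"
        using chi_nz[OF that] one[OF h] by simp
      finally show ?thesis
        using chi_nz[OF that] by (metis inverse_unique)
    qed
    have bij: "bij_betw (\<lambda>e. restrict (h \<circ> e) D) E E"
    proof (rule bij_betw_byWitness[where f' = "\<lambda>e. restrict (k \<circ> e) D"])
      have *: "restrict (a \<circ> restrict b D) D = restrict (a \<circ> b) D" for a b :: "'a \<Rightarrow> 'a"
        by (auto simp: restrict_def)
      show "(\<lambda>e. restrict (h \<circ> e) D) ` E \<subseteq> E" "(\<lambda>e. restrict (k \<circ> e) D) ` E \<subseteq> E"
        using comp[OF h] comp[OF k(1)] by (auto simp: E_def * simp del: restrict_apply)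
      show "\<forall>e\<in>E. restrict (k \<circ> restrict (h \<circ> e) D) D = e"
        using k(2) by (auto simp: E_def * comp_assoc[symmetric] simp del: restrict_apply)
      show "\<forall>e\<in>E. restrict (h \<circ> restrict (k \<circ> e) D) D = e"
        using k(3) by (auto simp: E_def * comp_assoc[symmetric] simp del: restrict_apply)
    qed
    have "h \<theta> = (\<Sum>e\<in>E. h (w e * e x))"
      by (simp add: \<theta>_def hsum)
    also have "\<dots> = (\<Sum>e\<in>E. \<chi> h * (w (restrict (h \<circ> e) D) * (restrict (h \<circ> e) D) x))"
    proof (intro sum.cong refl)
      fix e assume "e \<in> E"
      then obtain g where g: "g \<in> G" "e = restrict g D"
        by (auto simp: E_def)
      have "restrict (h \<circ> e) D = restrict (h \<circ> g) D"
        by (auto simp: g(2) restrict_def)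
      then show "h (w e * e x) = \<chi> h * (w (restrict (h \<circ> e) D) * (restrict (h \<circ> e) D) x)"
        using x(1) h g(1) chi_nz
        by (simp add: g(2) w comp chi mult hinv)
    qed
    also have "\<dots> = \<chi> h * (\<Sum>e\<in>E. w e * e x)"
      unfolding sum_distrib_left[symmetric]
      by (subst sum.reindex_bij_betw[OF bij, of "\<lambda>e. w e * e x"]) simp
    finally show ?thesis
      by (simp add: \<theta>_def)
  qed
  then show ?thesis
    using x(2) by (auto simp: \<theta>_def[symmetric])
qed

section \<open>Extending homomorphisms to an algebraic closure\<close>

text \<open>Partial embeddings with a subring as domain; values of h outside A carry no
  meaning.\<close>

definition hom_on :: "'a::comm_ring_1 set \<Rightarrow> ('a \<Rightarrow> 'b::comm_ring_1) \<Rightarrow> bool" where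
  "hom_on A h \<longleftrightarrow> subring_set A \<and> inj_on h A \<and> h 1 = 1 \<and>
     (\<forall>x\<in>A. \<forall>y\<in>A. h (x - y) = h x - h y \<and> h (x * y) = h x * h y)"

lemma hom_onD:
  assumes "hom_on A h"
  shows "subring_set A" "inj_on h A" "h 1 = 1" "h 0 = 0"
    "x \<in> A \<Longrightarrow> y \<in> A \<Longrightarrow> h (x - y) = h x - h y" "x \<in> A \<Longrightarrow> y \<in> A \<Longrightarrow> h (x * y) = h x * h y"
    "x \<in> A \<Longrightarrow> y \<in> A \<Longrightarrow> h (x + y) = h x + h y" "x \<in> A \<Longrightarrow> h x = 0 \<longleftrightarrow> x = 0"
proof -
  show A: "subring_set A" "inj_on h A" "h 1 = 1"
    and diff: "\<And>x y. x \<in> A \<Longrightarrow> y \<in> A \<Longrightarrow> h (x - y) = h x - h y"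
    and "x \<in> A \<Longrightarrow> y \<in> A \<Longrightarrow> h (x * y) = h x * h y"
    using assms by (auto simp: hom_on_def)
  note cl = subring_set_closed[OF A(1)]
  show zero: "h 0 = 0"
    using diff[of 1 1] cl by simp
  show "x \<in> A \<Longrightarrow> y \<in> A \<Longrightarrow> h (x + y) = h x + h y"
    using diff[of x "- y"] diff[of 0 y] cl zero by simp
  show "x \<in> A \<Longrightarrow> h x = 0 \<longleftrightarrow> x = 0"
    using inj_onD[OF A(2), of x 0] zero cl by auto
qed

lemma hom_on_sum:
  assumes "hom_on A h" "\<And>i. i \<in> I \<Longrightarrow> f i \<in> A"
  shows "h (sum f I) = (\<Sum>i\<in>I. h (f i))"
  using assms(2)
  by (induction I rule: infinite_finite_induct)
    (auto simp: hom_onD[OF assms(1)] subring_set_sum[OF hom_onD(1)[OF assms(1)]])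

lemma hom_on_map_poly:
  assumes h: "hom_on A h" and F: "F \<in> polys_in A" and G: "G \<in> polys_in A"
  shows "map_poly h (F + G) = map_poly h F + map_poly h G"
    "map_poly h (F - G) = map_poly h F - map_poly h G"
    "map_poly h (F * G) = map_poly h F * map_poly h G"
    "c \<in> A \<Longrightarrow> map_poly h (smult c F) = smult (h c) (map_poly h F)"
    "map_poly h F = 0 \<longleftrightarrow> F = 0" "Polynomial.degree (map_poly h F) = Polynomial.degree F"
proof -
  note D = hom_onD[OF h]
  note c = coeff_map_poly[of h, OF D(4)]
  note FG = coeff_polys_in[OF F] coeff_polys_in[OF G]
  show "map_poly h (F + G) = map_poly h F + map_poly h G"
    "map_poly h (F - G) = map_poly h F - map_poly h G"
    "c \<in> A \<Longrightarrow> map_poly h (smult c F) = smult (h c) (map_poly h F)"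
    by (rule poly_eqI; simp add: c D FG)+
  show "map_poly h (F * G) = map_poly h F * map_poly h G"
    by (rule poly_eqI)
      (simp add: c coeff_mult hom_on_sum[OF h] D FG subring_set_closed(6)[OF D(1)])
  show "map_poly h F = 0 \<longleftrightarrow> F = 0"
    by (simp add: poly_eq_iff c D FG)
  show "Polynomial.degree (map_poly h F) = Polynomial.degree F"
    by (simp add: Polynomial.degree_def c D FG)
qed

text \<open>Minimal degree without normalization: A is merely a ring, so the polynomial cannot
  always be made monic, and pseudo-division takes the place of division.\<close>

definition minimal_poly_in :: "'a::idom set \<Rightarrow> 'a \<Rightarrow> 'a poly \<Rightarrow> bool" where
  "minimal_poly_in A u q \<longleftrightarrow> q \<in> polys_in A \<and> q \<noteq> 0 \<and> poly q u = 0 \<and>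
     (\<forall>r\<in>polys_in A. r \<noteq> 0 \<longrightarrow> poly r u = 0 \<longrightarrow> Polynomial.degree q \<le> Polynomial.degree r)"

lemma minimal_poly_in_exists:
  assumes "\<exists>q\<in>polys_in A. q \<noteq> 0 \<and> poly q u = 0"
  shows "\<exists>q. minimal_poly_in A u q"
  using ex_has_least_nat[of "\<lambda>q. q \<in> polys_in A \<and> q \<noteq> 0 \<and> poly q u = 0" _ Polynomial.degree] assms
  unfolding minimal_poly_in_def by blast

text \<open>Up to constants q0 divides every polynomial over A with root u, which gives one
  direction. For the other, the least polynomial q1 whose image kills u' divides both q0 and q up to
  constants; its cofactor in q0 has smaller degree than q0, so u must be a root of q1.\<close>

lemma root_map_poly_iff:
  fixes A :: "'a::idom set" and h :: "'a \<Rightarrow> 'b::idom"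
  assumes h: "hom_on A h" and q0: "minimal_poly_in A u q0" "poly (map_poly h q0) u' = 0"
    and q: "q \<in> polys_in A"
  shows "poly q u = 0 \<longleftrightarrow> poly (map_poly h q) u' = 0"
proof
  note A = hom_onD(1)[OF h]
  note H = hom_on_map_poly[OF h]
  note P = subring_set_closed[OF subring_set_polys_in[OF A]]
  have q0': "q0 \<in> polys_in A" "q0 \<noteq> 0" "poly q0 u = 0"
    and min: "\<And>r. r \<in> polys_in A \<Longrightarrow> r \<noteq> 0 \<Longrightarrow> poly r u = 0 \<Longrightarrow> Polynomial.degree q0 \<le> Polynomial.degree r"
    using q0(1) by (auto simp: minimal_poly_in_def)
  have div: "\<exists>c s r. c \<in> A \<and> c \<noteq> 0 \<and> s \<in> polys_in A \<and> r \<in> polys_in A \<and> smult c f = s * g + r \<and>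
      (r = 0 \<or> Polynomial.degree r < Polynomial.degree g)"
    if "f \<in> polys_in A" "g \<in> polys_in A" "g \<noteq> 0" for f g
    using pseudo_division[OF A that(2,3,1)] that(3) coeff_polys_in[OF that(2)] subring_set_power[OF A]
    by (metis leading_coeff_0_iff power_not_zero)
  {
    assume qu: "poly q u = 0"
    obtain c s r where csr: "c \<in> A" "c \<noteq> 0" "s \<in> polys_in A" "r \<in> polys_in A"
      "smult c q = s * q0 + r" "r = 0 \<or> Polynomial.degree r < Polynomial.degree q0"
      using div[OF q q0'(1,2)] by blast
    have "poly r u = 0"
      using arg_cong[OF csr(5), of "\<lambda>x. poly x u"] qu q0'(3) by simp
    then have "r = 0"
      using csr(4,6) min[of r] by (cases "r = 0") auto
    then have "map_poly h (smult c q) = map_poly h (s * q0)"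
      using csr(5) by simp
    then have "smult (h c) (map_poly h q) = map_poly h s * map_poly h q0"
      using csr(1) by (simp add: H(4)[OF q q] H(3)[OF csr(3) q0'(1)])
    then have "h c * poly (map_poly h q) u' = 0"
      using q0(2) by (metis mult_zero_right poly_mult poly_smult)
    then show "poly (map_poly h q) u' = 0"
      using hom_onD(8)[OF h csr(1)] csr(2) by simp
  next
    assume qu': "poly (map_poly h q) u' = 0"
    show "poly q u = 0"
    proof (cases "q = 0")
      case False
      let ?P = "\<lambda>r. r \<in> polys_in A \<and> r \<noteq> 0 \<and> poly (map_poly h r) u' = 0"
      have "?P q" using q qu' False by blast
      then obtain q1 where q1: "?P q1" and min1: "\<And>r. ?P r \<Longrightarrow> Polynomial.degree q1 \<le> Polynomial.degree r"
        using ex_has_least_nat[of ?P q Polynomial.degree] by blast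
      have q1': "q1 \<in> polys_in A" "q1 \<noteq> 0"
        using q1 by auto
      have div1: "\<exists>c s. c \<in> A \<and> c \<noteq> 0 \<and> s \<in> polys_in A \<and> smult c f = s * q1"
        if f: "f \<in> polys_in A" "poly (map_poly h f) u' = 0" for f
      proof -
        obtain c s r where csr: "c \<in> A" "c \<noteq> 0" "s \<in> polys_in A" "r \<in> polys_in A"
          "smult c f = s * q1 + r" "r = 0 \<or> Polynomial.degree r < Polynomial.degree q1"
          using div[OF f(1) q1'] by blast
        have "smult (h c) (map_poly h f) = map_poly h s * map_poly h q1 + map_poly h r"
          using csr q1' f P(6)[OF csr(3) q1'(1)] by (simp flip: H)
        then have "poly (smult (h c) (map_poly h f)) u' = poly (map_poly h s * map_poly h q1 + map_poly h r) u'"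
          by (rule arg_cong)
        then have "poly (map_poly h r) u' = 0"
          using f(2) q1 by simp
        then have "r = 0"
          using min1[of r] csr(4,6) by (cases "r = 0") auto
        then show ?thesis
          using csr by auto
      qed
      have deg1: "Polynomial.degree q1 \<noteq> 0"
      proof
        assume "Polynomial.degree q1 = 0"
        then have "Polynomial.degree (map_poly h q1) = 0"
          using H(6)[OF q1'(1) q1'(1)] by simp
        then have "map_poly h q1 = 0"
          using q1 by (metis degree_eq_zeroE mult_zero_right pCons_0_0 poly_pCons add.right_neutral poly_0)
        then show False
          using H(5)[OF q1'(1) q1'(1)] q1'(2) by simp
      qed
      obtain c s where cs: "c \<in> A" "c \<noteq> 0" "s \<in> polys_in A" "smult c q0 = s * q1"
        using div1[OF q0'(1) q0(2)] by blast
      have s0: "s \<noteq> 0"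
        using cs(2,4) q0'(2) by auto
      have "Polynomial.degree q0 = Polynomial.degree s + Polynomial.degree q1"
        using arg_cong[OF cs(4), of Polynomial.degree] cs(2) s0 q1' by (simp add: degree_mult_eq)
      then have "poly s u \<noteq> 0"
        using min[OF cs(3) s0] deg1 by auto
      moreover have "poly s u * poly q1 u = 0"
        using arg_cong[OF cs(4), of "\<lambda>x. poly x u"] q0'(3) by simp
      ultimately have "poly q1 u = 0"
        by simp
      moreover obtain d t where "d \<in> A" "d \<noteq> 0" "t \<in> polys_in A" "smult d q = t * q1"
        using div1[OF q qu'] by blast
      ultimately show ?thesis
        by (metis mult_eq_0_iff poly_mult poly_smult)
    qed simp
  }
qed

text \<open>The new domain is A[u]. A value is read off from an arbitrary polynomial representing
  the argument; that the choice does not matter and that the result is injective are the two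
  directions of \<open>root_map_poly_iff\<close>.\<close>

lemma hom_on_extend_root:
  fixes A :: "'a::idom set" and h :: "'a \<Rightarrow> 'b::idom"
  assumes h: "hom_on A h" and q0: "minimal_poly_in A u q0" "poly (map_poly h q0) u' = 0"
  shows "\<exists>A' h'. hom_on A' h' \<and> A \<subseteq> A' \<and> (\<forall>x\<in>A. h' x = h x) \<and> u \<in> A' \<and> h' u = u'"
proof -
  note A = hom_onD(1)[OF h]
  note H = hom_on_map_poly[OF h]
  note PS = subring_set_polys_in[OF A]
  note P = subring_set_closed[OF PS]
  define A' where "A' = (\<lambda>q. poly q u) ` polys_in A"
  define rep where "rep x = (SOME q. q \<in> polys_in A \<and> poly q u = x)" for x
  define h' where "h' x = poly (map_poly h (rep x)) u'" for x
  have rep: "rep x \<in> polys_in A \<and> poly (rep x) u = x" if "x \<in> A'" for x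
    unfolding rep_def by (rule someI_ex) (use that in \<open>auto simp: A'_def\<close>)
  have A': "poly q u \<in> A'" if "q \<in> polys_in A" for q
    using that by (auto simp: A'_def)
  have iff: "poly q u = 0 \<longleftrightarrow> poly (map_poly h q) u' = 0" if "q \<in> polys_in A" for q
    using root_map_poly_iff[OF h q0 that] .
  have iff2: "poly q u = poly r u \<longleftrightarrow> poly (map_poly h q) u' = poly (map_poly h r) u'"
    if "q \<in> polys_in A" "r \<in> polys_in A" for q r
    using iff[OF P(5)[OF that]] H(2)[OF that] by simp
  have h': "h' (poly q u) = poly (map_poly h q) u'" if "q \<in> polys_in A" for q
    unfolding h'_def using iff2[of q "rep (poly q u)"] rep[OF A'[OF that]] that by simp
  have "hom_on A' h'"
    unfolding hom_on_def
  proof (intro conjI ballI)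
    show "subring_set A'"
      unfolding subring_set_def A'_def
      using P by (auto simp flip: poly_diff poly_mult intro!: image_eqI[of _ _ 1])
    show "inj_on h' A'"
      by (rule inj_onI) (auto simp: A'_def h' iff2)
    have "map_poly h 1 = 1"
      by (simp add: hom_onD[OF h] map_poly_1')
    then show "h' 1 = 1"
      using h'[OF P(2)] by simp
    fix x y assume "x \<in> A'" "y \<in> A'"
    then obtain q r where qr: "q \<in> polys_in A" "x = poly q u" "r \<in> polys_in A" "y = poly r u"
      by (auto simp: A'_def)
    show "h' (x - y) = h' x - h' y"
      using h'[OF P(5)[OF qr(1,3)]] h'[OF qr(1)] h'[OF qr(3)] by (simp add: qr H[OF qr(1,3)])
    show "h' (x * y) = h' x * h' y"
      using h'[OF P(6)[OF qr(1,3)]] h'[OF qr(1)] h'[OF qr(3)] by (simp add: qr H[OF qr(1,3)])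
  qed
  moreover have "x \<in> A' \<and> h' x = h x" if "x \<in> A" for x
    using A'[OF const_polys_in[OF A that]] h'[OF const_polys_in[OF A that]]
    by (simp add: map_poly_pCons hom_onD[OF h])
  moreover have "u \<in> A' \<and> h' u = u'"
    using A'[OF monom_polys_in[OF A subring_set_closed(2)[OF A]], of 1]
      h'[OF monom_polys_in[OF A subring_set_closed(2)[OF A]], of 1]
    by (simp add: poly_monom map_poly_monom hom_onD[OF h])
  ultimately show ?thesis
    by blast
qed

definition graph_on :: "'a set \<Rightarrow> ('a \<Rightarrow> 'b) \<Rightarrow> ('a \<times> 'b) set" where
  "graph_on A h = (\<lambda>x. (x, h x)) ` A"

text \<open>Inclusion of graphs is extension of maps, and these closure conditions pass to unions of
  chains, as Zorn's lemma requires. Applied to differences of pairs, the last one says both that the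
  relation is single-valued and that it is injective.\<close>

lemma hom_on_graph_iff:
  "(\<exists>A h. hom_on A h \<and> H = graph_on A h) \<longleftrightarrow>
     (1, 1) \<in> H \<and>
     (\<forall>x y x' y'. (x, y) \<in> H \<longrightarrow> (x', y') \<in> H \<longrightarrow> (x - x', y - y') \<in> H \<and> (x * x', y * y') \<in> H) \<and>
     (\<forall>x y. (x, y) \<in> H \<longrightarrow> (x = 0 \<longleftrightarrow> y = 0))"
  (is "?L \<longleftrightarrow> ?R")
proof
  assume ?L
  then obtain A h where h: "hom_on A h" and H: "H = graph_on A h"
    by blast
  show ?R
    unfolding H graph_on_def using subring_set_closed[OF hom_onD(1)[OF h]]
    by (auto simp: image_iff hom_onD[OF h])
next
  assume R: ?R
  define A where "A = fst ` H"
  define h where "h x = (SOME y. (x, y) \<in> H)" for x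
  have hH: "(x, h x) \<in> H" if "x \<in> A" for x
    unfolding h_def by (rule someI_ex) (use that in \<open>force simp: A_def\<close>)
  have uniq: "y = y'" if "(x, y) \<in> H" "(x, y') \<in> H" for x y y'
  proof -
    have "(x - x, y - y') \<in> H"
      using R that by blast
    then have "x - x = 0 \<longleftrightarrow> y - y' = 0"
      using R by blast
    then show ?thesis
      by simp
  qed
  have AH: "x \<in> A \<and> h x = y" if "(x, y) \<in> H" for x y
  proof -
    have "x \<in> A"
      using that by (force simp: A_def)
    then show ?thesis
      using uniq[OF hH that] by blast
  qed
  have "inj_on h A"
  proof (rule inj_onI)
    fix x y assume xy: "x \<in> A" "y \<in> A" "h x = h y"
    have "(x - y, h x - h y) \<in> H"
      using R hH xy by blast
    then have "x - y = 0 \<longleftrightarrow> h x - h y = 0"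
      using R by blast
    then show "x = y"
      using xy(3) by simp
  qed
  moreover have "h 1 = 1" "1 \<in> A"
    using AH[of 1 1] R by auto
  moreover have "x - y \<in> A \<and> x * y \<in> A \<and> h (x - y) = h x - h y \<and> h (x * y) = h x * h y"
    if "x \<in> A" "y \<in> A" for x y
  proof -
    have "(x - y, h x - h y) \<in> H" "(x * y, h x * h y) \<in> H"
      using R hH that by blast+
    then show ?thesis
      using AH by blast
  qed
  ultimately have "hom_on A h"
    by (simp add: hom_on_def subring_set_def)
  moreover have "H = graph_on A h"
    using AH hH by (force simp: graph_on_def)
  ultimately show ?L
    by blast
qed

text \<open>A maximal extension is total: every u is algebraic over its domain, the image of the
  minimal polynomial has a root in the algebraically closed target, and the map extends to
  u.\<close>

theorem hom_on_extend_UNIV: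
  fixes A :: "'a::idom set" and h :: "'a \<Rightarrow> 'b::alg_closed_field"
  assumes h: "hom_on A h" and alg: "\<And>u. \<exists>q\<in>polys_in A. q \<noteq> 0 \<and> poly q u = 0"
  shows "\<exists>g. hom_on UNIV g \<and> (\<forall>x\<in>A. g x = h x)"
proof -
  define F where "F = {H. (\<exists>A' h'. hom_on A' h' \<and> H = graph_on A' h') \<and> graph_on A h \<subseteq> H}"
  have "\<exists>M\<in>F. \<forall>Z\<in>F. M \<subseteq> Z \<longrightarrow> Z = M"
  proof (rule subset_Zorn_nonempty)
    show "F \<noteq> {}"
      using h by (auto simp: F_def)
    fix C assume C: "C \<noteq> {}" "subset.chain F C"
    then have CF: "C \<subseteq> F" and tot: "\<And>Z Z2. Z \<in> C \<Longrightarrow> Z2 \<in> C \<Longrightarrow> Z \<subseteq> Z2 \<or> Z2 \<subseteq> Z"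
      by (auto simp: subset.chain_def subset_chain_def)
    have *: "(1, 1) \<in> H"
      "(x, y) \<in> H \<Longrightarrow> (x', y') \<in> H \<Longrightarrow> (x - x', y - y') \<in> H \<and> (x * x', y * y') \<in> H"
      "(x, y) \<in> H \<Longrightarrow> x = 0 \<longleftrightarrow> y = 0" if "H \<in> C" for H x y x' y'
    proof -
      have "\<exists>A' h'. hom_on A' h' \<and> H = graph_on A' h'"
        using that CF by (auto simp: F_def)
      note this[unfolded hom_on_graph_iff]
      then show "(1, 1) \<in> H"
        "(x, y) \<in> H \<Longrightarrow> (x', y') \<in> H \<Longrightarrow> (x - x', y - y') \<in> H \<and> (x * x', y * y') \<in> H"
        "(x, y) \<in> H \<Longrightarrow> x = 0 \<longleftrightarrow> y = 0"
        by blast+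
    qed
    have "\<exists>A' h'. hom_on A' h' \<and> \<Union>C = graph_on A' h'"
      unfolding hom_on_graph_iff
    proof (intro conjI allI impI)
      show "(1, 1) \<in> \<Union>C"
        using C(1) *(1) by blast
      show "x = 0 \<longleftrightarrow> y = 0" if "(x, y) \<in> \<Union>C" for x y
        using that *(3) by blast
      fix x y x' y' assume "(x, y) \<in> \<Union>C" "(x', y') \<in> \<Union>C"
      then obtain Z where "Z \<in> C" "(x, y) \<in> Z" "(x', y') \<in> Z"
        using tot by blast
      then show "(x - x', y - y') \<in> \<Union>C" "(x * x', y * y') \<in> \<Union>C"
        using *(2) by blast+
    qed
    moreover have "graph_on A h \<subseteq> \<Union>C"
      using C(1) CF by (auto simp: F_def)
    ultimately show "\<Union>C \<in> F"
      by (simp add: F_def)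
  qed
  then obtain M where M: "M \<in> F" and max: "\<And>Z. Z \<in> F \<Longrightarrow> M \<subseteq> Z \<Longrightarrow> Z = M"
    by blast
  obtain A' g where g: "hom_on A' g" "M = graph_on A' g" "graph_on A h \<subseteq> graph_on A' g"
    using M by (auto simp: F_def)
  have ext: "A \<subseteq> A'" "\<And>x. x \<in> A \<Longrightarrow> g x = h x"
    using g(3) by (auto simp: graph_on_def)
  have "u \<in> A'" for u
  proof -
    obtain q where q: "q \<in> polys_in A" "q \<noteq> 0" "poly q u = 0"
      using alg[of u] by blast
    then have "q \<in> polys_in A'"
      using ext(1) by (auto simp: polys_in_def)
    then obtain q0 where q0: "minimal_poly_in A' u q0"
      using q minimal_poly_in_exists by blast
    have q0': "q0 \<in> polys_in A'" "q0 \<noteq> 0" "poly q0 u = 0"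
      using q0 by (auto simp: minimal_poly_in_def)
    then have "0 < Polynomial.degree q0"
      by (metis degree_eq_zeroE gr0I mult_zero_right pCons_0_0 poly_pCons add.right_neutral poly_0)
    then have "0 < Polynomial.degree (map_poly g q0)"
      using hom_on_map_poly(6)[OF g(1) q0'(1) q0'(1)] by simp
    then obtain u' where u': "poly (map_poly g q0) u' = 0"
      using alg_closed_imp_poly_has_root by blast
    obtain A'' g' where g': "hom_on A'' g'" "A' \<subseteq> A''" "\<forall>x\<in>A'. g' x = g x" "u \<in> A''"
      using hom_on_extend_root[OF g(1) q0 u'] by blast
    then have "M \<subseteq> graph_on A'' g'"
      by (auto simp: g(2) graph_on_def)
    moreover have "graph_on A'' g' \<in> F"
      using calculation M g'(1) by (auto simp: F_def)
    ultimately have "graph_on A'' g' = graph_on A' g"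
      using max g(2) by blast
    then have "fst ` graph_on A'' g' = fst ` graph_on A' g"
      by simp
    then show ?thesis
      using g'(4) by (simp add: graph_on_def image_image)
  qed
  then have "A' = UNIV"
    by blast
  then show ?thesis
    using g(1) ext by blast
qed

text \<open>Each element is a root of a polynomial whose coefficients g fixes, and the injective g
  maps the finite set of its roots into itself, hence onto itself.\<close>

lemma hom_on_UNIV_surj:
  fixes g :: "'a::idom \<Rightarrow> 'a"
  assumes g: "hom_on UNIV g" and fixed: "\<And>x. x \<in> A \<Longrightarrow> g x = x"
    and alg: "\<And>u. \<exists>q\<in>polys_in A. q \<noteq> 0 \<and> poly q u = 0"
  shows "bij g"
proof -
  have "u \<in> range g" for u
  proof -
    obtain q where q: "q \<in> polys_in A" "q \<noteq> 0" "poly q u = 0"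
      using alg[of u] by blast
    have "map_poly g q = q"
      by (rule poly_eqI) (use q fixed in \<open>auto simp: coeff_map_poly hom_onD[OF g] polys_in_def\<close>)
    moreover have "poly (map_poly g r) (g x) = g (poly r x)" for r x
      by (induction r) (auto simp: map_poly_pCons hom_onD[OF g])
    ultimately have "g ` {x. poly q x = 0} \<subseteq> {x. poly q x = 0}"
      using hom_onD(4)[OF g] by (metis (mono_tags, lifting) image_subsetI mem_Collect_eq)
    moreover have "inj_on g {x. poly q x = 0}"
      using hom_onD(2)[OF g] inj_on_subset by blast
    ultimately have "g ` {x. poly q x = 0} = {x. poly q x = 0}"
      using poly_roots_finite[OF q(2)] by (intro endo_inj_surj)
    then show ?thesis
      using q(3) by blast
  qed
  then show ?thesis
    using hom_onD(2)[OF g] by (auto simp: bij_def)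
qed

text \<open>The minimal polynomial of u has degree at least 2 because A is a field without u, and in
  characteristic 0 its root u is simple. Sending u to another root u' is a partial embedding, which
  extends to the closure.\<close>

theorem automorphism_moving:
  fixes A :: "'a::{alg_closed_field,field_char_0} set"
  assumes A: "subring_set A" "\<And>x. x \<in> A \<Longrightarrow> inverse x \<in> A"
    and alg: "\<And>u. \<exists>q\<in>polys_in A. q \<noteq> 0 \<and> poly q u = 0" and u: "u \<notin> A"
  shows "\<exists>g. hom_on UNIV g \<and> (\<forall>x\<in>A. g x = x) \<and> g u \<noteq> u"
proof -
  obtain q0 where q0: "minimal_poly_in A u q0"
    using minimal_poly_in_exists alg by blast
  have q0': "q0 \<in> polys_in A" "q0 \<noteq> 0" "poly q0 u = 0"
    and min: "\<And>r. r \<in> polys_in A \<Longrightarrow> r \<noteq> 0 \<Longrightarrow> poly r u = 0 \<Longrightarrow> Polynomial.degree q0 \<le> Polynomial.degree r"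
    using q0 by (auto simp: minimal_poly_in_def)
  have deg0: "Polynomial.degree q0 \<noteq> 0"
  proof
    assume "Polynomial.degree q0 = 0"
    then obtain c where "q0 = [:c:]"
      by (metis degree_eq_zeroE)
    then show False
      using q0' by auto
  qed
  have deg1: "Polynomial.degree q0 \<noteq> 1"
  proof
    assume "Polynomial.degree q0 = 1"
    then obtain a b where ab: "q0 = [:b, a:]" "a \<noteq> 0"
      by (metis One_nat_def coeff_pCons_0 coeff_pCons_Suc degree_eq_zeroE degree_pCons_eq_if leading_coeff_0_iff nat.inject one_neq_zero pCons_cases q0'(2))
    then have "a \<in> A" "b \<in> A"
      using coeff_polys_in[OF q0'(1), of 0] coeff_polys_in[OF q0'(1), of 1] by auto
    then have "- b * inverse a \<in> A"
      using A(2) by (intro subring_set_closed[OF A(1)])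
    moreover have "u = - b * inverse a"
      using q0'(3) ab by (simp add: field_simps add_eq_0_iff2)
    ultimately show False
      using u by simp
  qed
  have "pderiv q0 \<noteq> 0"
    using deg0 by (simp add: pderiv_eq_0_iff)
  moreover have "pderiv q0 \<in> polys_in A"
  proof -
    have "of_nat n \<in> A" for n
      by (induction n) (auto simp: subring_set_closed[OF A(1)])
    then show ?thesis
      using q0'(1) subring_set_closed(6)[OF A(1)] subring_set_closed(2,4)[OF A(1)]
      by (auto simp: polys_in_def coeff_pderiv simp del: of_nat_Suc)
  qed
  ultimately have pd: "poly (pderiv q0) u \<noteq> 0"
    using min[of "pderiv q0"] deg0 by (auto simp: degree_pderiv)
  obtain r where r: "q0 = [:- u, 1:] * r"
    using q0'(3) by (auto simp: poly_eq_0_iff_dvd dvd_def)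
  have "r \<noteq> 0"
    using r q0'(2) by auto
  then have "Polynomial.degree q0 = Suc (Polynomial.degree r)"
    unfolding r by (subst degree_mult_eq) auto
  then have "0 < Polynomial.degree r"
    using deg1 by auto
  then obtain u' where u': "poly r u' = 0"
    using alg_closed_imp_poly_has_root by blast
  have "poly (pderiv q0) u = poly r u"
    unfolding r pderiv_mult by (simp add: pderiv_pCons)
  then have "u' \<noteq> u"
    using u' pd by auto
  have id: "hom_on A (\<lambda>x. x)"
    using A by (simp add: hom_on_def inj_on_def)
  have "poly (map_poly (\<lambda>x. x) q0) u' = 0"
    by (simp add: map_poly_idI r u')
  then obtain A' h' where h': "hom_on A' h'" "A \<subseteq> A'" "\<forall>x\<in>A. h' x = x" "u \<in> A'" "h' u = u'"
    using hom_on_extend_root[OF id q0] by blast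
  have "\<exists>q\<in>polys_in A'. q \<noteq> 0 \<and> poly q x = 0" for x
    using alg[of x] h'(2) by (auto simp: polys_in_def)
  then obtain g where "hom_on UNIV g" "\<forall>x\<in>A'. g x = h' x"
    using hom_on_extend_UNIV[OF h'(1)] by blast
  then show ?thesis
    using h' \<open>u' \<noteq> u\<close> by (intro exI[of _ g]) auto
qed

section \<open>The Galois group of the field of invariants\<close>

instance polyfun :: ring_char_0
proof
  have "pf (of_nat n) v = of_nat n" for n v
    by (induction n) auto
  then show "inj (of_nat :: nat \<Rightarrow> polyfun)"
    by (metis injI of_nat_eq_iff)
qed

instance fract :: ("{idom,ring_char_0}") field_char_0
proof
  show "inj (of_nat :: nat \<Rightarrow> 'a fract)"
    by (rule injI) (simp add: of_nat_fract eq_fract)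
qed

lemma hom_on_map_poly_prod:
  assumes "hom_on UNIV h"
  shows "map_poly h (prod f I) = (\<Prod>i\<in>I. map_poly h (f i))"
proof -
  have U: "F \<in> polys_in UNIV" for F
    by (simp add: polys_in_def)
  have "map_poly h 1 = 1"
    by (simp add: hom_onD[OF assms] map_poly_1')
  then show ?thesis
    by (induction I rule: infinite_finite_induct) (simp_all add: hom_on_map_poly(3)[OF assms U U])
qed

lemma hom_on_UNIV_rules:
  assumes "hom_on UNIV g"
  shows "g (x + y) = g x + g y" "g (x - y) = g x - g y" "g (x * y) = g x * g y" "g 0 = 0" "g 1 = 1"
    "g x = 0 \<longleftrightarrow> x = 0" "g (x ^ n) = g x ^ n" "g (prod f I) = (\<Prod>i\<in>I. g (f i))"
proof -
  note D = hom_onD[OF assms]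
  show "g (x + y) = g x + g y" "g (x - y) = g x - g y" and m: "\<And>x y. g (x * y) = g x * g y"
    and "g 0 = 0" and o: "g 1 = 1"
    "g x = 0 \<longleftrightarrow> x = 0"
    by (simp_all add: D)
  show "g (x ^ n) = g x ^ n"
    by (induction n) (auto simp: m o)
  show "g (prod f I) = (\<Prod>i\<in>I. g (f i))"
    by (induction I rule: infinite_finite_induct) (auto simp: m o)
qed

lemma hom_on_UNIV_divide:
  fixes g :: "'a::field \<Rightarrow> 'b::field"
  assumes g: "hom_on UNIV g"
  shows "g (inverse x) = inverse (g x)" "g (x / y) = g x / g y"
proof -
  show inv: "g (inverse x) = inverse (g x)" for x
  proof (cases "x = 0")
    case False
    then have "g x * g (inverse x) = 1"
      by (simp flip: hom_on_UNIV_rules(3)[OF g] add: hom_on_UNIV_rules[OF g])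
    then show ?thesis
      by (metis inverse_unique)
  qed (simp add: hom_on_UNIV_rules[OF g])
  show "g (x / y) = g x / g y"
    by (simp add: divide_inverse hom_on_UNIV_rules[OF g] inv)
qed

lemma hom_on_UNIVI:
  fixes g :: "'a::field \<Rightarrow> 'b::field"
  assumes "\<And>x y. g (x + y) = g x + g y" "\<And>x y. g (x * y) = g x * g y" "g 1 = 1"
  shows "hom_on UNIV g"
proof -
  have g0: "g 0 = 0"
    using assms(1)[of 0 0] by (metis add_0 add_cancel_right_left)
  have diff: "g (x - y) = g x - g y" for x y
    using assms(1)[of "x - y" y] by (simp add: algebra_simps)
  have "inj g"
  proof (rule injI)
    fix x y assume "g x = g y"
    then have "g (x - y) = 0"
      by (simp add: diff)
    then have "g ((x - y) * inverse (x - y)) = 0"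
      by (subst assms(2)) simp
    then have "(x - y) * inverse (x - y) \<noteq> 1"
      using assms(3) by auto
    then show "x = y"
      by (cases "x - y = 0") auto
  qed
  then show ?thesis
    by (simp add: hom_on_def subring_set_def diff assms)
qed

definition field_auts :: "'a::field set \<Rightarrow> ('a \<Rightarrow> 'a) set" where
  "field_auts A = {g. bij g \<and> hom_on UNIV g \<and> (\<forall>x\<in>A. g x = x)}"

lemma field_auts_comp: "g \<in> field_auts A \<Longrightarrow> h \<in> field_auts A \<Longrightarrow> g \<circ> h \<in> field_auts A"
  by (auto simp: field_auts_def intro: bij_comp intro!: hom_on_UNIVI simp: hom_on_UNIV_rules)

lemma field_auts_inverse:
  assumes "g \<in> field_auts A"
  shows "\<exists>h\<in>field_auts A. h \<circ> g = id \<and> g \<circ> h = id"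
proof -
  have g: "bij g" "hom_on UNIV g" and fixed: "\<And>x. x \<in> A \<Longrightarrow> g x = x"
    using assms by (auto simp: field_auts_def)
  have gi: "g (inv_into UNIV g x) = x" "inv_into UNIV g (g x) = x" for x
    using g(1) by (auto simp: bij_is_surj bij_is_inj f_inv_into_f)
  have "hom_on UNIV (inv_into UNIV g)"
    by (rule hom_on_UNIVI)
      (metis gi hom_on_UNIV_rules(1)[OF g(2)], metis gi hom_on_UNIV_rules(3)[OF g(2)],
        metis gi hom_on_UNIV_rules(5)[OF g(2)])
  moreover have "inv_into UNIV g x = x" if "x \<in> A" for x
    using fixed[OF that] gi by metis
  ultimately have "inv_into UNIV g \<in> field_auts A"
    using g(1) by (simp add: field_auts_def bij_imp_bij_inv)
  then show ?thesis
    using gi by (intro bexI[of _ "inv_into UNIV g"]) (auto simp: fun_eq_iff)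
qed

type_synonym omega = "polyfun fract alg_closure"

lemma hom_on_to_ac: "hom_on UNIV (to_ac :: 'a::field \<Rightarrow> 'a alg_closure)"
  by (rule hom_on_UNIVI) auto

lemma poly_map_poly_hom: "hom_on UNIV g \<Longrightarrow> poly (map_poly g q) (g x) = g (poly q x)"
  by (induction q) (auto simp: map_poly_pCons hom_on_UNIV_rules)

definition omega_const :: "complex \<Rightarrow> omega" where
  "omega_const z = to_ac (to_fract (pconst z))"

lemma omega_const_hom:
  "omega_const 0 = 0" "omega_const 1 = 1" "omega_const (y * z) = omega_const y * omega_const z"
  "omega_const (y + z) = omega_const y + omega_const z" "omega_const z = 0 \<longleftrightarrow> z = 0"
  "omega_const y = omega_const z \<longleftrightarrow> y = z"
  by (simp_all add: omega_const_def pconst_hom flip: pconst_hom(1))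

definition omega_var :: "nat \<Rightarrow> omega" where
  "omega_var i = to_ac (to_fract (pvar i))"

locale heisenberg_field =
  fixes p :: nat
  assumes prime_p': "prime p" and odd_p': "odd p"
begin

sublocale R: heisenberg_action_ufd p "polyfun_act p"
  using prime_p' odd_p' by (rule heisenberg_action_ufd_polyfun)

sublocale L: heisenberg_action p R.fract_act
  by (rule R.heisenberg_action_fract)

abbreviation gact :: "int \<Rightarrow> int \<Rightarrow> int \<Rightarrow> polyfun fract \<Rightarrow> polyfun fract" where
  "gact \<equiv> R.fract_act"

lemma gact_to_fract: "gact a b c (to_fract f) = to_fract (polyfun_act p a b c f)"
  by (simp add: to_fract_def R.fract_act_Fract R.act_one)

lemma hom_on_gact: "hom_on UNIV (gact a b c)"
  by (rule hom_on_UNIVI) (auto simp: L.act_add L.act_mult L.act_one)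

text \<open>The invariant field F inside the closure of L, which is a closure of F as well since L
  is algebraic over F.\<close>

definition base :: "omega set" where
  "base = to_ac ` {x. \<forall>a b c. gact a b c x = x}"

lemma subring_set_base: "subring_set base"
proof -
  have "subring_set {x. \<forall>a b c. gact a b c x = x}"
    by (simp add: subring_set_def L.act_one L.act_diff L.act_mult)
  then show ?thesis
    unfolding subring_set_def base_def
    by (auto simp flip: to_ac_1 to_ac_diff to_ac_mult)
qed

lemma base_inverse: "x \<in> base \<Longrightarrow> inverse x \<in> base"
  by (auto simp: base_def hom_on_UNIV_divide[OF hom_on_gact] simp flip: to_ac_inverse)

lemma omega_const_base: "omega_const z \<in> base"
  by (auto simp: base_def omega_const_def gact_to_fract)

text \<open>A polynomial over L is multiplied by its conjugates under the group; the product has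
  invariant coefficients.\<close>

lemma algebraic_over_base: "\<exists>q\<in>polys_in base. q \<noteq> 0 \<and> poly q u = 0"
proof -
  obtain q :: "polyfun fract poly" where q: "q \<noteq> 0" "poly (map_poly to_ac q) u = 0"
    by (rule alg_closure_algebraic)
  have U: "F \<in> polys_in UNIV" for F :: "polyfun fract poly"
    by (simp add: polys_in_def)
  have hom: "hom_on UNIV f" if "f \<in> L.maps" for f
    using that hom_on_gact by (auto simp: L.maps_def)
  define Q where "Q = (\<Prod>f\<in>L.maps. map_poly f q)"
  have Q0: "Q \<noteq> 0"
    using q(1) hom by (auto simp: Q_def L.finite_maps hom_on_map_poly(5)[OF _ U U])
  have inv: "map_poly (gact a b c) Q = Q" for a b c
  proof -
    have "map_poly (gact a b c) Q = (\<Prod>f\<in>L.maps. map_poly (gact a b c \<circ> f) q)"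
      unfolding Q_def hom_on_map_poly_prod[OF hom_on_gact]
      by (intro prod.cong refl poly_eqI) (simp add: coeff_map_poly hom_on_UNIV_rules[OF hom] L.act_zero)
    also have "\<dots> = Q"
      unfolding Q_def by (rule prod.reindex_bij_betw[OF L.bij_betw_maps])
    finally show ?thesis .
  qed
  have "gact a b c (coeff Q i) = coeff Q i" for a b c i
    using arg_cong[OF inv[of a b c], of "\<lambda>r. coeff r i"] by (simp add: coeff_map_poly L.act_zero)
  then have "map_poly to_ac Q \<in> polys_in base"
    by (auto simp: polys_in_def base_def coeff_map_poly)
  moreover have "map_poly to_ac Q \<noteq> 0"
    using Q0 by (simp add: hom_on_map_poly(5)[OF hom_on_to_ac U U])
  moreover have "poly (map_poly to_ac Q) u = 0"
  proof -
    have "map_poly (gact 0 0 0) q = q"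
      by (rule poly_eqI) (simp add: coeff_map_poly L.act_period)
    then have "Q = q * (\<Prod>f\<in>L.maps - {gact 0 0 0}. map_poly f q)"
      unfolding Q_def by (subst prod.remove[OF L.finite_maps L.act_in_maps[of 0 0 0]]) simp
    then show ?thesis
      using q(2) by (simp add: hom_on_map_poly(3)[OF hom_on_to_ac U U])
  qed
  ultimately show ?thesis
    by blast
qed

lemma algebraic_over_range_to_ac: "\<exists>q\<in>polys_in (range to_ac). q \<noteq> 0 \<and> poly q (u :: omega) = 0"
proof -
  have "base \<subseteq> range to_ac"
    by (auto simp: base_def)
  then have "polys_in base \<subseteq> polys_in (range to_ac)"
    by (auto simp: polys_in_def)
  then show ?thesis
    using algebraic_over_base[of u] by blast
qed

section \<open>Automorphisms of the closure over the invariant field\<close>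

definition Aut :: "(omega \<Rightarrow> omega) set" where
  "Aut = field_auts base"

lemma Aut_hom: "g \<in> Aut \<Longrightarrow> hom_on UNIV g"
  by (simp add: Aut_def field_auts_def)

lemmas Aut_rules = hom_on_UNIV_rules[OF Aut_hom] hom_on_UNIV_divide[OF Aut_hom]

lemma Aut_base: "g \<in> Aut \<Longrightarrow> x \<in> base \<Longrightarrow> g x = x"
  by (simp add: Aut_def field_auts_def)

lemma Aut_const: "g \<in> Aut \<Longrightarrow> g (omega_const z) = omega_const z"
  by (simp add: Aut_base omega_const_base)

lemma AutI: "hom_on UNIV g \<Longrightarrow> (\<And>x. x \<in> base \<Longrightarrow> g x = x) \<Longrightarrow> g \<in> Aut"
  using hom_on_UNIV_surj[of g base] algebraic_over_base by (auto simp: Aut_def field_auts_def)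

lemma Aut_id: "id \<in> Aut"
  by (rule AutI) (auto intro: hom_on_UNIVI)

lemma Aut_comp: "g \<in> Aut \<Longrightarrow> h \<in> Aut \<Longrightarrow> g \<circ> h \<in> Aut"
  unfolding Aut_def by (rule field_auts_comp)

lemma Aut_inverse: "g \<in> Aut \<Longrightarrow> \<exists>h\<in>Aut. h \<circ> g = id \<and> g \<circ> h = id"
  unfolding Aut_def by (rule field_auts_inverse)

definition restricts_to :: "(omega \<Rightarrow> omega) \<Rightarrow> int \<Rightarrow> int \<Rightarrow> int \<Rightarrow> bool" where
  "restricts_to g a b c \<longleftrightarrow> (\<forall>x. g (to_ac x) = to_ac (gact a b c x))"

lemma restricts_to_comp:
  "restricts_to g a b c \<Longrightarrow> restricts_to h a' b' c' \<Longrightarrow>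
     restricts_to (g \<circ> h) (a + a') (b + b') (c + c' + a' * b)"
  by (simp add: restricts_to_def L.act_act)

text \<open>If g did not restrict to a group element, the embeddings of L by group elements and the
  same embeddings followed by g would all be distinct. Traces lie in \<open>base\<close> and are
  fixed by g, so the two sums of embeddings agree, against independence of characters.\<close>

lemma Aut_restricts:
  assumes g: "g \<in> Aut"
  shows "\<exists>a b c. restricts_to g a b c"
proof (rule ccontr)
  assume neg: "\<not> ?thesis"
  define E1 where "E1 = (\<lambda>f. to_ac \<circ> f) ` L.maps"
  define E2 where "E2 = (\<lambda>f. g \<circ> to_ac \<circ> f) ` L.maps"
  define w where "w e = (if e \<in> E1 then 1 else (- 1 :: omega))" for e
  have inj_g: "inj g"
    using g by (simp add: Aut_def field_auts_def bij_is_inj)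
  have inj1: "inj_on (\<lambda>f. to_ac \<circ> f) L.maps"
    by (auto simp: inj_on_def fun_eq_iff)
  have inj2: "inj_on (\<lambda>f. g \<circ> to_ac \<circ> f) L.maps"
    using inj_g by (auto simp: inj_on_def fun_eq_iff) (metis to_ac_eq_iff)
  have fin: "finite E1" "finite E2"
    by (auto simp: E1_def E2_def L.finite_maps)
  have disj: "E1 \<inter> E2 = {}"
  proof (rule ccontr)
    assume "E1 \<inter> E2 \<noteq> {}"
    then obtain a b c a' b' c' where *: "to_ac \<circ> gact a b c = g \<circ> to_ac \<circ> gact a' b' c'"
      by (auto simp: E1_def E2_def L.maps_def)
    have "g (to_ac x) = to_ac (gact (a + - a') (b + - b') (c + (a' * b' - c') + - a' * b) x)" for x
    proof -
      have "g (to_ac (gact a' b' c' (gact (- a') (- b') (a' * b' - c') x))) =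
          to_ac (gact a b c (gact (- a') (- b') (a' * b' - c') x))"
        using fun_cong[OF *] by (simp add: comp_def)
      then show ?thesis
        by (simp only: L.act_inverse) (simp add: L.act_act)
    qed
    then show False
      using neg by (auto simp: restricts_to_def)
  qed
  have tr: "(\<Sum>e\<in>E1. e x) = to_ac (\<Sum>f\<in>L.maps. f x)" "(\<Sum>e\<in>E2. e x) = g (to_ac (\<Sum>f\<in>L.maps. f x))" for x
  proof -
    show "(\<Sum>e\<in>E1. e x) = to_ac (\<Sum>f\<in>L.maps. f x)"
      unfolding E1_def by (subst sum.reindex[OF inj1]) (simp add: to_ac_sum)
    have "g (sum k I) = (\<Sum>i\<in>I. g (k i))" for k :: "(polyfun fract \<Rightarrow> polyfun fract) \<Rightarrow> omega" and I
      by (induction I rule: infinite_finite_induct) (auto simp: Aut_rules[OF g])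
    then show "(\<Sum>e\<in>E2. e x) = g (to_ac (\<Sum>f\<in>L.maps. f x))"
      unfolding E2_def by (subst sum.reindex[OF inj2]) (simp add: to_ac_sum)
  qed
  have "w (to_ac \<circ> gact 0 0 0) = 0"
  proof (rule dedekind_independence[where E = "E1 \<union> E2" and D = UNIV and w = w])
    show "finite (E1 \<union> E2)"
      using fin by simp
    show "to_ac \<circ> gact 0 0 0 \<in> E1 \<union> E2"
      by (auto simp: E1_def L.act_in_maps)
    show "(\<Sum>e\<in>E1 \<union> E2. w e * e x) = 0" for x
    proof -
      have "(\<Sum>e\<in>E1 \<union> E2. w e * e x) = (\<Sum>e\<in>E1. w e * e x) + (\<Sum>e\<in>E2. w e * e x)"
        by (rule sum.union_disjoint[OF fin disj])
      also have "(\<Sum>e\<in>E1. w e * e x) = (\<Sum>e\<in>E1. e x)"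
        by (intro sum.cong) (auto simp: w_def)
      also have "(\<Sum>e\<in>E2. w e * e x) = (\<Sum>e\<in>E2. - e x)"
        using disj by (intro sum.cong) (auto simp: w_def)
      also have "\<dots> = - (\<Sum>e\<in>E2. e x)"
        by (simp add: sum_negf)
      finally have "(\<Sum>e\<in>E1 \<union> E2. w e * e x) = (\<Sum>e\<in>E1. e x) + - (\<Sum>e\<in>E2. e x)" .
      moreover have "g (to_ac (\<Sum>f\<in>L.maps. f x)) = to_ac (\<Sum>f\<in>L.maps. f x)"
        by (rule Aut_base[OF g]) (auto simp: base_def L.act_sum_maps)
      ultimately show ?thesis
        by (simp add: tr)
    qed
    fix e assume e: "e \<in> E1 \<union> E2"
    then show "e 1 = 1"
      by (auto simp: E1_def E2_def L.maps_def L.act_one Aut_rules[OF g])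
    show "e (x * y) = e x * e y" for x y
      using e by (auto simp: E1_def E2_def L.maps_def L.act_mult Aut_rules[OF g])
    show "\<exists>x\<in>UNIV. e x \<noteq> e' x" if "e \<noteq> e'" for e'
      using that by (auto simp: fun_eq_iff)
  qed simp_all
  moreover have "to_ac \<circ> gact 0 0 0 \<in> E1"
    by (auto simp: E1_def L.act_in_maps)
  ultimately show False
    by (simp add: w_def)
qed

lemma restricts_to_exists: "\<exists>g\<in>Aut. restricts_to g a b c"
proof -
  define h where "h y = to_ac (gact a b c (of_ac y))" for y :: omega
  have h: "h (to_ac x) = to_ac (gact a b c x)" for x
    by (simp add: h_def)
  have "hom_on (range to_ac) h"
    unfolding hom_on_def
  proof (intro conjI ballI)
    show "subring_set (range to_ac :: omega set)"
      by (auto simp: subring_set_def simp flip: to_ac_diff to_ac_mult to_ac_1)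
    show "inj_on h (range to_ac)"
      using hom_onD(2)[OF hom_on_gact] by (auto simp: inj_on_def h)
    show "h 1 = 1"
      using h[of 1] by (simp add: L.act_one)
    fix x y :: omega assume "x \<in> range to_ac" "y \<in> range to_ac"
    then obtain x' y' where "x = to_ac x'" "y = to_ac y'"
      by blast
    then show "h (x - y) = h x - h y" "h (x * y) = h x * h y"
      using h[of "x' - y'"] h[of "x' * y'"] by (simp_all add: h L.act_diff L.act_mult)
  qed
  then obtain g where g: "hom_on UNIV g" "\<forall>x\<in>range to_ac. g x = h x"
    using hom_on_extend_UNIV algebraic_over_range_to_ac by blast
  have "restricts_to g a b c"
    using g(2) by (auto simp: restricts_to_def h_def)
  moreover have "g \<in> Aut"
    using g by (intro AutI) (auto simp: base_def h_def)
  ultimately show ?thesis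
    by blast
qed

text \<open>In characteristic 0 an element outside L has a different conjugate over L, and some
  automorphism over L moves it there.\<close>

lemma fixed_in_range_to_ac:
  assumes "\<And>g. g \<in> Aut \<Longrightarrow> restricts_to g 0 0 0 \<Longrightarrow> g u = u"
  shows "u \<in> range to_ac"
proof (rule ccontr)
  assume u: "u \<notin> range to_ac"
  have "\<exists>g. hom_on UNIV g \<and> (\<forall>x\<in>range to_ac. g x = x) \<and> g u \<noteq> u"
  proof (rule automorphism_moving[OF _ _ algebraic_over_range_to_ac u])
    show "subring_set (range to_ac :: omega set)"
      by (auto simp: subring_set_def simp flip: to_ac_diff to_ac_mult to_ac_1)
  qed (auto simp flip: to_ac_inverse)
  then obtain g where g: "hom_on UNIV g" "\<forall>x\<in>range to_ac. g x = x" "g u \<noteq> u"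
    by blast
  have "g \<in> Aut"
    using g by (intro AutI) (auto simp: base_def)
  moreover have "restricts_to g 0 0 0"
    using g(2) by (simp add: restricts_to_def L.act_period)
  ultimately show False
    using assms g(3) by blast
qed

lemma finite_orbit: "finite {g u |g. g \<in> Aut}"
proof -
  obtain q where q: "q \<in> polys_in base" "q \<noteq> 0" "poly q u = 0"
    using algebraic_over_base by blast
  have "poly q (g u) = 0" if g: "g \<in> Aut" for g
  proof -
    have "map_poly g q = q"
      by (rule poly_eqI) (use q(1) in \<open>auto simp: coeff_map_poly Aut_rules[OF g] Aut_base[OF g] polys_in_def\<close>)
    then show ?thesis
      using poly_map_poly_hom[OF Aut_hom[OF g], of q u] q(3) by (simp add: Aut_rules[OF g])
  qed
  then have "{g u |g. g \<in> Aut} \<subseteq> {x. poly q x = 0}"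
    by blast
  then show ?thesis
    using poly_roots_finite[OF q(2)] finite_subset by blast
qed

lemma restricts_to_omega_var:
  assumes "restricts_to g a b c" "i < p"
  shows "g (omega_var i) = omega_const (root_unity p (c + int i * b)) * omega_var (nat ((int i + a) mod int p))"
  using assms by (simp add: restricts_to_def omega_var_def omega_const_def gact_to_fract
      polyfun_act_pvar heis_subst_def)

text \<open>The image of the variable with number 0 shows a and c, that of number 1 then shows b.
  Finitely many variables thus decide the index, which gives both the uniqueness and the continuity
  of the representation.\<close>

lemma restricts_to_unique:
  assumes g: "restricts_to g a b c" "restricts_to h a' b' c'"
    and eq: "\<And>i. i < p \<Longrightarrow> g (omega_var i) = h (omega_var i)"
  shows "[a = a'] (mod int p)" "[b = b'] (mod int p)" "[c = c'] (mod int p)"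
proof -
  have p: "1 < p"
    using prime_p' prime_gt_1_nat by blast
  have *: "[c + int i * b = c' + int i * b'] (mod int p) \<and> [int i + a = int i + a'] (mod int p)"
    if i: "i < p" for i
  proof -
    define j k where "j = nat ((int i + a) mod int p)" and "k = nat ((int i + a') mod int p)"
    have "omega_const (root_unity p (c + int i * b)) * omega_var j =
        omega_const (root_unity p (c' + int i * b')) * omega_var k"
      using restricts_to_omega_var[OF g(1) i] restricts_to_omega_var[OF g(2) i] eq[OF i]
      by (simp add: j_def k_def)
    then have "pconst (root_unity p (c + int i * b)) * pvar j = pconst (root_unity p (c' + int i * b')) * pvar k"
      by (simp add: omega_const_def omega_var_def flip: to_ac_mult to_fract_mult)
    then have e: "root_unity p (c + int i * b) * v j = root_unity p (c' + int i * b') * v k" for v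
      by (simp add: polyfun_eq_iff)
    \<comment> \<open>Evaluation at the indicator of j separates the variables; evaluation at the
      constant 1 then compares the scalars.\<close>
    have jk: "j = k"
      using e[of "\<lambda>l. if l = j then 1 else 0"] by (auto split: if_splits)
    then have "root_unity p (c + int i * b) = root_unity p (c' + int i * b')"
      using e[of "\<lambda>_. 1"] by simp
    moreover have "int j = (int i + a) mod int p" "int k = (int i + a') mod int p"
      using p by (simp_all add: j_def k_def)
    then have "(int i + a) mod int p = (int i + a') mod int p"
      using jk by simp
    ultimately show ?thesis
      using p by (simp add: root_unity_eq_iff cong_def)
  qed
  show c: "[c = c'] (mod int p)" and a: "[a = a'] (mod int p)"
    using *[of 0] p by auto
  have "[c + b = c' + b'] (mod int p)"
    using *[of 1] p by simp
  then show "[b = b'] (mod int p)"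
    using c by (metis cong_add_lcancel cong_add cong_refl cong_sym cong_trans)
qed

end

text \<open>The three congruences are the multiplication of unitriangular matrices modulo p^2, and S
  expresses continuity. Modulo p the corner entry is left unconstrained, so the hypotheses are
  stable under conjugation.\<close>

theorem (in heisenberg_field) no_lift:
  fixes A B C :: "(omega \<Rightarrow> omega) \<Rightarrow> int"
  assumes A: "\<And>g h. g \<in> Aut \<Longrightarrow> h \<in> Aut \<Longrightarrow> [A (g \<circ> h) = A g + A h] (mod int (p ^ 2))"
    and B: "\<And>g h. g \<in> Aut \<Longrightarrow> h \<in> Aut \<Longrightarrow> [B (g \<circ> h) = B g + B h] (mod int (p ^ 2))"
    and C: "\<And>g h. g \<in> Aut \<Longrightarrow> h \<in> Aut \<Longrightarrow> [C (g \<circ> h) = C g + C h + A g * B h] (mod int (p ^ 2))"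
    and S: "finite S" "\<And>g. g \<in> Aut \<Longrightarrow> (\<And>s. s \<in> S \<Longrightarrow> g s = s) \<Longrightarrow>
      [A g = 0] (mod int (p ^ 2)) \<and> [B g = 0] (mod int (p ^ 2)) \<and> [C g = 0] (mod int (p ^ 2))"
    and lift: "\<And>g a b c. g \<in> Aut \<Longrightarrow> restricts_to g a b c \<Longrightarrow>
      [A g = b] (mod int p) \<and> [B g = a] (mod int p)"
  shows False
proof -
  let ?q = "int (p ^ 2)"
  have p: "0 < p" "1 < p"
    using prime_p' prime_gt_0_nat prime_gt_1_nat by blast+
  \<comment> \<open>The integers modulo p^2 are mapped into the constants, which every automorphism
    fixes; additive entries of the lift become characters with values in the field.\<close>
  define w where "w k = omega_const (root_unity (p ^ 2) k)" for k
  have w_add: "w (k + l) = w k * w l" and w_0: "w 0 = 1" and w_nz: "w k \<noteq> 0" for k l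
    by (simp_all add: w_def root_unity_add omega_const_hom)
  have w_cong: "w k = w l" if "[k = l] (mod ?q)" for k l
    using that p root_unity_eq_iff[of "p ^ 2" k l] by (simp add: w_def)
  have w_fixed: "g (w k) = w k" if "g \<in> Aut" for g k
    using that by (simp add: w_def Aut_const)
  have pq: "[k = l] (mod int p)" if "[k = l] (mod ?q)" for k l
    using that by (rule cong_dvd_modulus) (simp add: power2_eq_square)
  have orbit: "finite {g s |g. g \<in> H}" if "H \<subseteq> Aut" for H s
    using finite_orbit[of s] by (rule finite_subset[rotated]) (use that in blast)
  obtain th where th: "th \<noteq> 0" "\<And>g. g \<in> Aut \<Longrightarrow> g th = w (A g) * th"
  proof -
    have "\<exists>th. th \<noteq> 0 \<and> (\<forall>g\<in>Aut. g th = w (A g) * th)"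
    proof (rule hilbert90_finite_orbits[where S = S])
      show "w (A (g \<circ> h)) = w (A g) * w (A h)" if "g \<in> Aut" "h \<in> Aut" for g h
        using w_cong[OF A[OF that]] by (simp add: w_add)
      show "w (A g) = 1" if "g \<in> Aut" "\<And>s. s \<in> S \<Longrightarrow> g s = s" for g
        using w_cong[of "A g" 0] S(2)[OF that] by (simp add: w_0)
    qed (use S(1) orbit in \<open>auto simp: Aut_id Aut_comp Aut_inverse Aut_rules w_nz w_fixed\<close>)
    then show ?thesis
      using that by blast
  qed
  \<comment> \<open>On H the mixed term \<open>A g * B h\<close> is a product of two multiples of p,
    hence 0 modulo p^2.\<close>
  define H where "H = {g \<in> Aut. [A g = 0] (mod int p) \<and> [B g = 0] (mod int p)}"
  have HA: "g \<in> Aut" if "g \<in> H" for g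
    using that by (simp add: H_def)
  have AB_id: "[A id = 0] (mod ?q)" "[B id = 0] (mod ?q)"
    using S(2)[OF Aut_id] by auto
  have cong0: "[x * y = 0] (mod ?q)" if "[x = 0] (mod int p)" "[y = 0] (mod int p)" for x y
    using that by (auto simp: cong_0_iff power2_eq_square intro: mult_dvd_mono)
  obtain eta where eta: "eta \<noteq> 0" "\<And>g. g \<in> H \<Longrightarrow> g eta = w (C g) * eta"
  proof -
    have "\<exists>eta. eta \<noteq> 0 \<and> (\<forall>g\<in>H. g eta = w (C g) * eta)"
    proof (rule hilbert90_finite_orbits[where S = S])
      show "id \<in> H"
        using AB_id pq by (auto simp: H_def Aut_id)
      show "g \<circ> h \<in> H" if gh: "g \<in> H" "h \<in> H" for g h
      proof -
        have gh': "[A g = 0] (mod int p)" "[B g = 0] (mod int p)" "[A h = 0] (mod int p)" "[B h = 0] (mod int p)"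
          using gh by (auto simp: H_def)
        have "[A (g \<circ> h) = 0] (mod int p)"
          using cong_trans[OF pq[OF A[OF HA HA, OF gh]] cong_add[OF gh'(1,3)]] by simp
        moreover have "[B (g \<circ> h) = 0] (mod int p)"
          using cong_trans[OF pq[OF B[OF HA HA, OF gh]] cong_add[OF gh'(2,4)]] by simp
        ultimately show ?thesis
          using gh by (simp add: H_def Aut_comp)
      qed
      show "\<exists>h\<in>H. h \<circ> g = id \<and> g \<circ> h = id" if g: "g \<in> H" for g
      proof -
        obtain h where h: "h \<in> Aut" "h \<circ> g = id" "g \<circ> h = id"
          using Aut_inverse[OF HA[OF g]] by blast
        have "[A g + A h = 0] (mod int p)" "[B g + B h = 0] (mod int p)"
          using pq[OF A[OF HA[OF g] h(1)]] pq[OF B[OF HA[OF g] h(1)]] pq[OF AB_id(1)] pq[OF AB_id(2)]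
          by (auto simp: h(3) intro: cong_trans cong_sym)
        then have "[A h = 0] (mod int p)" "[B h = 0] (mod int p)"
          using g by (auto simp: H_def cong_0_iff dvd_add_right_iff)
        then show ?thesis
          using h by (auto simp: H_def)
      qed
      show "w (C (g \<circ> h)) = w (C g) * w (C h)" if gh: "g \<in> H" "h \<in> H" for g h
      proof -
        have "[A g * B h = 0] (mod ?q)"
          using gh by (intro cong0) (auto simp: H_def)
        then have "[C g + C h + A g * B h = C g + C h + 0] (mod ?q)"
          by (intro cong_add cong_refl)
        then have "[C (g \<circ> h) = C g + C h] (mod ?q)"
          using C[OF HA HA, OF gh] by (auto intro: cong_trans)
        then show ?thesis
          using w_cong by (metis w_add)
      qed
      show "w (C g) = 1" if "g \<in> H" "\<And>s. s \<in> S \<Longrightarrow> g s = s" for g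
        using w_cong[of "C g" 0] S(2)[OF HA[OF that(1)] that(2)] by (simp add: w_0)
    qed (use S(1) orbit[of H] HA in \<open>auto simp: Aut_rules w_nz w_fixed\<close>)
    then show ?thesis
      using that by blast
  qed
  obtain s where s: "s \<in> Aut" "restricts_to s 1 0 0"
    using restricts_to_exists by blast
  obtain t where t: "t \<in> Aut" "restricts_to t 0 1 0"
    using restricts_to_exists by blast
  obtain r where r: "r \<in> Aut" "restricts_to r 0 0 1"
    using restricts_to_exists by blast
  have sAB: "[A s = 0] (mod int p)" "[B s = 1] (mod int p)"
    using lift[OF s] by auto
  have tA: "[A t = 1] (mod int p)"
    using lift[OF t] by auto
  \<comment> \<open>Up to powers of \<open>th ^ (p ^ 2)\<close>, the rule g \<mapsto> w(C g) th^(B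
    g) is a cocycle on the whole group. As B s is 1 modulo p, it suggests comparing
    \<open>s eta\<close> with \<open>w (C s) * th * eta\<close>; z is the quotient.\<close>
  define z where "z = w (C s) * th * eta / s eta"
  have s_eta: "s eta \<noteq> 0"
    using eta(1) by (simp add: Aut_rules[OF s(1)])
  \<comment> \<open>With m = s^(-1) n s, comparing the corner entries of s m = n s gives C m = C n +
    A n, because \<open>A s * B m\<close> and \<open>A n * (B s - 1)\<close> vanish modulo p^2. The
    extra factor \<open>w (A n)\<close> in \<open>n (s eta)\<close> is the one by which n multiplies
    \<open>th\<close>, so z is fixed.\<close>
  have z_fixed: "n z = z" if n: "n \<in> H" for n
  proof -
    obtain s' where s': "s' \<in> Aut" "s' \<circ> s = id" "s \<circ> s' = id"
      using Aut_inverse[OF s(1)] by blast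
    define m where "m = s' \<circ> (n \<circ> s)"
    note nA = HA[OF n]
    have m: "m \<in> Aut" "s \<circ> m = n \<circ> s"
      using s' nA s(1) by (auto simp: m_def Aut_comp simp flip: comp_assoc)
    have nAB: "[A n = 0] (mod int p)" "[B n = 0] (mod int p)"
      using n by (auto simp: H_def)
    have "[A s + A m = A n + A s] (mod ?q)" "[B s + B m = B n + B s] (mod ?q)"
      using A[OF s(1) m(1)] A[OF nA s(1)] B[OF s(1) m(1)] B[OF nA s(1)] unfolding m(2)
      by (meson cong_sym cong_trans)+
    then have mn: "[A m = A n] (mod ?q)" "[B m = B n] (mod ?q)"
      by (metis add.commute cong_add_lcancel)+
    then have mAB: "[A m = 0] (mod int p)" "[B m = 0] (mod int p)"
      using nAB pq by (meson cong_trans)+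
    then have mH: "m \<in> H"
      using m by (simp add: H_def)
    have "[A s * B m = 0] (mod ?q)"
      by (rule cong0[OF sAB(1) mAB(2)])
    then have "[C s + C m + A s * B m = C s + C m + 0] (mod ?q)"
      by (intro cong_add cong_refl)
    moreover have "[A n * (B s - 1) = 0] (mod ?q)"
      using sAB(2) by (intro cong0[OF nAB(1)]) (simp add: cong_iff_dvd_diff)
    then have "[C n + C s + A n * B s = C n + C s + A n] (mod ?q)"
      by (simp add: cong_iff_dvd_diff algebra_simps)
    moreover have "[C s + C m + A s * B m = C n + C s + A n * B s] (mod ?q)"
      using C[OF s(1) m(1)] C[OF nA s(1)] unfolding m(2) by (meson cong_sym cong_trans)
    ultimately have "[C s + C m + 0 = C n + C s + A n] (mod ?q)"
      by (meson cong_sym cong_trans)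
    then have Cm: "[C m = C n + A n] (mod ?q)"
      by (simp add: cong_iff_dvd_diff algebra_simps)
    have "n (s eta) = s (m eta)"
      using fun_cong[OF m(2), of eta] by simp
    also have "\<dots> = w (C m) * s eta"
      by (simp add: eta(2)[OF mH] Aut_rules[OF s(1)] w_fixed[OF s(1)])
    also have "w (C m) = w (C n) * w (A n)"
      using w_cong[OF Cm] by (simp add: w_add)
    finally have "n (s eta) = w (C n) * w (A n) * s eta" .
    then show ?thesis
      using s_eta by (simp add: z_def Aut_rules[OF nA] w_fixed[OF nA] th(2)[OF nA] eta(2)[OF n] w_nz)
  qed
  \<comment> \<open>H contains all automorphisms over L, which puts z into L, and it contains r, an
    extension of \<zeta>.\<close>
  have "z \<in> range to_ac"
  proof (rule fixed_in_range_to_ac)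
    show "g z = z" if "g \<in> Aut" "restricts_to g 0 0 0" for g
      using lift[OF that] that(1) by (intro z_fixed) (simp add: H_def)
  qed
  then obtain z0 where z0: "z = to_ac z0"
    by blast
  have "z \<noteq> 0"
    using th(1) eta(1) s_eta w_nz by (simp add: z_def)
  then have z0_nz: "z0 \<noteq> 0"
    using z0 by auto
  have "r z = z"
    using lift[OF r] r(1) by (intro z_fixed) (simp add: H_def)
  then have rz: "gact 0 0 1 z0 = z0"
    using r(2) by (simp add: z0 restricts_to_def)
  have sn: "(s ^^ n) \<in> Aut \<and> [A (s ^^ n) = int n * A s] (mod ?q) \<and> [B (s ^^ n) = int n * B s] (mod ?q) \<and>
      (\<forall>x. (s ^^ n) (to_ac x) = to_ac (gact (int n) 0 0 x))" for n
  proof (induction n)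
    case 0
    then show ?case
      using AB_id Aut_id by (simp add: L.act_period id_def)
  next
    case (Suc n)
    have "[A s + A (s ^^ n) = A s + int n * A s] (mod ?q)" "[B s + B (s ^^ n) = B s + int n * B s] (mod ?q)"
      using Suc by (auto intro: cong_add)
    then have "[A (s ^^ Suc n) = int (Suc n) * A s] (mod ?q)" "[B (s ^^ Suc n) = int (Suc n) * B s] (mod ?q)"
      using A[OF s(1), of "s ^^ n"] B[OF s(1), of "s ^^ n"] Suc by (auto simp: algebra_simps intro: cong_trans)
    moreover have "s ^^ Suc n \<in> Aut"
      using Aut_comp[OF s(1), of "s ^^ n"] Suc by simp
    moreover have "(s ^^ Suc n) (to_ac x) = to_ac (gact (int (Suc n)) 0 0 x)" for x
      using Suc s(2) by (simp add: restricts_to_def L.act_act add.commute)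
    ultimately show ?case
      by blast
  qed
  \<comment> \<open>The product telescopes: each factor \<open>(s ^^ n) z\<close> contributes
    \<open>th\<close> up to a constant and replaces \<open>(s ^^ n) eta\<close> by the next
    power.\<close>
  have norm: "\<exists>k. (\<Prod>i<n. (s ^^ i) z) * (s ^^ n) eta = w k * th ^ n * eta" for n
  proof (induction n)
    case 0
    then show ?case by (intro exI[of _ 0]) (simp add: w_0)
  next
    case (Suc n)
    then obtain k where k: "(\<Prod>i<n. (s ^^ i) z) * (s ^^ n) eta = w k * th ^ n * eta" ..
    have sA: "s ^^ n \<in> Aut"
      using sn by blast
    have nz: "(s ^^ n) (s eta) \<noteq> 0"
      using s_eta by (simp add: Aut_rules[OF sA])
    have "(s ^^ n) z * (s ^^ n) (s eta) = w (C s) * w (A (s ^^ n)) * th * (s ^^ n) eta"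
      using nz by (simp add: z_def Aut_rules[OF sA] w_fixed[OF sA] th(2)[OF sA])
    moreover have "(s ^^ Suc n) eta = (s ^^ n) (s eta)"
      by (simp add: funpow_swap1)
    ultimately have "(\<Prod>i<Suc n. (s ^^ i) z) * (s ^^ Suc n) eta =
        w (C s) * w (A (s ^^ n)) * th * ((\<Prod>i<n. (s ^^ i) z) * (s ^^ n) eta)"
      by (simp add: mult_ac)
    then show ?case
      unfolding k by (intro exI[of _ "C s + A (s ^^ n) + k"]) (simp add: w_add mult_ac)
  qed
  \<comment> \<open>Both superdiagonal entries of the p-th power are multiples of p. So
    \<open>eta\<close> returns to a constant multiple of itself and cancels, leaving
    \<open>th ^ p\<close> up to a constant as the norm of z.\<close>
  have spH: "s ^^ p \<in> H"
  proof -
    have "[A (s ^^ p) = int p * A s] (mod int p)" "[B (s ^^ p) = int p * B s] (mod int p)"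
      using sn[of p] pq by blast+
    moreover have "[int p * x = 0] (mod int p)" for x
      by (simp add: cong_0_iff)
    ultimately show ?thesis
      using sn[of p] by (auto simp: H_def intro: cong_trans)
  qed
  obtain k where "(\<Prod>i<p. (s ^^ i) z) * (s ^^ p) eta = w k * th ^ p * eta"
    using norm by blast
  then have "(\<Prod>i<p. (s ^^ i) z) * w (C (s ^^ p)) = w k * th ^ p"
    using eta by (simp add: eta(2)[OF spH])
  moreover have Nz: "(\<Prod>i<p. (s ^^ i) z) = to_ac (L.N z0)"
    using sn by (simp add: L.N_def z0 to_ac_prod)
  ultimately have N_th: "to_ac (L.N z0) * w (C (s ^^ p)) = w k * th ^ p"
    by simp
  \<comment> \<open>A t = 1 modulo p makes p times A t equal to p modulo p^2, so the eigenvalue of t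
    on \<open>th ^ p\<close> has order exactly p.\<close>
  have zeta: "w (A t) ^ p = omega_const (root_unity p 1)"
  proof -
    have pow: "w x ^ n = w (int n * x)" for n x
      by (induction n) (auto simp: w_0 w_add ring_distribs)
    have "int p dvd A t - 1"
      using tA by (simp add: cong_iff_dvd_diff)
    then have "int p * int p dvd int p * (A t - 1)"
      by simp
    then have "[int p * A t = int p * 1] (mod ?q)"
      by (simp add: cong_iff_dvd_diff power2_eq_square algebra_simps)
    then have "w (A t) ^ p = w (int p * 1)"
      unfolding pow by (rule w_cong)
    then show ?thesis
      using root_unity_square[OF p(1), of 1] by (simp add: w_def)
  qed
  have "to_ac (gact 0 1 0 (L.N z0)) * w (C (s ^^ p)) = t (to_ac (L.N z0) * w (C (s ^^ p)))"
    using t by (simp add: Aut_rules[OF t(1)] w_fixed[OF t(1)] restricts_to_def)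
  also have "\<dots> = w k * (w (A t) ^ p * th ^ p)"
    unfolding N_th by (simp add: Aut_rules[OF t(1)] w_fixed[OF t(1)] th(2)[OF t(1)] power_mult_distrib)
  also have "\<dots> = omega_const (root_unity p 1) * (to_ac (L.N z0) * w (C (s ^^ p)))"
    unfolding N_th zeta by (simp add: mult_ac)
  finally have "to_ac (gact 0 1 0 (L.N z0)) = omega_const (root_unity p 1) * to_ac (L.N z0)"
    using w_nz by simp
  then have "gact 0 1 0 (L.N z0) = to_fract (pconst (root_unity p 1)) * L.N z0"
    by (simp add: omega_const_def flip: to_ac_mult)
  moreover have "pconst (root_unity p 1) dvd 1"
    by (rule dvdI[of _ _ "pconst (inverse (root_unity p 1))"]) (simp add: polyfun_eq_iff)
  ultimately have "pconst (root_unity p 1) = 1"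
    using R.fract_norm_eigenvalue_one[OF z0_nz rz] by blast
  then have "root_unity p 1 = 1"
    by (metis pconst_eq_iff pconst_hom(2))
  then show False
    using p by (simp add: root_unity_eq_1_iff)
qed

section \<open>A copy of the algebraic closure on sets of complex numbers\<close>

definition embeds :: "'a itself \<Rightarrow> bool" where
  "embeds _ \<longleftrightarrow> (\<exists>j :: 'a \<Rightarrow> complex set. inj j)"

lemma embedsI: "inj (f :: 'a \<Rightarrow> 'b) \<Longrightarrow> embeds TYPE('b) \<Longrightarrow> embeds TYPE('a)"
  unfolding embeds_def using inj_compose by blast

text \<open>A sequence of sets of complex numbers is coded as one set of pairs (n, z) with z in the
  n-th set, and pairs of complex numbers are coded by complex numbers.\<close>

lemma embeds_sequences:
  assumes "embeds TYPE('a)"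
  shows "embeds TYPE(nat \<Rightarrow> 'a)"
proof -
  obtain j :: "'a \<Rightarrow> complex set" where j: "inj j"
    using assms by (auto simp: embeds_def)
  have "infinite (UNIV :: complex set)"
    by (rule infinite_UNIV_char_0)
  then have "|UNIV \<times> UNIV :: (complex \<times> complex) set| =o |UNIV :: complex set|"
    using card_of_Times_same_infinite by blast
  then obtain enc where "bij_betw enc (UNIV \<times> UNIV :: (complex \<times> complex) set) (UNIV :: complex set)"
    by (rule card_of_ordIso[THEN iffD2, THEN exE])
  then have enc: "inj enc"
    using bij_betw_imp_inj_on by fastforce
  have enc_eq: "enc x = enc y \<longleftrightarrow> x = y" for x y
    using enc by (rule inj_eq)
  define J where "J F = {enc (of_nat n, z) |n z. z \<in> j (F n)}" for F :: "nat \<Rightarrow> 'a"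
  have mem: "enc (of_nat n, z) \<in> J F \<longleftrightarrow> z \<in> j (F n)" for n z F
    by (auto simp: J_def enc_eq)
  have "inj J"
  proof (rule injI, rule ext)
    fix F G n assume "J F = J G"
    then have "j (F n) = j (G n)"
      unfolding set_eq_iff mem[symmetric] by simp
    then show "F n = G n"
      by (rule injD[OF j])
  qed
  then show ?thesis
    by (auto simp: embeds_def)
qed

lemma embeds_complex: "embeds TYPE(complex)"
  unfolding embeds_def by (intro exI[of _ "\<lambda>z. {z}"]) (auto simp: inj_def)

text \<open>Coordinates from k on are kept natural while the first k become arbitrary, one at a
  time: in a single coordinate f is a polynomial with all naturals as roots. The test points are
  countable, so a polynomial function is coded by a sequence of complex numbers.\<close>

lemma polyfun_zero_if_zero_at_naturals:
  assumes "\<And>l :: nat list. pf f (\<lambda>i. of_nat (nth_default 0 l i)) = 0"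
  shows "f = 0"
proof -
  obtain m where m: "f \<in> vars_below m"
    using ex_vars_below by blast
  have "pf f v = 0" if "\<forall>i\<ge>k. v i \<in> \<nat>" for k v
    using that
  proof (induction k arbitrary: v)
    case 0
    define l where "l = map (\<lambda>i. SOME n. v i = of_nat n) [0..<m]"
    have "v i = of_nat (nth_default 0 l i)" if "i < m" for i
    proof -
      have "\<exists>n. v i = of_nat n"
        using 0 by (auto elim: Nats_cases)
      then have "v i = of_nat (SOME n. v i = of_nat n)"
        by (rule someI_ex)
      then show ?thesis
        using that by (simp add: l_def nth_default_def)
    qed
    then have "pf f v = pf f (\<lambda>i. of_nat (nth_default 0 l i))"
      using m by (auto simp: vars_below_def)
    then show ?case
      using assms by simp
  next
    case (Suc k)
    define b :: "nat \<Rightarrow> complex" where "b = (\<lambda>i. if i = k then 1 else 0)"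
    have upd: "(\<lambda>i. (v(k := 0)) i + t * b i) = v(k := t)" for t
      by (auto simp: b_def)
    obtain P where P: "\<And>t. pf f (v(k := t)) = poly P t"
      using pf_on_line[of f "v(k := 0)" b] unfolding upd by blast
    have "poly P (of_nat n) = 0" for n
    proof -
      have "v i \<in> \<nat>" if "k \<le> i" "i \<noteq> k" for i
        using Suc.prems that by (metis Suc_leI le_neq_implies_less)
      then show ?thesis
        unfolding P[symmetric] by (intro Suc.IH) auto
    qed
    then have "range of_nat \<subseteq> {t. poly P t = 0}"
      by auto
    moreover have "infinite (range (of_nat :: nat \<Rightarrow> complex))"
      by (rule range_inj_infinite) (simp add: inj_def)
    ultimately have "infinite {t. poly P t = 0}"
      by (rule infinite_super)
    then have "P = 0"
      using poly_roots_finite[of P] by metis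
    then show ?case
      using P[of "v k"] by simp
  qed
  note * = this
  have "pf f v = 0" for v
  proof -
    have "pf f v = pf f (\<lambda>i. if i < m then v i else 0)"
      using m by (auto simp: vars_below_def)
    also have "\<dots> = 0"
      by (rule *[of m]) auto
    finally show ?thesis .
  qed
  then show ?thesis
    by (simp add: polyfun_eq_iff)
qed

lemma embeds_polyfun: "embeds TYPE(polyfun)"
proof (rule embedsI[OF _ embeds_sequences[OF embeds_complex]])
  show "inj (\<lambda>f n. pf f (\<lambda>i. of_nat (nth_default 0 (from_nat n :: nat list) i)))"
  proof (rule injI)
    fix f g :: polyfun
    assume eq: "(\<lambda>n. pf f (\<lambda>i. of_nat (nth_default 0 (from_nat n :: nat list) i))) =
      (\<lambda>n. pf g (\<lambda>i. of_nat (nth_default 0 (from_nat n :: nat list) i)))"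
    have "f - g = 0"
    proof (rule polyfun_zero_if_zero_at_naturals)
      show "pf (f - g) (\<lambda>i. of_nat (nth_default 0 l i)) = 0" for l
        using fun_cong[OF eq, of "to_nat l"] by simp
    qed
    then show "f = g" by simp
  qed
qed

lemma embeds_fract:
  assumes "embeds TYPE('a::idom)"
  shows "embeds TYPE('a fract)"
proof -
  have "\<exists>ab. x = Fract (fst ab) (snd ab)" for x :: "'a fract"
    by (metis Fract_cases fst_conv snd_conv)
  then obtain rep where rep: "\<And>x :: 'a fract. x = Fract (fst (rep x)) (snd (rep x))"
    by metis
  have "inj (\<lambda>x n. if n = (0::nat) then fst (rep x) else snd (rep x))"
  proof (rule injI)
    fix x y assume eq: "(\<lambda>n. if n = (0::nat) then fst (rep x) else snd (rep x)) =
      (\<lambda>n. if n = (0::nat) then fst (rep y) else snd (rep y))"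
    have "fst (rep x) = fst (rep y)" "snd (rep x) = snd (rep y)"
      using fun_cong[OF eq, of 0] fun_cong[OF eq, of 1] by simp_all
    then show "x = y"
      using rep[of x] rep[of y] by simp
  qed
  then show ?thesis
    using embeds_sequences[OF assms] by (rule embedsI)
qed

text \<open>An element is coded by a polynomial annihilating it and by its number among the finitely
  many roots. Slot 0 of the sequence holds the number, the later slots hold the
  coefficients.\<close>

lemma embeds_alg_closure:
  assumes "embeds TYPE('a::field_char_0)"
  shows "embeds TYPE('a alg_closure)"
proof -
  have "\<exists>q. q \<noteq> 0 \<and> poly (map_poly to_ac q) x = 0" for x :: "'a alg_closure"
    by (metis alg_closure_algebraic)
  then obtain q where q: "\<And>x :: 'a alg_closure. q x \<noteq> 0 \<and> poly (map_poly to_ac (q x)) x = 0"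
    by metis
  define rts where "rts r = {x :: 'a alg_closure. poly (map_poly to_ac r) x = 0}" for r
  have fin: "finite (rts (q x))" for x
  proof -
    have "map_poly to_ac (q x) \<noteq> 0"
      using q[of x] hom_on_map_poly(5)[OF hom_on_to_ac, of "q x" "q x"] by (simp add: polys_in_def)
    then show ?thesis
      unfolding rts_def by (rule poly_roots_finite)
  qed
  define J where "J x n = (if n = 0 then of_nat (to_nat_on (rts (q x)) x) else coeff (q x) (n - 1))"
    for x :: "'a alg_closure" and n :: nat
  have "inj J"
  proof (rule injI)
    fix x y assume eq: "J x = J y"
    have "coeff (q x) n = coeff (q y) n" for n
      using fun_cong[OF eq, of "Suc n"] by (simp add: J_def)
    then have qq: "q x = q y"
      by (simp add: poly_eq_iff)
    have "to_nat_on (rts (q x)) x = to_nat_on (rts (q x)) y"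
      using fun_cong[OF eq, of 0] by (simp add: J_def qq)
    moreover have "x \<in> rts (q x)" "y \<in> rts (q x)"
      using q[of x] q[of y] qq by (simp_all add: rts_def)
    ultimately show "x = y"
      using fin[of x] by (simp add: countable_finite)
  qed
  then show ?thesis
    using embeds_sequences[OF assms] by (rule embedsI)
qed

lemma embeds_omega: "\<exists>j :: omega \<Rightarrow> complex set. inj j"
  using embeds_alg_closure[OF embeds_fract[OF embeds_polyfun]] by (simp add: embeds_def)

section \<open>Transport of the field structure to an explicit carrier\<close>

definition transported_ring :: "('a::field \<Rightarrow> 'b) \<Rightarrow> 'b ring" where
  "transported_ring j = \<lparr>carrier = range j,
     monoid.mult = \<lambda>x y. j (inv_into UNIV j x * inv_into UNIV j y), one = j 1,
     ring.zero = j 0, add = \<lambda>x y. j (inv_into UNIV j x + inv_into UNIV j y)\<rparr>"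

locale transported =
  fixes j :: "'a::{alg_closed_field,field_char_0} \<Rightarrow> 'b"
  assumes inj_j: "inj j"
begin

abbreviation T :: "'b ring" where "T \<equiv> transported_ring j"
abbreviation j' :: "'b \<Rightarrow> 'a" where "j' \<equiv> inv_into UNIV j"

lemma j'_j [simp]: "j' (j x) = x"
  using inj_j by simp

lemma j_j' [simp]: "y \<in> range j \<Longrightarrow> j (j' y) = y"
  by auto

lemma j_eq_iff [simp]: "j x = j y \<longleftrightarrow> x = y"
  using inj_j by (auto dest: injD)

lemma T_simps [simp]:
  "carrier T = range j" "\<zero>\<^bsub>T\<^esub> = j 0" "\<one>\<^bsub>T\<^esub> = j 1"
  "j x \<otimes>\<^bsub>T\<^esub> j y = j (x * y)" "j x \<oplus>\<^bsub>T\<^esub> j y = j (x + y)"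
  by (simp_all add: transported_ring_def)

lemma field_T: "field T"
proof -
  have "j \<in> ring_iso (ring_of_type_algebra :: 'a ring) T"
    unfolding ring_iso_def using inj_j
    by (auto intro!: ring_hom_memI simp: ring_of_type_algebra_def bij_betw_def)
  from field.ring_iso_imp_img_field[OF field_from_type_algebra this]
  show ?thesis
    by (simp add: ring_of_type_algebra_def transported_ring_def)
qed

sublocale T: field T
  by (rule field_T)

lemma T_inv: "x \<noteq> 0 \<Longrightarrow> inv\<^bsub>T\<^esub> (j x) = j (inverse x)"
  by (rule T.comm_inv_char) auto

lemma T_minus: "\<ominus>\<^bsub>T\<^esub> (j x) = j (- x)"
  by (rule T.minus_equality) auto

lemma subfield_T:
  assumes A: "subring_set A" "\<And>x. x \<in> A \<Longrightarrow> inverse x \<in> A"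
  shows "subfield (j ` A) T"
proof (rule T.subfieldI')
  show "subring (j ` A) T"
    by (rule T.subringI) (auto simp: T_minus subring_set_closed[OF A(1)] intro!: imageI)
  show "inv\<^bsub>T\<^esub> k \<in> j ` A" if "k \<in> j ` A - {\<zero>\<^bsub>T\<^esub>}" for k
    using that A(2) by (auto simp: T_inv)
qed

text \<open>\<open>pl\<close> and \<open>lp\<close> translate between coefficient lists over the
  carrier, leading coefficient first, and polynomials over the type, whose coefficient lists start
  with the constant term.\<close>

definition pl :: "'b list \<Rightarrow> 'a poly" where
  "pl P = Poly (rev (map j' P))"

definition lp :: "'a poly \<Rightarrow> 'b list" where
  "lp q = map j (rev (coeffs q))"

lemma T_pow: "j x [^]\<^bsub>T\<^esub> (n::nat) = j (x ^ n)"
  by (induction n) (simp_all add: mult.commute)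

lemma eval_T: "set P \<subseteq> range j \<Longrightarrow> T.eval P (j u) = j (poly (pl P) u)"
  by (induction P) (auto simp: pl_def T_pow Poly_append poly_monom algebra_simps)

lemma pl_lp: "pl (lp q) = q"
  by (simp add: pl_def lp_def rev_map comp_def)

lemma set_lp: "set (lp q) \<subseteq> range j"
  by (auto simp: lp_def)

lemma lp_carrier:
  assumes "q \<in> polys_in A"
  shows "lp q \<in> carrier ((j ` A)[X]\<^bsub>T\<^esub>)"
proof (cases "q = 0")
  case True
  then show ?thesis
    by (simp add: lp_def univ_poly_def polynomial_def)
next
  case False
  have "hd (lp q) = j (last (coeffs q))"
    using False by (simp add: lp_def hd_map hd_rev)
  moreover have "set (coeffs q) \<subseteq> A"
    using assms by (auto simp: polys_in_def coeffs_def)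
  ultimately show ?thesis
    using False by (auto simp: univ_poly_def polynomial_def last_coeffs_eq_coeff_degree lp_def)
qed

lemma lp_eq_Nil: "lp q = [] \<longleftrightarrow> q = 0"
  by (simp add: lp_def)

lemma algebraic_T:
  assumes "q \<in> polys_in A" "q \<noteq> 0" "poly q u = 0"
  shows "(T.algebraic over (j ` A)) (j u)"
  using T.algebraicI[OF lp_carrier[OF assms(1)], of "j u"] assms
  by (simp add: lp_eq_Nil eval_T[OF set_lp] pl_lp)

lemma degree_pl:
  assumes "polynomial\<^bsub>T\<^esub> (range j) P"
  shows "Polynomial.degree (pl P) = length P - 1"
proof (cases "P = []")
  case False
  then have "set P \<subseteq> range j" "hd P \<noteq> j 0"
    using assms by (auto simp: polynomial_def)
  then have "j' (hd P) \<noteq> 0"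
    using False by (metis j_j' list.set_sel(1) subsetD)
  then have "last (rev (map j' P)) \<noteq> 0"
    using False by (simp add: last_rev hd_map)
  then have "coeffs (pl P) = rev (map j' P)"
    unfolding pl_def coeffs_Poly strip_while_idem_iff no_trailing_unfold by metis
  then show ?thesis
    by (simp add: degree_eq_length_coeffs)
qed (simp add: pl_def)

lemma algebraically_closed_T: "algebraically_closed T"
proof (rule T.algebraically_closedI)
  fix P assume P: "P \<in> carrier (poly_ring T)" "1 < Polynomials.degree P"
  have pol: "polynomial\<^bsub>T\<^esub> (range j) P"
    using P by (simp add: univ_poly_def)
  then have "0 < Polynomial.degree (pl P)"
    using P(2) by (simp add: degree_pl)
  then obtain u where "poly (pl P) u = 0"
    using alg_closed_imp_poly_has_root by blast
  moreover have "set P \<subseteq> range j"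
    using pol by (auto simp: polynomial_def)
  ultimately show "\<exists>x\<in>carrier T. T.eval P x = \<zero>\<^bsub>T\<^esub>"
    by (intro bexI[of _ "j u"]) (auto simp: eval_T)
qed

lemma T_add_pow: "[n] \<cdot>\<^bsub>T\<^esub> j x = j (of_nat n * x)" for n :: nat
  by (induction n) (simp_all add: algebra_simps)

text \<open>A divisor d of the irreducible f is a unit or an associate of f, and an associate has
  too large a degree to divide the derivative, which is nonzero in characteristic 0.\<close>

lemma irreducible_separable:
  assumes K: "subfield K T" and f: "f \<in> carrier (K[X]\<^bsub>T\<^esub>)" "pirreducible\<^bsub>T\<^esub> K f"
  shows "separable_poly T K f"
  unfolding separable_poly_def
proof (intro conjI ballI impI f(1))
  have KT: "subring K T"
    using K by (rule subfieldE(1))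
  interpret UP: domain "K[X]\<^bsub>T\<^esub>"
    by (rule T.univ_poly_is_domain[OF KT])
  have KX: "x \<in> carrier (K[X]\<^bsub>T\<^esub>) \<longleftrightarrow> polynomial\<^bsub>T\<^esub> K x" for x
    by (simp add: univ_poly_def)
  have deg_mult: "Polynomials.degree (a \<otimes>\<^bsub>K[X]\<^bsub>T\<^esub>\<^esub> b) = Polynomials.degree a + Polynomials.degree b"
    if "a \<in> carrier (K[X]\<^bsub>T\<^esub>)" "b \<in> carrier (K[X]\<^bsub>T\<^esub>)" "a \<otimes>\<^bsub>K[X]\<^bsub>T\<^esub>\<^esub> b \<noteq> []" for a b
    using T.poly_mult_degree_eq[OF KT, of a b] that UP.l_null[of b] UP.r_null[of a]
    by (auto simp: KX univ_poly_mult univ_poly_zero split: if_splits)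
  have f0: "f \<noteq> []" "2 \<le> length f"
  proof -
    have "Polynomials.degree f \<ge> 1"
      by (rule T.pirreducible_degree[OF K f])
    then show "2 \<le> length f" by simp
    then show "f \<noteq> []" by auto
  qed
  have fT: "set f \<subseteq> range j" "hd f \<noteq> j 0"
    using f(1) f0(1) subringE(1)[OF KT] by (auto simp: KX polynomial_def)
  \<comment> \<open>The leading coefficient of the derivative is a positive integer times that of f,
    hence nonzero, so the normalization removes nothing.\<close>
  have D: "length (formal_deriv T f) = length f - 1"
  proof -
    have "T.coeff f (length f - 1) = hd f"
      using T.lead_coeff_simp[OF f0(1)] by simp
    moreover have "hd f \<in> range j"
      using fT(1) f0(1) list.set_sel(1) by blast
    then obtain x where x: "hd f = j x"
      by blast
    moreover obtain n where n: "length f = 2 + n"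
      using le_Suc_ex[OF f0(2)] ..
    then have "rev [1..<length f] = (length f - 1) # rev [1..<length f - 1]"
      by simp
    moreover have "of_nat (length f - 1) * x \<noteq> 0"
      using fT(2) f0(2) x by (auto simp: of_nat_diff)
    ultimately show ?thesis
      using f0(2) unfolding formal_deriv_def by (simp add: T_add_pow del: of_nat_diff)
  qed
  fix d assume d: "d \<in> carrier (K[X]\<^bsub>T\<^esub>)" "d divides\<^bsub>K[X]\<^bsub>T\<^esub>\<^esub> f"
    "d divides\<^bsub>K[X]\<^bsub>T\<^esub>\<^esub> formal_deriv T f"
  obtain e where e: "e \<in> carrier (K[X]\<^bsub>T\<^esub>)" "f = d \<otimes>\<^bsub>K[X]\<^bsub>T\<^esub>\<^esub> e"
    using d(2) by (auto simp: factor_def)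
  obtain g where g: "g \<in> carrier (K[X]\<^bsub>T\<^esub>)" "formal_deriv T f = d \<otimes>\<^bsub>K[X]\<^bsub>T\<^esub>\<^esub> g"
    using d(3) by (auto simp: factor_def)
  show "d \<in> Units (K[X]\<^bsub>T\<^esub>)"
  proof (rule ccontr)
    assume nd: "d \<notin> Units (K[X]\<^bsub>T\<^esub>)"
    have "e \<in> Units (K[X]\<^bsub>T\<^esub>)"
      using UP.ring_irreducibleE(5)[OF f d(1) e(1) e(2)] nd by blast
    then obtain k where "e = [k]"
      unfolding T.univ_poly_units[OF K] by blast
    then have "Polynomials.degree e = 0"
      by simp
    then have "Polynomials.degree d = Polynomials.degree f"
      using deg_mult[OF d(1) e(1)] e(2) f0(1) by simp
    moreover have "formal_deriv T f \<noteq> []"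
      using D f0(2) by auto
    then have "Polynomials.degree d \<le> Polynomials.degree (formal_deriv T f)"
      using deg_mult[OF d(1) g(1)] g(2) by simp
    ultimately show False
      using D f0(2) by simp
  qed
qed

text \<open>Minimal polynomials are separable by irreducibility in characteristic 0, and over an
  algebraically closed field every polynomial splits.\<close>

lemma separable_closure_T:
  assumes A: "subring_set A" "\<And>x. x \<in> A \<Longrightarrow> inverse x \<in> A"
    and alg: "\<And>u. \<exists>q\<in>polys_in A. q \<noteq> 0 \<and> poly q u = 0"
  shows "separable_closure T (j ` A)"
proof -
  interpret K: subfield "j ` A" T
    by (rule subfield_T[OF A])
  have algT: "(T.algebraic over (j ` A)) x" if "x \<in> carrier T" for x
    using that alg algebraic_T by auto
  show ?thesis
  proof
    show "(T.algebraic over (j ` A)) x" if "x \<in> carrier T" for x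
      using algT[OF that] .
    show "separable_poly T (j ` A) (T.Irr (j ` A) x)" if "x \<in> carrier T" for x
      using irreducible_separable[OF subfield_T[OF A]] T.IrrE[OF subfield_T[OF A] that algT[OF that]]
      by blast
    show "T.splitted f" if "separable_poly T (carrier T) f" for f
      using that algebraically_closed.roots_over_carrier[OF algebraically_closed_T]
      by (auto simp: separable_poly_def)
  qed
qed

end

section \<open>Galois groups and the Krull topology\<close>

context transported
begin

text \<open>Restricted to the carrier because the elements of \<open>Bij\<close> are extensional
  functions.\<close>

definition lift_aut :: "('a \<Rightarrow> 'a) \<Rightarrow> 'b \<Rightarrow> 'b" where
  "lift_aut g = restrict (\<lambda>y. j (g (j' y))) (range j)"

lemma lift_aut_j [simp]: "lift_aut g (j x) = j (g x)"
  by (simp add: lift_aut_def)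

lemma lift_aut_Bij: "bij g \<Longrightarrow> lift_aut g \<in> Bij (range j)"
proof -
  assume g: "bij g"
  have "inj_on (lift_aut g) (range j)"
    using g by (auto simp: inj_on_def bij_def)
  moreover have "lift_aut g ` range j = range j"
    using g by (auto simp: image_image bij_def) (metis j_eq_iff rangeI surjD)
  ultimately show ?thesis
    by (simp add: Bij_def bij_betw_def lift_aut_def)
qed

lemma lift_aut_mult:
  assumes "bij g" "bij h"
  shows "lift_aut g \<otimes>\<^bsub>galois_group T K\<^esub> lift_aut h = lift_aut (g \<circ> h)"
  using lift_aut_Bij[OF assms(1)] lift_aut_Bij[OF assms(2)]
  by (auto simp: galois_group_def BijGroup_def compose_def lift_aut_def fun_eq_iff)

lemma carrier_galois_group: "carrier (galois_group T (j ` A)) = lift_aut ` field_auts A"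
proof
  show "lift_aut ` field_auts A \<subseteq> carrier (galois_group T (j ` A))"
    using lift_aut_Bij
    by (auto simp: galois_group_def BijGroup_def field_auts_def hom_on_UNIV_rules intro!: ring_hom_memI)
next
  show "carrier (galois_group T (j ` A)) \<subseteq> lift_aut ` field_auts A"
  proof
    fix s assume "s \<in> carrier (galois_group T (j ` A))"
    then have s: "s \<in> Bij (range j)" "s \<in> Ring.ring_hom T T" "\<And>x. x \<in> A \<Longrightarrow> s (j x) = j x"
      by (auto simp: galois_group_def BijGroup_def)
    define g where "g x = j' (s (j x))" for x
    have bb: "bij_betw s (range j) (range j)"
      using s(1) by (simp add: Bij_def)
    then have jg: "j (g x) = s (j x)" for x
      unfolding g_def by (intro j_j') (auto simp: bij_betw_def)
    have "s = lift_aut g"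
    proof
      fix y
      show "s y = lift_aut g y"
      proof (cases "y \<in> range j")
        case True
        then show ?thesis
          using jg by auto
      next
        case False
        then show ?thesis
          using s(1) by (simp add: Bij_def lift_aut_def extensional_def)
      qed
    qed
    moreover have "hom_on UNIV g"
    proof (rule hom_on_UNIVI)
      show "g (x + y) = g x + g y" for x y
        using ring_hom_add[OF s(2), of "j x" "j y"] by (simp flip: jg)
      show "g (x * y) = g x * g y" for x y
        using ring_hom_mult[OF s(2), of "j x" "j y"] by (simp flip: jg)
      show "g 1 = 1"
        using ring_hom_one[OF s(2)] by (simp flip: jg)
    qed
    moreover have "bij g"
    proof -
      have "bij_betw (j' \<circ> s \<circ> j) UNIV UNIV"
        using bb inj_j by (intro bij_betw_trans[of j UNIV "range j"] bij_betw_trans[of s "range j" "range j"])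
          (auto simp: bij_betw_def inj_on_inv_into)
      moreover have "g = j' \<circ> s \<circ> j"
        by (auto simp: g_def)
      ultimately show ?thesis
        by simp
    qed
    moreover have "g x = x" if "x \<in> A" for x
      using s(3)[OF that] by (simp add: g_def)
    ultimately show "s \<in> lift_aut ` field_auts A"
      by (auto simp: field_auts_def)
  qed
qed

text \<open>S is a spanning set of E over the base; g and h are linear over the base, so agreement
  on S spreads to the span.\<close>

lemma finite_subextension_agree:
  assumes A: "subring_set A" "\<And>x. x \<in> A \<Longrightarrow> inverse x \<in> A"
    and E: "finite_subextension T (j ` A) E"
  shows "\<exists>S. finite S \<and> (\<forall>g\<in>field_auts A. \<forall>h\<in>field_auts A.
    (\<forall>s\<in>S. g s = h s) \<longrightarrow> (\<forall>x. j x \<in> E \<longrightarrow> g x = h x))"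
proof -
  have K: "subfield (j ` A) T"
    by (rule subfield_T[OF A])
  have fd: "T.finite_dimension (j ` A) E"
    using E by (simp add: finite_subextension_def)
  then obtain Us where Us: "set Us \<subseteq> carrier T" "T.Span (j ` A) Us = E"
    using T.exists_base[OF K T.finite_dimensionE[OF K fd]] by blast
  have "g x = h x" if g: "g \<in> field_auts A" and h: "h \<in> field_auts A"
    and eq: "\<forall>s\<in>j' ` set Us. g s = h s" and x: "j x \<in> T.Span (j ` A) Us" for g h x
    using Us(1) eq x
  proof (induction Us arbitrary: x)
    case Nil
    then show ?case
      using g h by (simp add: field_auts_def hom_on_UNIV_rules)
  next
    case (Cons u Us)
    have "j x \<in> T.line_extension (j ` A) u (T.Span (j ` A) Us)"
      using Cons.prems(3) by simp
    then obtain k v where kv: "k \<in> j ` A" "v \<in> T.Span (j ` A) Us" "j x = k \<otimes>\<^bsub>T\<^esub> u \<oplus>\<^bsub>T\<^esub> v"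
      unfolding T.line_extension_mem_iff by blast
    have "v \<in> carrier T"
      using kv(2) T.Span_in_carrier[of "j ` A" Us] Cons.prems(1) by auto
    then obtain k' u' v' where k': "k = j k'" "k' \<in> A" "u = j u'" "v = j v'"
      using kv(1) Cons.prems(1) by auto
    have "x = k' * u' + v'"
      using kv(3) by (simp add: k')
    moreover have "g u' = h u'" "g v' = h v'"
      using Cons.prems Cons.IH[of v'] kv(2) by (auto simp: k')
    ultimately show ?case
      using g h k'(2) by (simp add: field_auts_def hom_on_UNIV_rules)
  qed
  then show ?thesis
    unfolding Us(2) by (intro exI[of _ "j' ` set Us"]) auto
qed

text \<open>Induction over the formation of open sets from cosets. If g lies in the coset of g0 by
  the group fixing E, it coincides with g0 on E; any h that agrees with g on a spanning set of E
  does so too and lies in the same coset.\<close>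

lemma krull_open_contains_nbhd:
  assumes A: "subring_set A" "\<And>x. x \<in> A \<Longrightarrow> inverse x \<in> A"
    and U: "openin (krull_topology T (j ` A)) U" and g: "g \<in> field_auts A" "lift_aut g \<in> U"
  shows "\<exists>S. finite S \<and> (\<forall>h\<in>field_auts A. (\<forall>s\<in>S. h s = g s) \<longrightarrow> lift_aut h \<in> U)"
proof -
  have bij: "bij g" if "g \<in> field_auts B" for g :: "'a \<Rightarrow> 'a" and B
    using that by (simp add: field_auts_def)
  show ?thesis
    using U[unfolded krull_topology_def openin_topology_generated_by_iff] g
  proof (induction arbitrary: g rule: generate_topology_on.induct)
    case Empty
    then show ?case by simp
  next
    case (Int U V)
    obtain S1 where "finite S1" "\<forall>h\<in>field_auts A. (\<forall>s\<in>S1. h s = g s) \<longrightarrow> lift_aut h \<in> U"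
      using Int.IH(1)[OF Int.prems(1)] Int.prems(2) by auto
    moreover obtain S2 where "finite S2" "\<forall>h\<in>field_auts A. (\<forall>s\<in>S2. h s = g s) \<longrightarrow> lift_aut h \<in> V"
      using Int.IH(2)[OF Int.prems(1)] Int.prems(2) by auto
    ultimately show ?case
      by (intro exI[of _ "S1 \<union> S2"]) auto
  next
    case (UN K)
    then obtain k where k: "k \<in> K" "lift_aut g \<in> k"
      by blast
    then obtain S where "finite S" "\<forall>h\<in>field_auts A. (\<forall>s\<in>S. h s = g s) \<longrightarrow> lift_aut h \<in> k"
      using UN.IH[OF k(1) UN.prems(1) k(2)] by blast
    then show ?case
      using k(1) by blast
  next
    case (Basis s)
    then obtain g0 E where g0: "g0 \<in> field_auts A" and E: "finite_subextension T (j ` A) E"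
      and s: "s = lift_aut g0 <#\<^bsub>galois_group T (j ` A)\<^esub> carrier (galois_group T E)"
      by (auto simp: carrier_galois_group)
    have "E \<subseteq> range j"
      using E subfieldE(3)[of E T] by (auto simp: finite_subextension_def)
    then have jE: "j ` (j' ` E) = E"
      by (rule image_inv_into_cancel[OF refl])
    have cE: "carrier (galois_group T E) = lift_aut ` field_auts (j' ` E)"
      using carrier_galois_group[of "j' ` E"] by (simp only: jE)
    obtain c where c: "c \<in> field_auts (j' ` E)" "lift_aut g = lift_aut g0 \<otimes>\<^bsub>galois_group T (j ` A)\<^esub> lift_aut c"
      using Basis.prems(2) by (auto simp: s l_coset_def cE)
    have "lift_aut g = lift_aut (g0 \<circ> c)"
      unfolding c(2) by (rule lift_aut_mult[OF bij[OF g0] bij[OF c(1)]])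
    then have gc: "g x = g0 (c x)" for x
      by (metis comp_apply j_eq_iff lift_aut_j)
    obtain S where S: "finite S" "\<And>h k x. h \<in> field_auts A \<Longrightarrow> k \<in> field_auts A \<Longrightarrow>
        (\<forall>s\<in>S. h s = k s) \<Longrightarrow> j x \<in> E \<Longrightarrow> h x = k x"
      using finite_subextension_agree[OF A E] by blast
    have "lift_aut h \<in> s" if h: "h \<in> field_auts A" "\<forall>s\<in>S. h s = g s" for h
    proof -
      obtain k where k: "k \<in> field_auts A" "k \<circ> g0 = id" "g0 \<circ> k = id"
        using field_auts_inverse[OF g0] by blast
      have "(k \<circ> h) x = x" if x: "j x \<in> E" for x
      proof -
        have "c x = x"
          using c(1) x by (auto simp: field_auts_def image_iff)
        then have "h x = g0 x"
          using S(2)[OF h(1) Basis.prems(1) h(2) x] gc by simp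
        then show ?thesis
          using k(2) by (metis comp_apply id_apply)
      qed
      then have kh: "k \<circ> h \<in> field_auts (j' ` E)"
        using field_auts_comp[OF k(1) h(1)] \<open>E \<subseteq> range j\<close> by (auto simp: field_auts_def)
      have "h = g0 \<circ> (k \<circ> h)"
        using k(3) by (simp flip: comp_assoc)
      then have "lift_aut h = lift_aut g0 \<otimes>\<^bsub>galois_group T (j ` A)\<^esub> lift_aut (k \<circ> h)"
        using lift_aut_mult[OF bij[OF g0] bij[OF kh]] by simp
      then show ?thesis
        using kh by (auto simp: s l_coset_def cE)
    qed
    then show ?case
      using S(1) by blast
  qed
qed

text \<open>The last hypothesis says that U is stable under right multiplication by automorphisms
  fixing xs. Adjoining xs to the base gives a finite subextension E, and with every g the set U
  contains the coset of g by the group fixing E.\<close>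

lemma krull_openI:
  assumes A: "subring_set A" "\<And>x. x \<in> A \<Longrightarrow> inverse x \<in> A"
    and alg: "\<And>u. \<exists>q\<in>polys_in A. q \<noteq> 0 \<and> poly q u = 0"
    and U: "U \<subseteq> lift_aut ` field_auts A"
    and nbhd: "\<And>g c. g \<in> field_auts A \<Longrightarrow> c \<in> field_auts A \<Longrightarrow> lift_aut g \<in> U \<Longrightarrow>
      (\<And>x. x \<in> set xs \<Longrightarrow> c x = x) \<Longrightarrow> lift_aut (g \<circ> c) \<in> U"
  shows "openin (krull_topology T (j ` A)) U"
proof -
  have K: "subfield (j ` A) T"
    by (rule subfield_T[OF A])
  define E where "E = T.finite_extension (j ` A) (map j xs)"
  have xs: "set (map j xs) \<subseteq> carrier T" "\<And>x. x \<in> set (map j xs) \<Longrightarrow> (T.algebraic over (j ` A)) x"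
    using alg algebraic_T by auto
  have AT: "j ` A \<subseteq> carrier T"
    by auto
  have E: "finite_subextension T (j ` A) E"
    unfolding finite_subextension_def E_def
    using T.finite_extension_is_subfield[OF K xs] T.finite_extension_incl[OF AT xs(1)]
      T.finite_extension_finite_dimension(1)[OF K xs] by blast
  have mem: "set (map j xs) \<subseteq> E"
    unfolding E_def by (rule T.finite_extension_mem[OF subfieldE(1)[OF K] xs(1)])
  have AE: "j ` A \<subseteq> E"
    using E by (simp add: finite_subextension_def)
  have ER: "E \<subseteq> range j"
    using E subfieldE(3)[of E T] by (auto simp: finite_subextension_def)
  then have jE: "j ` (j' ` E) = E"
    by (rule image_inv_into_cancel[OF refl])
  let ?G = "galois_group T (j ` A)"
  have cE: "c \<in> field_auts A \<and> (\<forall>x\<in>set xs. c x = x)" if c: "c \<in> field_auts (j' ` E)" for c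
  proof -
    have "c x = x" if "j x \<in> E" for x
      using c that by (auto simp: field_auts_def image_iff)
    then show ?thesis
      using c mem AE by (auto simp: field_auts_def)
  qed
  have id: "id \<in> field_auts (j' ` E)"
    by (auto simp: field_auts_def intro: hom_on_UNIVI)
  have "\<exists>W. openin (krull_topology T (j ` A)) W \<and> s \<in> W \<and> W \<subseteq> U" if s: "s \<in> U" for s
  proof -
    obtain g where g: "g \<in> field_auts A" "s = lift_aut g"
      using U s by blast
    define W where "W = s <#\<^bsub>?G\<^esub> carrier (galois_group T E)"
    have "carrier (galois_group T E) = lift_aut ` field_auts (j' ` E)"
      using carrier_galois_group[of "j' ` E"] by (simp only: jE)
    then have "W = (\<Union>c\<in>field_auts (j' ` E). {s \<otimes>\<^bsub>?G\<^esub> lift_aut c})"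
      by (simp add: W_def l_coset_def)
    also have "\<dots> = (\<Union>c\<in>field_auts (j' ` E). {lift_aut (g \<circ> c)})"
      using g(1) by (intro SUP_cong refl) (simp add: g(2) lift_aut_mult field_auts_def)
    finally have W: "W = (\<lambda>c. lift_aut (g \<circ> c)) ` field_auts (j' ` E)"
      by auto
    have "openin (krull_topology T (j ` A)) W"
      unfolding krull_topology_def
      by (rule topology_generated_by_Basis) (use g E in \<open>auto simp: W_def carrier_galois_group\<close>)
    moreover have "s \<in> W"
      using id g(2) unfolding W by (intro image_eqI[of _ _ id]) auto
    moreover have "W \<subseteq> U"
      unfolding W using nbhd[OF g(1)] cE s g(2) by blast
    ultimately show ?thesis
      by blast
  qed
  then show ?thesis
    by (subst openin_subopen) blast
qed

end

section \<open>Unitriangular matrices of size three\<close>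

definition um :: "int \<Rightarrow> int \<Rightarrow> int \<Rightarrow> int mat" where
  "um x y z = mat 3 3 (\<lambda>(i, j). if i = j then 1 else if i = 0 \<and> j = 1 then x
     else if i = 1 \<and> j = 2 then y else if i = 0 \<and> j = 2 then z else 0)"

lemma um_carrier_mat [simp]: "um x y z \<in> carrier_mat 3 3" "dim_row (um x y z) = 3" "dim_col (um x y z) = 3"
  by (simp_all add: um_def)

lemma um_entries [simp]:
  "um x y z $$ (0, Suc 0) = x" "um x y z $$ (Suc 0, 2) = y" "um x y z $$ (0, 2) = z"
  "um x y z $$ (0, 0) = 1" "um x y z $$ (Suc 0, Suc 0) = 1" "um x y z $$ (2, 2) = 1"
  "um x y z $$ (Suc 0, 0) = 0" "um x y z $$ (2, 0) = 0" "um x y z $$ (2, Suc 0) = 0"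
  by (simp_all add: um_def)

lemma um_eq_iff: "um x y z = um x' y' z' \<longleftrightarrow> x = x' \<and> y = y' \<and> z = z'"
  by (metis um_entries)

lemma less_3_cases: "i < 3 \<Longrightarrow> (i = 0 \<Longrightarrow> P) \<Longrightarrow> (i = Suc 0 \<Longrightarrow> P) \<Longrightarrow> (i = 2 \<Longrightarrow> P) \<Longrightarrow> P"
  for i :: nat
  by linarith

lemma eq_um_iff:
  assumes "M \<in> carrier_mat 3 3"
  shows "M = um x y z \<longleftrightarrow> M $$ (0, Suc 0) = x \<and> M $$ (Suc 0, 2) = y \<and> M $$ (0, 2) = z \<and>
    M $$ (0, 0) = 1 \<and> M $$ (Suc 0, Suc 0) = 1 \<and> M $$ (2, 2) = 1 \<and>
    M $$ (Suc 0, 0) = 0 \<and> M $$ (2, 0) = 0 \<and> M $$ (2, Suc 0) = 0" (is "_ \<longleftrightarrow> ?R")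
proof
  assume R: ?R
  show "M = um x y z"
  proof (rule eq_matI)
    fix i j assume "i < dim_row (um x y z)" "j < dim_col (um x y z)"
    then have "i < 3" "j < 3" by simp_all
    then show "M $$ (i, j) = um x y z $$ (i, j)"
      by (elim less_3_cases) (simp_all add: R)
  qed (use assms in auto)
qed auto

lemma carrier_U3:
  assumes "1 < m"
  shows "carrier (U3_mod m) = {um x y z |x y z. {x, y, z} \<subseteq> {0..<int m}}"
proof
  show "{um x y z |x y z. {x, y, z} \<subseteq> {0..<int m}} \<subseteq> carrier (U3_mod m)"
  proof
    fix M assume "M \<in> {um x y z |x y z. {x, y, z} \<subseteq> {0..<int m}}"
    then obtain x y z where M: "M = um x y z" "{x, y, z} \<subseteq> {0..<int m}"
      by blast
    have "M $$ (i, j) \<in> {0..int m - 1}" if "i < 3" "j < 3" for i j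
      using that by (elim less_3_cases) (use assms M in simp_all)
    moreover have "M $$ (i, i) = 1" if "i < 3" for i
      using that by (elim less_3_cases) (simp_all add: M)
    moreover have "M $$ (i, j) = 0" if "i < 3" "j < i" for i j
    proof -
      have "j < 3" using that by simp
      with that show ?thesis
        by (elim less_3_cases) (simp_all add: M)
    qed
    ultimately show "M \<in> carrier (U3_mod m)"
      by (simp add: unitriangular_def residue_ring_def M(1))
  qed
  show "carrier (U3_mod m) \<subseteq> {um x y z |x y z. {x, y, z} \<subseteq> {0..<int m}}"
  proof
    fix M assume "M \<in> carrier (U3_mod m)"
    then have M: "M \<in> carrier_mat 3 3" "\<And>i j. i < 3 \<Longrightarrow> j < 3 \<Longrightarrow> M $$ (i, j) \<in> {0..<int m}"
      "\<And>i. i < 3 \<Longrightarrow> M $$ (i, i) = 1" "\<And>i j. i < 3 \<Longrightarrow> j < i \<Longrightarrow> M $$ (i, j) = 0"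
      by (auto simp: unitriangular_def residue_ring_def)
    have "M = um (M $$ (0, 1)) (M $$ (1, 2)) (M $$ (0, 2))"
      using M(3)[of 0] M(3)[of 1] M(3)[of 2] M(4)[of 1 0] M(4)[of 2 0] M(4)[of 2 1]
      by (simp add: eq_um_iff[OF M(1)])
    then show "M \<in> {um x y z |x y z. {x, y, z} \<subseteq> {0..<int m}}"
      using M(2)[of 0 1] M(2)[of 1 2] M(2)[of 0 2]
      by (intro CollectI exI[of _ "M $$ (0, 1)"] exI[of _ "M $$ (1, 2)"] exI[of _ "M $$ (0, 2)"]) simp
  qed
qed

lemma mult_U3:
  assumes m: "1 < m" and r: "{x, y, z, x', y', z'} \<subseteq> {0..<int m}"
  shows "um x y z \<otimes>\<^bsub>U3_mod m\<^esub> um x' y' z' =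
    um ((x + x') mod int m) ((y + y') mod int m) ((z + z' + x * y') mod int m)"
proof -
  interpret res: residues "int m" "residue_ring (int m)"
    using m by (simp add: residues_def)
  have three: "{..<3} = {0, 1, 2 :: nat}"
    by auto
  have sum3: "(\<Oplus>\<^bsub>residue_ring (int m)\<^esub>k\<in>{..<3}. f k) = (f 0 + f 1 + f 2) mod int m"
    if "\<And>k. f k \<in> {0..<int m}" for f :: "nat \<Rightarrow> int"
  proof -
    have "f k \<in> carrier (residue_ring (int m))" for k
      using that[of k] by (simp add: residue_ring_def)
    then show ?thesis
      unfolding three
      by (simp add: res.res_add_eq res.res_zero_eq mod_simps ac_simps)
  qed
  show ?thesis
  proof (rule eq_matI)
    fix i j assume ij: "i < dim_row (um ((x + x') mod int m) ((y + y') mod int m) ((z + z' + x * y') mod int m))"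
      "j < dim_col (um ((x + x') mod int m) ((y + y') mod int m) ((z + z' + x * y') mod int m))"
    have b: "(um x y z $$ (i, k) * um x' y' z' $$ (k, j)) mod int m \<in> {0..<int m}" for k
      using m by simp
    have "(um x y z \<otimes>\<^bsub>U3_mod m\<^esub> um x' y' z') $$ (i, j) =
        (\<Oplus>\<^bsub>residue_ring (int m)\<^esub>k\<in>{..<3}. (um x y z $$ (i, k) * um x' y' z' $$ (k, j)) mod int m)"
      using ij by (simp add: unitriangular_def residue_ring_def)
    also have "\<dots> = ((um x y z $$ (i, 0) * um x' y' z' $$ (0, j)) mod int m +
        (um x y z $$ (i, 1) * um x' y' z' $$ (1, j)) mod int m +
        (um x y z $$ (i, 2) * um x' y' z' $$ (2, j)) mod int m) mod int m"
      by (rule sum3[OF b])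
    also have "\<dots> = (um x y z $$ (i, 0) * um x' y' z' $$ (0, j) +
        um x y z $$ (i, 1) * um x' y' z' $$ (1, j) + um x y z $$ (i, 2) * um x' y' z' $$ (2, j)) mod int m"
      unfolding cong_def[symmetric] by (intro cong_add) (simp_all add: cong_def)
    also have "\<dots> = um ((x + x') mod int m) ((y + y') mod int m) ((z + z' + x * y') mod int m) $$ (i, j)"
    proof -
      have "i < 3" "j < 3" using ij by simp_all
      then show ?thesis
        by (elim less_3_cases) (use m in \<open>simp_all add: ac_simps\<close>)
    qed
    finally show "(um x y z \<otimes>\<^bsub>U3_mod m\<^esub> um x' y' z') $$ (i, j) =
        um ((x + x') mod int m) ((y + y') mod int m) ((z + z' + x * y') mod int m) $$ (i, j)" .
  qed (simp_all add: unitriangular_def)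
qed

lemma one_U3: "\<one>\<^bsub>U3_mod m\<^esub> = um 0 0 0"
  by (subst eq_um_iff) (simp_all add: unitriangular_def residue_ring_def)

lemma group_U3:
  assumes m: "1 < m"
  shows "group (U3_mod m)"
proof (rule groupI)
  note mem = carrier_U3[OF m]
  have md: "x mod int m \<in> {0..<int m}" for x
    using m by simp
  show "\<one>\<^bsub>U3_mod m\<^esub> \<in> carrier (U3_mod m)"
    using m unfolding mem one_U3 by force
  fix M assume "M \<in> carrier (U3_mod m)"
  then obtain x y z where M: "M = um x y z" "{x, y, z} \<subseteq> {0..<int m}"
    unfolding mem by blast
  show "\<one>\<^bsub>U3_mod m\<^esub> \<otimes>\<^bsub>U3_mod m\<^esub> M = M"
    using M m by (simp add: one_U3 mult_U3[OF m])
  show "\<exists>M'\<in>carrier (U3_mod m). M' \<otimes>\<^bsub>U3_mod m\<^esub> M = \<one>\<^bsub>U3_mod m\<^esub>"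
  proof (rule bexI)
    have "um ((- x) mod int m) ((- y) mod int m) ((x * y - z) mod int m) \<otimes>\<^bsub>U3_mod m\<^esub> M =
        um (((- x) mod int m + x) mod int m) (((- y) mod int m + y) mod int m)
          (((x * y - z) mod int m + z + (- x) mod int m * y) mod int m)"
      unfolding M(1) using M(2) md by (intro mult_U3[OF m]) simp
    also have "\<dots> = um 0 0 0"
    proof -
      have "[(x * y - z) mod int m + z + (- x) mod int m * y = (x * y - z) + z + (- x) * y] (mod int m)"
        by (intro cong_add cong_mult) (simp_all add: cong_def)
      then show ?thesis
        unfolding um_eq_iff by (simp add: mod_simps cong_def)
    qed
    finally show "um ((- x) mod int m) ((- y) mod int m) ((x * y - z) mod int m) \<otimes>\<^bsub>U3_mod m\<^esub> M = \<one>\<^bsub>U3_mod m\<^esub>"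
      by (simp add: one_U3)
    show "um ((- x) mod int m) ((- y) mod int m) ((x * y - z) mod int m) \<in> carrier (U3_mod m)"
      unfolding mem using md by force
  qed
  fix M' assume "M' \<in> carrier (U3_mod m)"
  then obtain x' y' z' where M': "M' = um x' y' z'" "{x', y', z'} \<subseteq> {0..<int m}"
    unfolding mem by blast
  have MM': "M \<otimes>\<^bsub>U3_mod m\<^esub> M' = um ((x + x') mod int m) ((y + y') mod int m) ((z + z' + x * y') mod int m)"
    unfolding M(1) M'(1) using M(2) M'(2) by (intro mult_U3[OF m]) simp
  show "M \<otimes>\<^bsub>U3_mod m\<^esub> M' \<in> carrier (U3_mod m)"
    unfolding MM' mem using md by force
  fix M'' assume "M'' \<in> carrier (U3_mod m)"
  then obtain x'' y'' z'' where M'': "M'' = um x'' y'' z''" "{x'', y'', z''} \<subseteq> {0..<int m}"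
    unfolding mem by blast
  have M'M'': "M' \<otimes>\<^bsub>U3_mod m\<^esub> M'' =
      um ((x' + x'') mod int m) ((y' + y'') mod int m) ((z' + z'' + x' * y'') mod int m)"
    unfolding M''(1) M'(1) using M''(2) M'(2) by (intro mult_U3[OF m]) simp
  have "(M \<otimes>\<^bsub>U3_mod m\<^esub> M') \<otimes>\<^bsub>U3_mod m\<^esub> M'' =
      um (((x + x') mod int m + x'') mod int m) (((y + y') mod int m + y'') mod int m)
        (((z + z' + x * y') mod int m + z'' + (x + x') mod int m * y'') mod int m)"
    unfolding MM' M''(1) using M''(2) md by (intro mult_U3[OF m]) simp
  also have "\<dots> = um ((x + (x' + x'') mod int m) mod int m) ((y + (y' + y'') mod int m) mod int m)
        ((z + (z' + z'' + x' * y'') mod int m + x * ((y' + y'') mod int m)) mod int m)"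
  proof -
    have "[(z + z' + x * y') mod int m + z'' + (x + x') mod int m * y'' =
        (z + z' + x * y') + z'' + (x + x') * y''] (mod int m)"
      by (intro cong_add cong_mult) (simp_all add: cong_def)
    moreover have "[z + (z' + z'' + x' * y'') mod int m + x * ((y' + y'') mod int m) =
        z + (z' + z'' + x' * y'') + x * (y' + y'')] (mod int m)"
      by (intro cong_add cong_mult) (simp_all add: cong_def)
    moreover have "(z + z' + x * y') + z'' + (x + x') * y'' = z + (z' + z'' + x' * y'') + x * (y' + y'')"
      by (simp add: algebra_simps)
    ultimately have "((z + z' + x * y') mod int m + z'' + (x + x') mod int m * y'') mod int m =
        (z + (z' + z'' + x' * y'') mod int m + x * ((y' + y'') mod int m)) mod int m"
      by (simp only: cong_def)
    then show ?thesis
      unfolding um_eq_iff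
      by (intro conjI) (simp add: mod_simps add.assoc, simp add: mod_simps add.assoc, assumption)
  qed
  also have "\<dots> = M \<otimes>\<^bsub>U3_mod m\<^esub> (M' \<otimes>\<^bsub>U3_mod m\<^esub> M'')"
    unfolding M'M'' M(1) using M(2) md by (intro mult_U3[OF m, symmetric]) simp
  finally show "(M \<otimes>\<^bsub>U3_mod m\<^esub> M') \<otimes>\<^bsub>U3_mod m\<^esub> M'' = M \<otimes>\<^bsub>U3_mod m\<^esub> (M' \<otimes>\<^bsub>U3_mod m\<^esub> M'')" .
qed

lemma reduce_mod_um: "1 < p \<Longrightarrow> reduce_mod p (um x y z) = um (x mod int p) (y mod int p) (z mod int p)"
  by (subst eq_um_iff) (simp_all add: reduce_mod_def)

lemma mult_U3_entries:
  assumes m: "1 < m" and M: "M \<in> carrier (U3_mod m)" "M' \<in> carrier (U3_mod m)"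
  shows "(M \<otimes>\<^bsub>U3_mod m\<^esub> M') $$ (0, Suc 0) = (M $$ (0, Suc 0) + M' $$ (0, Suc 0)) mod int m"
    "(M \<otimes>\<^bsub>U3_mod m\<^esub> M') $$ (Suc 0, 2) = (M $$ (Suc 0, 2) + M' $$ (Suc 0, 2)) mod int m"
    "(M \<otimes>\<^bsub>U3_mod m\<^esub> M') $$ (0, 2) =
      (M $$ (0, 2) + M' $$ (0, 2) + M $$ (0, Suc 0) * M' $$ (Suc 0, 2)) mod int m"
proof -
  obtain x y z x' y' z' where "M = um x y z" "{x, y, z} \<subseteq> {0..<int m}"
    "M' = um x' y' z'" "{x', y', z'} \<subseteq> {0..<int m}"
    using M unfolding carrier_U3[OF m] by blast
  then show "(M \<otimes>\<^bsub>U3_mod m\<^esub> M') $$ (0, Suc 0) = (M $$ (0, Suc 0) + M' $$ (0, Suc 0)) mod int m"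
    "(M \<otimes>\<^bsub>U3_mod m\<^esub> M') $$ (Suc 0, 2) = (M $$ (Suc 0, 2) + M' $$ (Suc 0, 2)) mod int m"
    "(M \<otimes>\<^bsub>U3_mod m\<^esub> M') $$ (0, 2) =
      (M $$ (0, 2) + M' $$ (0, 2) + M $$ (0, Suc 0) * M' $$ (Suc 0, 2)) mod int m"
    by (simp_all add: mult_U3[OF m])
qed

text \<open>Superdiagonal entries are homomorphisms to an abelian group, so conjugation cannot
  change them. This is what makes the argument apply to classes in \<open>H1\<close>.\<close>

lemma conj_U3_entries:
  assumes m: "1 < m" and a: "a \<in> carrier (U3_mod m)" and M: "M \<in> carrier (U3_mod m)"
  shows "(a \<otimes>\<^bsub>U3_mod m\<^esub> M \<otimes>\<^bsub>U3_mod m\<^esub> inv\<^bsub>U3_mod m\<^esub> a) $$ (0, Suc 0) = M $$ (0, Suc 0) mod int m"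
    "(a \<otimes>\<^bsub>U3_mod m\<^esub> M \<otimes>\<^bsub>U3_mod m\<^esub> inv\<^bsub>U3_mod m\<^esub> a) $$ (Suc 0, 2) = M $$ (Suc 0, 2) mod int m"
proof -
  interpret G: group "U3_mod m"
    by (rule group_U3[OF m])
  have ai: "inv\<^bsub>U3_mod m\<^esub> a \<in> carrier (U3_mod m)" "a \<otimes>\<^bsub>U3_mod m\<^esub> M \<in> carrier (U3_mod m)"
    using a M by auto
  have "a \<otimes>\<^bsub>U3_mod m\<^esub> inv\<^bsub>U3_mod m\<^esub> a = um 0 0 0"
    using G.r_inv[OF a] by (simp only: one_U3)
  then have z: "(a $$ (0, Suc 0) + (inv\<^bsub>U3_mod m\<^esub> a) $$ (0, Suc 0)) mod int m = 0"
    "(a $$ (Suc 0, 2) + (inv\<^bsub>U3_mod m\<^esub> a) $$ (Suc 0, 2)) mod int m = 0"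
    using mult_U3_entries(1,2)[OF m a ai(1)] by simp_all
  have key: "((u + v) mod int m + w) mod int m = v mod int m" if "(u + w) mod int m = 0" for u v w :: int
  proof -
    have "((u + v) mod int m + w) mod int m = ((u + w) mod int m + v) mod int m"
      by (simp add: mod_simps ac_simps)
    then show ?thesis
      using that by simp
  qed
  show "(a \<otimes>\<^bsub>U3_mod m\<^esub> M \<otimes>\<^bsub>U3_mod m\<^esub> inv\<^bsub>U3_mod m\<^esub> a) $$ (0, Suc 0) = M $$ (0, Suc 0) mod int m"
    "(a \<otimes>\<^bsub>U3_mod m\<^esub> M \<otimes>\<^bsub>U3_mod m\<^esub> inv\<^bsub>U3_mod m\<^esub> a) $$ (Suc 0, 2) = M $$ (Suc 0, 2) mod int m"
    unfolding mult_U3_entries(1,2)[OF m ai(2,1)] mult_U3_entries(1,2)[OF m a M]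
    by (simp_all add: key z)
qed

section \<open>The representation that does not lift\<close>

lemma (in transported) lift_aut_eq_iff: "lift_aut g = lift_aut h \<longleftrightarrow> g = h"
  by (metis ext j_eq_iff lift_aut_j)

locale heisenberg_field_transported = heisenberg_field p + transported j
  for p :: nat and j :: "omega \<Rightarrow> 'b"
begin

abbreviation "Gal \<equiv> galois_group T (j ` base)"
abbreviation "Krull \<equiv> krull_topology T (j ` base)"

lemma carrier_Gal: "carrier Gal = lift_aut ` Aut"
  by (simp add: carrier_galois_group Aut_def)

lemma Gal_mult: "g \<in> Aut \<Longrightarrow> h \<in> Aut \<Longrightarrow> lift_aut g \<otimes>\<^bsub>Gal\<^esub> lift_aut h = lift_aut (g \<circ> h)"
  by (rule lift_aut_mult) (auto simp: Aut_def field_auts_def)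

lemma p_gt_1: "1 < p" "1 < p ^ 2"
  using prime_gt_1_nat[OF prime_p'] one_less_power[of p 2] by simp_all

text \<open>The indices b and a change places: the corner term of the matrix product is x y', that
  of the composition of automorphisms is b a'. By \<open>restricts_to_unique\<close> the choice of
  the index is immaterial modulo p.\<close>

definition rho :: "('b \<Rightarrow> 'b) \<Rightarrow> int mat" where
  "rho = (\<lambda>s\<in>carrier Gal. SOME M. \<exists>g\<in>Aut. \<exists>a b c. s = lift_aut g \<and> restricts_to g a b c \<and>
     M = um (b mod int p) (a mod int p) (c mod int p))"

lemma rho_lift_aut:
  assumes g: "g \<in> Aut" "restricts_to g a b c"
  shows "rho (lift_aut g) = um (b mod int p) (a mod int p) (c mod int p)"
proof -
  let ?P = "\<lambda>M. \<exists>h\<in>Aut. \<exists>a b c. lift_aut g = lift_aut h \<and> restricts_to h a b c \<and>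
     M = um (b mod int p) (a mod int p) (c mod int p)"
  have "?P (um (b mod int p) (a mod int p) (c mod int p))"
    using g by blast
  then have "?P (SOME M. ?P M)"
    by (rule someI)
  then obtain a' b' c' where *: "restricts_to g a' b' c'"
    "(SOME M. ?P M) = um (b' mod int p) (a' mod int p) (c' mod int p)"
    by (auto simp: lift_aut_eq_iff)
  have "rho (lift_aut g) = (SOME M. ?P M)"
    using g(1) by (simp add: rho_def carrier_Gal)
  also have "\<dots> = um (b mod int p) (a mod int p) (c mod int p)"
    unfolding *(2) um_eq_iff using restricts_to_unique[OF *(1) g(2)] by (simp add: cong_def)
  finally show ?thesis .
qed

lemma rho_hom: "rho \<in> hom Gal (U3_mod p)"
proof (rule homI)
  have md: "x mod int p \<in> {0..<int p}" for x
    using p_gt_1 by simp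
  fix s assume "s \<in> carrier Gal"
  then obtain g where g: "g \<in> Aut" "s = lift_aut g"
    by (auto simp: carrier_Gal)
  obtain a b c where abc: "restricts_to g a b c"
    using Aut_restricts[OF g(1)] by blast
  show "rho s \<in> carrier (U3_mod p)"
    unfolding g(2) rho_lift_aut[OF g(1) abc] carrier_U3[OF p_gt_1(1)]
    by (intro CollectI exI conjI, rule refl) (use md in simp)
  fix s' assume "s' \<in> carrier Gal"
  then obtain h where h: "h \<in> Aut" "s' = lift_aut h"
    by (auto simp: carrier_Gal)
  obtain a' b' c' where abc': "restricts_to h a' b' c'"
    using Aut_restricts[OF h(1)] by blast
  have "rho (s \<otimes>\<^bsub>Gal\<^esub> s') = rho (lift_aut (g \<circ> h))"
    by (simp add: g h Gal_mult)
  also have "\<dots> = um ((b + b') mod int p) ((a + a') mod int p) ((c + c' + a' * b) mod int p)"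
    by (rule rho_lift_aut[OF Aut_comp[OF g(1) h(1)] restricts_to_comp[OF abc abc']])
  also have "\<dots> = um ((b mod int p + b' mod int p) mod int p) ((a mod int p + a' mod int p) mod int p)
      ((c mod int p + c' mod int p + (b mod int p) * (a' mod int p)) mod int p)"
  proof -
    have "[c mod int p + c' mod int p + (b mod int p) * (a' mod int p) = c + c' + b * a'] (mod int p)"
      by (intro cong_add cong_mult) (simp_all add: cong_def)
    then show ?thesis
      unfolding um_eq_iff by (simp add: mod_simps cong_def mult.commute)
  qed
  also have "\<dots> = rho s \<otimes>\<^bsub>U3_mod p\<^esub> rho s'"
    unfolding g(2) h(2) rho_lift_aut[OF g(1) abc] rho_lift_aut[OF h(1) abc']
    using md by (intro mult_U3[OF p_gt_1(1), symmetric]) simp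
  finally show "rho (s \<otimes>\<^bsub>Gal\<^esub> s') = rho s \<otimes>\<^bsub>U3_mod p\<^esub> rho s'" .
qed

text \<open>The first p variables decide the value of \<open>rho\<close>, so its kernel is stable
  under multiplication by automorphisms that fix these finitely many elements.\<close>

lemma rho_continuous: "rho \<in> continuous_homs Gal Krull (U3_mod p)"
proof -
  have "openin Krull (kernel Gal (U3_mod p) rho)"
  proof (rule krull_openI[OF subring_set_base base_inverse algebraic_over_base, where xs = "map omega_var [0..<p]"])
    show "kernel Gal (U3_mod p) rho \<subseteq> lift_aut ` field_auts base"
      using carrier_Gal by (auto simp: kernel_def Aut_def)
    fix g c assume gc: "g \<in> field_auts base" "c \<in> field_auts base"
      and gk: "lift_aut g \<in> kernel Gal (U3_mod p) rho"
      and fixed: "\<And>x. x \<in> set (map omega_var [0..<p]) \<Longrightarrow> c x = x"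
    have gA: "g \<in> Aut" "c \<in> Aut"
      using gc by (simp_all add: Aut_def)
    obtain x y z where xyz: "restricts_to c x y z"
      using Aut_restricts[OF gA(2)] by blast
    have "restricts_to id 0 0 0"
      by (simp add: restricts_to_def L.act_period)
    then have "[x = 0] (mod int p)" "[y = 0] (mod int p)" "[z = 0] (mod int p)"
      using restricts_to_unique[OF xyz, of id 0 0 0] fixed by auto
    then have "rho (lift_aut c) = \<one>\<^bsub>U3_mod p\<^esub>"
      by (simp add: rho_lift_aut[OF gA(2) xyz] one_U3 cong_def)
    moreover have "rho (lift_aut g) = \<one>\<^bsub>U3_mod p\<^esub>"
      using gk by (simp add: kernel_def)
    moreover have "rho (lift_aut (g \<circ> c)) = rho (lift_aut g) \<otimes>\<^bsub>U3_mod p\<^esub> rho (lift_aut c)"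
      using hom_mult[OF rho_hom, of "lift_aut g" "lift_aut c"] gA by (simp add: carrier_Gal Gal_mult)
    ultimately have "rho (lift_aut (g \<circ> c)) = \<one>\<^bsub>U3_mod p\<^esub>"
      using group.is_monoid[OF group_U3[OF p_gt_1(1)]] monoid.l_one monoid.one_closed by metis
    then show "lift_aut (g \<circ> c) \<in> kernel Gal (U3_mod p) rho"
      using Aut_comp[OF gA] by (simp add: kernel_def carrier_Gal)
  qed
  moreover have "rho \<in> extensional (carrier Gal)"
    by (simp add: rho_def)
  ultimately show ?thesis
    using rho_hom by (simp add: continuous_homs_def)
qed

text \<open>The entries of f are the functions A, B, C of \<open>no_lift\<close>. Openness of the
  kernel yields the finite set S, and the superdiagonal entries of \<open>rho\<close> survive the
  conjugation by a.\<close>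

lemma rho_not_reduction:
  assumes f: "f \<in> continuous_homs Gal Krull (U3_mod (p ^ 2))"
    and a: "a \<in> carrier (U3_mod p)"
    and eq: "\<And>s. s \<in> carrier Gal \<Longrightarrow>
      rho s = a \<otimes>\<^bsub>U3_mod p\<^esub> reduce_mod p (f s) \<otimes>\<^bsub>U3_mod p\<^esub> inv\<^bsub>U3_mod p\<^esub> a"
  shows False
proof -
  let ?U = "U3_mod (p ^ 2)"
  interpret U: group ?U
    by (rule group_U3[OF p_gt_1(2)])
  have fhom: "f \<in> hom Gal ?U" and fker: "openin Krull (kernel Gal ?U f)"
    using f by (simp_all add: continuous_homs_def)
  define M where "M g = f (lift_aut g)" for g
  have M: "M g \<in> carrier ?U" if "g \<in> Aut" for g
    using hom_in_carrier[OF fhom, of "lift_aut g"] that by (simp add: M_def carrier_Gal)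
  have M_mult: "M (g \<circ> h) = M g \<otimes>\<^bsub>?U\<^esub> M h" if "g \<in> Aut" "h \<in> Aut" for g h
    using hom_mult[OF fhom, of "lift_aut g" "lift_aut h"] that by (simp add: M_def carrier_Gal Gal_mult)
  have "M id = \<one>\<^bsub>?U\<^esub>"
    using M_mult[OF Aut_id Aut_id] M[OF Aut_id] U.l_cancel_one' by (metis comp_id)
  then have id_ker: "lift_aut id \<in> kernel Gal ?U f"
    using Aut_id by (auto simp: kernel_def carrier_Gal M_def)
  have id: "id \<in> field_auts base"
    using Aut_id by (simp add: Aut_def)
  obtain S where S: "finite S" "\<And>h. h \<in> Aut \<Longrightarrow> (\<forall>s\<in>S. h s = s) \<Longrightarrow> lift_aut h \<in> kernel Gal ?U f"
    using krull_open_contains_nbhd[OF subring_set_base base_inverse fker id id_ker]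
    by (auto simp: Aut_def)
  show False
  proof (rule no_lift[of "\<lambda>g. M g $$ (0, Suc 0)" "\<lambda>g. M g $$ (Suc 0, 2)" "\<lambda>g. M g $$ (0, 2)" S])
    fix g h assume gh: "g \<in> Aut" "h \<in> Aut"
    note e = mult_U3_entries[OF p_gt_1(2) M[OF gh(1)] M[OF gh(2)], folded M_mult[OF gh]]
    show "[M (g \<circ> h) $$ (0, Suc 0) = M g $$ (0, Suc 0) + M h $$ (0, Suc 0)] (mod int (p\<^sup>2))"
      "[M (g \<circ> h) $$ (Suc 0, 2) = M g $$ (Suc 0, 2) + M h $$ (Suc 0, 2)] (mod int (p\<^sup>2))"
      "[M (g \<circ> h) $$ (0, 2) = M g $$ (0, 2) + M h $$ (0, 2) + M g $$ (0, Suc 0) * M h $$ (Suc 0, 2)]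
        (mod int (p\<^sup>2))"
      unfolding e by (simp_all add: cong_def)
  next
    show "finite S" by (rule S(1))
  next
    fix g assume "g \<in> Aut" "\<And>s. s \<in> S \<Longrightarrow> g s = s"
    then have "M g = um 0 0 0"
      using S(2)[of g] \<open>g \<in> Aut\<close> by (simp add: kernel_def M_def one_U3 del: of_nat_power)
    then show "[M g $$ (0, Suc 0) = 0] (mod int (p\<^sup>2)) \<and> [M g $$ (Suc 0, 2) = 0] (mod int (p\<^sup>2)) \<and>
        [M g $$ (0, 2) = 0] (mod int (p\<^sup>2))"
      by simp
  next
    fix g x y z assume g: "g \<in> Aut" "restricts_to g x y z"
    obtain u v w where M': "M g = um u v w"
      using M[OF g(1)] unfolding carrier_U3[OF p_gt_1(2)] by blast
    have red: "reduce_mod p (M g) = um (u mod int p) (v mod int p) (w mod int p)"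
      by (simp add: M' reduce_mod_um[OF p_gt_1(1)])
    have md: "x mod int p \<in> {0..<int p}" for x
      using p_gt_1 by simp
    have "reduce_mod p (M g) \<in> carrier (U3_mod p)"
      unfolding red carrier_U3[OF p_gt_1(1)]
      by (intro CollectI exI conjI, rule refl) (use md in simp)
    note e = conj_U3_entries[OF p_gt_1(1) a this]
    have "um (y mod int p) (x mod int p) (z mod int p) =
        a \<otimes>\<^bsub>U3_mod p\<^esub> reduce_mod p (M g) \<otimes>\<^bsub>U3_mod p\<^esub> inv\<^bsub>U3_mod p\<^esub> a"
      using eq[of "lift_aut g"] g(1) by (simp add: rho_lift_aut[OF g] carrier_Gal M_def)
    note e[folded this]
    then show "[M g $$ (0, Suc 0) = y] (mod int p) \<and> [M g $$ (Suc 0, 2) = x] (mod int p)"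
      unfolding red by (simp add: M' cong_def)
  qed
qed

theorem not_surjective:
  "\<not> H1 Gal Krull (U3_mod p) \<subseteq> H1_map Gal Krull (U3_mod p) (reduce_mod p) ` H1 Gal Krull (U3_mod (p ^ 2))"
proof
  assume "H1 Gal Krull (U3_mod p) \<subseteq> H1_map Gal Krull (U3_mod p) (reduce_mod p) ` H1 Gal Krull (U3_mod (p ^ 2))"
  moreover have "conj_rel Gal Krull (U3_mod p) `` {rho} \<in> H1 Gal Krull (U3_mod p)"
    unfolding H1_def by (rule quotientI[OF rho_continuous])
  ultimately obtain c where c: "c \<in> H1 Gal Krull (U3_mod (p ^ 2))"
    "conj_rel Gal Krull (U3_mod p) `` {rho} = H1_map Gal Krull (U3_mod p) (reduce_mod p) c"
    by blast
  interpret U: group "U3_mod p"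
    by (rule group_U3[OF p_gt_1(1)])
  have "(rho, rho) \<in> conj_rel Gal Krull (U3_mod p)"
    unfolding conj_rel_def using rho_continuous hom_in_carrier[OF rho_hom]
    by (auto intro!: bexI[of _ "\<one>\<^bsub>U3_mod p\<^esub>"])
  then have "rho \<in> H1_map Gal Krull (U3_mod p) (reduce_mod p) c"
    unfolding c(2)[symmetric] by simp
  \<comment> \<open>A class equal to that of \<open>rho\<close> contains \<open>rho\<close>, so some
    member f of c, not necessarily the one representing c below, reduces to a conjugate of
    \<open>rho\<close>.\<close>
  then obtain f where f: "f \<in> c" "(compose (carrier Gal) (reduce_mod p) f, rho) \<in> conj_rel Gal Krull (U3_mod p)"
    by (auto simp: H1_map_def)
  obtain f0 where "c = conj_rel Gal Krull (U3_mod (p ^ 2)) `` {f0}"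
    using c(1) by (auto simp: H1_def elim: quotientE)
  then have "f \<in> continuous_homs Gal Krull (U3_mod (p ^ 2))"
    using f(1) by (simp add: conj_rel_def)
  moreover obtain a where "a \<in> carrier (U3_mod p)" "\<And>s. s \<in> carrier Gal \<Longrightarrow>
      rho s = a \<otimes>\<^bsub>U3_mod p\<^esub> compose (carrier Gal) (reduce_mod p) f s \<otimes>\<^bsub>U3_mod p\<^esub> inv\<^bsub>U3_mod p\<^esub> a"
    using f(2) by (auto simp: conj_rel_def)
  ultimately show False
    by (intro rho_not_reduction[of f a]) (simp_all add: compose_eq del: of_nat_power)
qed

end

theorem mainTheorem2:
  fixes p :: nat
  assumes "Factorial_Ring.prime p" and "p \<ge> 3"
  shows "\<exists>(Fs :: complex set ring) F.
    separable_closure Fs F \<and>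
    (\<exists>\<iota>. \<iota> \<in> Ring.ring_hom (ring_of_type_algebra :: complex ring) (Fs\<lparr>carrier := F\<rparr>)) \<and>
    \<not> H1 (galois_group Fs F) (krull_topology Fs F) (U3_mod p)
      \<subseteq> H1_map (galois_group Fs F) (krull_topology Fs F) (U3_mod p) (reduce_mod p)
          ` H1 (galois_group Fs F) (krull_topology Fs F) (U3_mod (p ^ 2))"
proof -
  obtain j :: "omega \<Rightarrow> complex set" where j: "inj j"
    using embeds_omega by blast
  interpret heisenberg_field_transported p j
    using assms j prime_odd_nat[of p] by unfold_locales auto
  \<comment> \<open>Constants are invariant under the group, so the complex numbers embed into the
    field of invariants.\<close>
  have "(\<lambda>z. j (omega_const z)) \<in> Ring.ring_hom (ring_of_type_algebra :: complex ring) (T\<lparr>carrier := j ` base\<rparr>)"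
    by (rule ring_hom_memI) (auto simp: ring_of_type_algebra_def omega_const_base omega_const_hom)
  moreover have "separable_closure T (j ` base)"
    by (rule separable_closure_T[OF subring_set_base base_inverse algebraic_over_base])
  ultimately show ?thesis
    using not_surjective by blast
qed

end
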